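(* Let $T:[0,1]\to[0,1]$ be a map preserving a probability measure $\mu$ on $[0,1]$. Suppose that $T$ is BV-contracting and that $f$ is a monotonic function from $]0,1[$ to $\mathbb{R}$ satisfying $$\int_0^\infty\sqrt{\lambda(|f|>t)}\,dt<\infty ,$$ where $\lambda$ is the Lebesgue measure. On the probability space $([0,1],\mu)$ let $Y_k=f\circ T^k$ for $k\ge0$, let $F_Y$ be the common distribution function of the $Y_k$, and let $F_n(t)=\frac1n\sum_{i=1}^n\mathbf{1}_{Y_i\le t}$. Then $\{t\mapsto\sqrt n(F_n(t)-F_Y(t)),\ t\in\mathbb{R}\}$ converges in law in $\mathbf{L}^1(\lambda)$, as $n\to\infty$, to a centered Gaussian random variable with covariance function: for any $g,h\in\mathbf{L}^\infty(\lambda)$, $$\Phi_\lambda(g,h)=\int_{\mathbb{R}^2}g(s)h(t)\,C(s,t)\,dt\,ds,$$ with $$C(s,t)=F_Y(t\wedge s)-F_Y(t)F_Y(s)+2\sum_{k\ge1}\big(\mathbb{P}(Y_0\le t,Y_k\le s)-F_Y(t)F_Y(s)\big),$$ where $\mathbb{P}=\mu$.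
   Context: $\lambda$ is the Lebesgue measure on $\mathbb{R}$; $\mathbf{L}^1(\lambda)$ is the space of Lebesgue-integrable real functions with norm $\int_{\mathbb{R}}|x(t)|\,dt$, with dual $\mathbf{L}^\infty(\lambda)$ acting by $g(x)=\int_{\mathbb{R}} g(t)x(t)\,dt$. The covariance function of a centered Gaussian $G$ in $\mathbf{L}^1(\lambda)$ is $(g,h)\mapsto\mathbb{E}(g(G)h(G))$. $t\wedge s$ denotes the minimum. The Perron-Frobenius operator $K:\mathbf{L}^1(\mu)\to\mathbf{L}^1(\mu)$ of $T$ is defined by: for all $h\in\mathbf{L}^1(\mu)$ and $\psi\in\mathbf{L}^\infty(\mu)$, $\int_0^1(Kh)(x)\psi(x)\,\mu(dx)=\int_0^1h(x)(\psi\circ T)(x)\,\mu(dx)$. $BV$ is the class of bounded variation functions from $[0,1]$ to $\mathbb{R}$, and for $h\in BV$, $\|dh\|$ is the variation norm of the measure $dh$. $T$ is BV-contracting if $K$ (viewed as a Markov kernel) is BV-contracting: there exist $C>0$ and $\rho\in[0,1[$ such that $\|dK^n(h)\|\le C\rho^n\|dh\|$ for all $h\in BV$ and all $n\ge1$.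
   Formalization: Also assumes ∫√μ(|f|>t)dt<∞, since the Lebesgue tail condition alone does not put F_n−F_Y in L¹; and the covariance is the symmetrized (Φ(g,h)+Φ(h,g))/2, since the printed C(s,t) is not symmetric in general. *)

theory Defs
  imports "HOL-Probability.Probability"
begin

section \<open>The Banach space of Lebesgue integrable functions on the real line\<close>

text \<open>
  Elements are a.e.-classes of integrable functions. Representatives are taken Borel measurable
  (\<^const>\<open>lborel\<close>); every Lebesgue integrable function is a.e. equal to such a function.
\<close>

definition l1_rel :: "(real \<Rightarrow> real) \<Rightarrow> (real \<Rightarrow> real) \<Rightarrow> bool" where
  "l1_rel u v \<longleftrightarrow> integrable lborel u \<and> integrable lborel v \<and> (AE t in lborel. u t = v t)"

quotient_type l1 = "real \<Rightarrow> real" / partial: l1_rel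
  morphisms rep_l1 abs_l1
proof (rule part_equivpI)
  show "\<exists>u. l1_rel u u"
    by (rule exI[of _ "\<lambda>_. 0"]) (simp add: l1_rel_def)
  show "symp l1_rel"
    by (auto simp: symp_def l1_rel_def)
  show "transp l1_rel"
    unfolding transp_def l1_rel_def by (auto elim: AE_mp)
qed

instantiation l1 :: real_vector
begin

lift_definition zero_l1 :: l1 is "\<lambda>_. 0"
  by (simp add: l1_rel_def)

lift_definition plus_l1 :: "l1 \<Rightarrow> l1 \<Rightarrow> l1" is "\<lambda>u v t. u t + v t"
  unfolding l1_rel_def by (auto elim: AE_mp)

lift_definition minus_l1 :: "l1 \<Rightarrow> l1 \<Rightarrow> l1" is "\<lambda>u v t. u t - v t"
  unfolding l1_rel_def by (auto elim: AE_mp)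

lift_definition uminus_l1 :: "l1 \<Rightarrow> l1" is "\<lambda>u t. - u t"
  unfolding l1_rel_def by auto

lift_definition scaleR_l1 :: "real \<Rightarrow> l1 \<Rightarrow> l1" is "\<lambda>c u t. c * u t"
  unfolding l1_rel_def by auto

instance
proof
  fix x y z :: l1 and a b :: real
  show "x + y + z = x + (y + z)"
    by transfer (auto simp: l1_rel_def algebra_simps)
  show "x + y = y + x"
    by transfer (auto simp: l1_rel_def algebra_simps)
  show "0 + x = x"
    by transfer (auto simp: l1_rel_def)
  show "- x + x = 0"
    by transfer (auto simp: l1_rel_def)
  show "x - y = x + - y"
    by transfer (auto simp: l1_rel_def)
  show "a *\<^sub>R (x + y) = a *\<^sub>R x + a *\<^sub>R y"
    by transfer (auto simp: l1_rel_def algebra_simps)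
  show "(a + b) *\<^sub>R x = a *\<^sub>R x + b *\<^sub>R x"
    by transfer (auto simp: l1_rel_def algebra_simps)
  show "a *\<^sub>R b *\<^sub>R x = (a * b) *\<^sub>R x"
    by transfer (auto simp: l1_rel_def algebra_simps)
  show "1 *\<^sub>R x = x"
    by transfer (auto simp: l1_rel_def)
qed

end

instantiation l1 :: real_normed_vector
begin

lift_definition norm_l1 :: "l1 \<Rightarrow> real" is "\<lambda>u. \<integral>t. \<bar>u t\<bar> \<partial>lborel"
  unfolding l1_rel_def by (auto intro!: integral_cong_AE)

definition sgn_l1 :: "l1 \<Rightarrow> l1" where
  "sgn_l1 x = scaleR (inverse (norm x)) x"

definition dist_l1 :: "l1 \<Rightarrow> l1 \<Rightarrow> real" where
  "dist_l1 x y = norm (x - y)"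

definition uniformity_l1 :: "(l1 \<times> l1) filter" where
  "uniformity_l1 = (INF e\<in>{0<..}. principal {(x, y). dist x y < e})"

definition open_l1 :: "l1 set \<Rightarrow> bool" where
  "open_l1 U \<longleftrightarrow> (\<forall>x\<in>U. eventually (\<lambda>(x', y). x' = x \<longrightarrow> y \<in> U) uniformity)"

instance
proof
  fix x y :: l1 and a :: real
  show "dist x y = norm (x - y)"
    by (rule dist_l1_def)
  show "sgn x = x /\<^sub>R norm x"
    by (simp add: sgn_l1_def)
  show "uniformity = (INF e\<in>{0<..}. principal {(x::l1, y). dist x y < e})"
    by (rule uniformity_l1_def)
  show "open U \<longleftrightarrow> (\<forall>x\<in>U. \<forall>\<^sub>F (x', y) in uniformity. x' = x \<longrightarrow> y \<in> U)" for U :: "l1 set"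
    by (rule open_l1_def)
  show "norm x = 0 \<longleftrightarrow> x = 0"
    by transfer (auto simp: l1_rel_def integral_nonneg_eq_0_iff_AE)
  show "norm (x + y) \<le> norm x + norm y"
    by transfer (auto simp: l1_rel_def Bochner_Integration.integral_add[symmetric]
        simp del: Bochner_Integration.integral_add intro!: integral_mono)
  show "norm (a *\<^sub>R x) = \<bar>a\<bar> * norm x"
    by transfer (auto simp: l1_rel_def abs_mult)
qed

end

definition linfty :: "'a measure \<Rightarrow> ('a \<Rightarrow> real) set" where
  "linfty M = {g \<in> borel_measurable M. \<exists>c. AE x in M. \<bar>g x\<bar> \<le> c}"

definition l1_pair :: "(real \<Rightarrow> real) \<Rightarrow> l1 \<Rightarrow> real" where
  "l1_pair g x = (\<integral>t. g t * rep_l1 x t \<partial>lborel)"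

section \<open>Gaussian laws and convergence in law\<close>

text \<open>The degenerate case of variance \<open>0\<close> is included.\<close>

definition centered_gaussian :: "'b::real_normed_vector measure \<Rightarrow> bool" where
  "centered_gaussian \<gamma> \<longleftrightarrow> prob_space \<gamma> \<and> sets \<gamma> = sets borel \<and>
    (\<forall>\<phi>::'b \<Rightarrow> real. bounded_linear \<phi> \<longrightarrow>
      (\<exists>\<sigma>\<ge>0. distr \<gamma> borel \<phi> =
        (if \<sigma> = 0 then return borel 0 else density lborel (\<lambda>x. ennreal (normal_density 0 \<sigma> x)))))"

definition converges_in_law ::
    "'a measure \<Rightarrow> (nat \<Rightarrow> 'a \<Rightarrow> 'b::topological_space) \<Rightarrow> 'b measure \<Rightarrow> bool" where
  "converges_in_law M X \<gamma> \<longleftrightarrow> (\<forall>n. X n \<in> borel_measurable M) \<and>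
    (\<forall>\<phi>::'b \<Rightarrow> real. continuous_on UNIV \<phi> \<and> bounded (range \<phi>) \<longrightarrow>
      (\<lambda>n. \<integral>x. \<phi> (X n x) \<partial>M) \<longlonglongrightarrow> (\<integral>y. \<phi> y \<partial>\<gamma>))"

section \<open>BV-contracting maps\<close>

text \<open>
  The variation norm of \<open>dh\<close> is the total variation of the function \<open>h\<close> over \<open>[0,1]\<close>.
\<close>

definition variation01 :: "(real \<Rightarrow> real) \<Rightarrow> ennreal" where
  "variation01 h = (SUP xs\<in>{xs. sorted xs \<and> set xs \<subseteq> {0..1}}.
     \<Sum>i<length xs - 1. ennreal \<bar>h (xs ! Suc i) - h (xs ! i)\<bar>)"

definition BV :: "(real \<Rightarrow> real) set" where
  "BV = {h. variation01 h < \<infinity>}"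

definition perron_frobenius ::
    "'a measure \<Rightarrow> ('a \<Rightarrow> 'a) \<Rightarrow> (('a \<Rightarrow> real) \<Rightarrow> 'a \<Rightarrow> real) \<Rightarrow> bool" where
  "perron_frobenius M T P \<longleftrightarrow> (\<forall>h. integrable M h \<longrightarrow> integrable M (P h) \<and>
     (\<forall>\<psi>\<in>linfty M. (\<integral>x. P h x * \<psi> x \<partial>M) = (\<integral>x. h x * \<psi> (T x) \<partial>M)))"

definition kernel_op :: "('a \<Rightarrow> 'a measure) \<Rightarrow> ('a \<Rightarrow> real) \<Rightarrow> 'a \<Rightarrow> real" where
  "kernel_op K h x = (\<integral>y. h y \<partial>K x)"

definition BV_contracting_kernel :: "(real \<Rightarrow> real measure) \<Rightarrow> bool" where
  "BV_contracting_kernel K \<longleftrightarrow> (\<exists>C>0. \<exists>\<rho>\<in>{0..<1::real}. \<forall>h\<in>BV. \<forall>n\<ge>1.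
     variation01 ((kernel_op K ^^ n) h) \<le> ennreal (C * \<rho> ^ n) * variation01 h)"

text \<open>
  The Perron-Frobenius operator determines \<open>K h\<close> only almost everywhere, whereas the variation
  depends on the values at all points; the condition is therefore imposed on some version of it
  as a Markov kernel.
\<close>

definition BV_contracting_map :: "real measure \<Rightarrow> (real \<Rightarrow> real) \<Rightarrow> bool" where
  "BV_contracting_map M T \<longleftrightarrow> (\<exists>K \<in> M \<rightarrow>\<^sub>M prob_algebra M.
     perron_frobenius M T (kernel_op K) \<and> BV_contracting_kernel K)"

section \<open>The empirical process and its limiting covariance\<close>

definition empirical_process ::
    "'a measure \<Rightarrow> (nat \<Rightarrow> 'a \<Rightarrow> real) \<Rightarrow> nat \<Rightarrow> 'a \<Rightarrow> real \<Rightarrow> real" where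
  "empirical_process M Y n \<omega> t =
     sqrt n * ((1 / n) * (\<Sum>i=1..n. indicator {..t} (Y i \<omega>)) - cdf (distr M borel (Y 0)) t)"

definition cov_term :: "'a measure \<Rightarrow> (nat \<Rightarrow> 'a \<Rightarrow> real) \<Rightarrow> real \<Rightarrow> real \<Rightarrow> nat \<Rightarrow> real" where
  "cov_term M Y s t k = measure M {\<omega> \<in> space M. Y 0 \<omega> \<le> t \<and> Y k \<omega> \<le> s}
     - cdf (distr M borel (Y 0)) t * cdf (distr M borel (Y 0)) s"

definition lim_cov :: "'a measure \<Rightarrow> (nat \<Rightarrow> 'a \<Rightarrow> real) \<Rightarrow> real \<Rightarrow> real \<Rightarrow> real" where
  "lim_cov M Y s t = cdf (distr M borel (Y 0)) (min t s)
     - cdf (distr M borel (Y 0)) t * cdf (distr M borel (Y 0)) s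
     + 2 * (\<Sum>k. cov_term M Y s t (Suc k))"

definition \<Phi> ::
    "'a measure \<Rightarrow> (nat \<Rightarrow> 'a \<Rightarrow> real) \<Rightarrow> (real \<Rightarrow> real) \<Rightarrow> (real \<Rightarrow> real) \<Rightarrow> real" where
  "\<Phi> M Y g h = (\<integral>(s, t). g s * h t * lim_cov M Y s t \<partial>(lborel \<Otimes>\<^sub>M lborel))"

text \<open>
  For a non-reversible sequence \<open>lim_cov M Y s t\<close> is not symmetric in \<open>s\<close> and \<open>t\<close>, hence neither is
  the bilinear form \<open>\<Phi>\<close>, whereas a covariance function is. The covariance function with
  quadratic form \<open>\<Phi> g g\<close> is the symmetric part of \<open>\<Phi>\<close>.
\<close>

definition \<Phi>_sym ::
    "'a measure \<Rightarrow> (nat \<Rightarrow> 'a \<Rightarrow> real) \<Rightarrow> (real \<Rightarrow> real) \<Rightarrow> (real \<Rightarrow> real) \<Rightarrow> real" where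
  "\<Phi>_sym M Y g h = (\<Phi> M Y g h + \<Phi> M Y h g) / 2"

end

(*
  Spectral perturbation gives the central limit theorem for a bounded variation observable h of
  mean zero: solving two Poisson equations yields an eigenfunction v of the twisted operator
  u -> K (exp (i theta h) u), up to an error of order theta^3, with eigenvalue
  1 - theta^2 sigma^2 / 2. Hence E (v exp (i theta S_n)) is nearly a geometric sequence in n, and
  theta = 1 / sqrt n gives the limit exp (- sigma^2 / 2).

  Indicators of {f <= t} have variation at most 3, so the finite dimensional laws of the empirical
  process converge to Gaussian ones, and variances are bounded by P (s < Y <= t) uniformly in n.
  By the tail condition the process is therefore approximated in L1, uniformly in n, by step
  functions of its values at finitely many rational points. A Gaussian sequence indexed by the
  rational points, built from independent normal variables, yields step functions converging almost
  surely in L1; their limit has the required law.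
*)

theory Submission
  imports Defs "HOL-Library.Countable" "HOL-Real_Asymp.Real_Asymp"
begin

section \<open>Bounded variation on the unit interval\<close>

definition bv :: "real \<Rightarrow> (real \<Rightarrow> real) \<Rightarrow> bool" where
  "bv V h \<longleftrightarrow> (\<forall>xs. sorted xs \<longrightarrow> set xs \<subseteq> {0..1} \<longrightarrow>
     (\<Sum>i<length xs - 1. \<bar>h (xs ! Suc i) - h (xs ! i)\<bar>) \<le> V)"

lemma bvD: "bv V h \<Longrightarrow> sorted xs \<Longrightarrow> set xs \<subseteq> {0..1} \<Longrightarrow>
    (\<Sum>i<length xs - 1. \<bar>h (xs ! Suc i) - h (xs ! i)\<bar>) \<le> V"
  by (auto simp: bv_def)

lemma bv_nonneg: "bv V h \<Longrightarrow> 0 \<le> V"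
  using bvD[of V h "[]"] by simp

lemma bv_iff_variation01:
  assumes "0 \<le> V"
  shows "bv V h \<longleftrightarrow> variation01 h \<le> ennreal V"
  using assms unfolding bv_def variation01_def
  by (auto simp: SUP_le_iff sum_nonneg)

lemma bv_mono: "bv V h \<Longrightarrow> V \<le> V' \<Longrightarrow> bv V' h"
  unfolding bv_def by (meson order_trans)

lemma bv_imp_BV: "bv V h \<Longrightarrow> h \<in> BV"
  using bv_iff_variation01[OF bv_nonneg, of V h] by (auto simp: BV_def intro: le_less_trans)

lemma nth_in_unit_interval:
  fixes xs :: "real list"
  assumes "set xs \<subseteq> {0..1}" "i < length xs - 1"
  shows "xs ! i \<in> {0..1}" "xs ! Suc i \<in> {0..1}"
  using assms by (metis Suc_lessD less_diff_conv Suc_eq_plus1 nth_mem subsetD)+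

lemma bv_cong:
  assumes "bv V h" "\<And>x. x \<in> {0..1} \<Longrightarrow> h' x = h x"
  shows "bv V h'"
  unfolding bv_def
proof (intro allI impI)
  fix xs :: "real list" assume xs: "sorted xs" "set xs \<subseteq> {0..1}"
  have "(\<Sum>i<length xs - 1. \<bar>h' (xs ! Suc i) - h' (xs ! i)\<bar>)
      = (\<Sum>i<length xs - 1. \<bar>h (xs ! Suc i) - h (xs ! i)\<bar>)"
    by (intro sum.cong refl) (simp only: assms(2) nth_in_unit_interval[OF xs(2)] lessThan_iff)
  also have "\<dots> \<le> V" by (rule bvD[OF assms(1) xs])
  finally show "(\<Sum>i<length xs - 1. \<bar>h' (xs ! Suc i) - h' (xs ! i)\<bar>) \<le> V" .
qed

lemma bv_diff_le:
  assumes "bv V h" "x \<in> {0..1}" "y \<in> {0..1}"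
  shows "\<bar>h x - h y\<bar> \<le> V"
proof (cases "x \<le> y")
  case True
  then show ?thesis using bvD[OF assms(1), of "[x, y]"] assms(2,3) by (simp add: abs_minus_commute)
next
  case False
  then show ?thesis using bvD[OF assms(1), of "[y, x]"] assms(2,3) by simp
qed

lemma bv_const: "bv 0 (\<lambda>_. c)"
  by (simp add: bv_def)

lemma bv_increment:
  assumes u: "bv U u" and v: "bv V v" and ab: "0 \<le> a" "0 \<le> b"
    and le: "\<And>x y. x \<in> {0..1} \<Longrightarrow> y \<in> {0..1} \<Longrightarrow> \<bar>h x - h y\<bar> \<le> a * \<bar>u x - u y\<bar> + b * \<bar>v x - v y\<bar>"
  shows "bv (a * U + b * V) h"
  unfolding bv_def
proof (intro allI impI)
  fix xs :: "real list" assume xs: "sorted xs" "set xs \<subseteq> {0..1}"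
  have "(\<Sum>i<length xs - 1. \<bar>h (xs ! Suc i) - h (xs ! i)\<bar>)
      \<le> (\<Sum>i<length xs - 1. a * \<bar>u (xs ! Suc i) - u (xs ! i)\<bar> + b * \<bar>v (xs ! Suc i) - v (xs ! i)\<bar>)"
    by (intro sum_mono le) (simp_all only: nth_in_unit_interval[OF xs(2)] lessThan_iff)
  also have "\<dots> \<le> a * U + b * V"
    unfolding sum.distrib sum_distrib_left[symmetric]
    by (intro add_mono mult_left_mono bvD[OF u xs] bvD[OF v xs] ab)
  finally show "(\<Sum>i<length xs - 1. \<bar>h (xs ! Suc i) - h (xs ! i)\<bar>) \<le> a * U + b * V" .
qed

lemma bv_add: "bv U u \<Longrightarrow> bv V v \<Longrightarrow> bv (U + V) (\<lambda>x. u x + v x)"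
  using bv_increment[of U u V v 1 1 "\<lambda>x. u x + v x"] by simp

lemma bv_diff: "bv U u \<Longrightarrow> bv V v \<Longrightarrow> bv (U + V) (\<lambda>x. u x - v x)"
  using bv_increment[of U u V v 1 1 "\<lambda>x. u x - v x"] by simp

lemma bv_cmult: "bv U u \<Longrightarrow> bv (\<bar>c\<bar> * U) (\<lambda>x. c * u x)"
  using bv_increment[of U u 0 "\<lambda>_. 0" "\<bar>c\<bar>" 0 "\<lambda>x. c * u x"]
  by (simp add: bv_const right_diff_distrib[symmetric] abs_mult)

lemma bv_mult:
  assumes u: "bv U u" and v: "bv V v"
    and "\<And>x. x \<in> {0..1} \<Longrightarrow> \<bar>u x\<bar> \<le> A" "\<And>x. x \<in> {0..1} \<Longrightarrow> \<bar>v x\<bar> \<le> B"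
  shows "bv (B * U + A * V) (\<lambda>x. u x * v x)"
proof (rule bv_increment[OF u v])
  show "0 \<le> B" "0 \<le> A" using assms(3,4)[of 0] by auto
  fix x y :: real assume xy: "x \<in> {0..1}" "y \<in> {0..1}"
  have "u x * v x - u y * v y = (u x - u y) * v x + u y * (v x - v y)"
    by (simp add: algebra_simps)
  then have "\<bar>u x * v x - u y * v y\<bar> \<le> \<bar>v x\<bar> * \<bar>u x - u y\<bar> + \<bar>u y\<bar> * \<bar>v x - v y\<bar>"
    by (metis abs_mult abs_triangle_ineq mult.commute)
  also have "\<dots> \<le> B * \<bar>u x - u y\<bar> + A * \<bar>v x - v y\<bar>"
    using assms(3)[OF xy(2)] assms(4)[OF xy(1)] by (intro add_mono mult_right_mono) auto
  finally show "\<bar>u x * v x - u y * v y\<bar> \<le> B * \<bar>u x - u y\<bar> + A * \<bar>v x - v y\<bar>" .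
qed

lemma bv_suminf:
  assumes bv: "\<And>k. bv (V k) (u k)" and V: "summable V"
    and u: "\<And>x. x \<in> {0..1} \<Longrightarrow> summable (\<lambda>k. u k x)"
  shows "bv (suminf V) (\<lambda>x. \<Sum>k. u k x)"
  unfolding bv_def
proof (intro allI impI)
  fix xs :: "real list" assume xs: "sorted xs" "set xs \<subseteq> {0..1}"
  let ?I = "{..<length xs - 1}"
  define d where "d k i = \<bar>u k (xs ! Suc i) - u k (xs ! i)\<bar>" for k i
  have in01: "xs ! i \<in> {0..1}" "xs ! Suc i \<in> {0..1}" if "i \<in> ?I" for i
    using that nth_in_unit_interval[OF xs(2)] by auto
  have d_le: "d k i \<le> V k" if "i \<in> ?I" for k i
    unfolding d_def using in01[OF that] by (intro bv_diff_le[OF bv])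
  have sd: "summable (\<lambda>k. d k i)" if "i \<in> ?I" for i
    by (rule summable_comparison_test'[OF V, of 0]) (use d_le[OF that] in \<open>auto simp: d_def\<close>)
  have "(\<Sum>i\<in>?I. \<bar>(\<Sum>k. u k (xs ! Suc i)) - (\<Sum>k. u k (xs ! i))\<bar>) \<le> (\<Sum>i\<in>?I. \<Sum>k. d k i)"
  proof (rule sum_mono)
    fix i assume i: "i \<in> ?I"
    have "\<bar>(\<Sum>k. u k (xs ! Suc i)) - (\<Sum>k. u k (xs ! i))\<bar> = \<bar>\<Sum>k. u k (xs ! Suc i) - u k (xs ! i)\<bar>"
      using in01[OF i] by (simp add: suminf_diff u)
    also have "\<dots> \<le> (\<Sum>k. d k i)"
      using summable_rabs[of "\<lambda>k. u k (xs ! Suc i) - u k (xs ! i)"] sd[OF i] by (simp add: d_def)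
    finally show "\<bar>(\<Sum>k. u k (xs ! Suc i)) - (\<Sum>k. u k (xs ! i))\<bar> \<le> (\<Sum>k. d k i)" .
  qed
  also have "\<dots> = (\<Sum>k. \<Sum>i\<in>?I. d k i)"
    by (rule suminf_sum[symmetric]) (rule sd)
  also have "\<dots> \<le> suminf V"
    by (intro suminf_le summable_sum sd V) (use bvD[OF bv xs] in \<open>auto simp: d_def\<close>)
  finally show "(\<Sum>i\<in>?I. \<bar>(\<Sum>k. u k (xs ! Suc i)) - (\<Sum>k. u k (xs ! i))\<bar>) \<le> suminf V" .
qed

lemma bv_mono_on:
  assumes "mono_on {0..1} u" "\<And>x. x \<in> {0..1} \<Longrightarrow> u x \<in> {0..1}"
  shows "bv 1 u"
  unfolding bv_def
proof (intro allI impI)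
  fix xs :: "real list" assume xs: "sorted xs" "set xs \<subseteq> {0..1}"
  have in01: "xs ! i \<in> {0..1}" if "i < length xs" for i
    using that xs(2) nth_mem by blast
  have "(\<Sum>i<length xs - 1. \<bar>u (xs ! Suc i) - u (xs ! i)\<bar>)
      = (\<Sum>i<length xs - 1. u (xs ! Suc i) - u (xs ! i))"
  proof (rule sum.cong[OF refl])
    fix i assume "i \<in> {..<length xs - 1}"
    then have i: "i < length xs" "Suc i < length xs" by auto
    have "xs ! i \<le> xs ! Suc i" using xs(1) i by (simp add: sorted_iff_nth_Suc)
    then have "u (xs ! i) \<le> u (xs ! Suc i)"
      using assms(1) in01[OF i(1)] in01[OF i(2)] by (auto simp: mono_on_def)
    then show "\<bar>u (xs ! Suc i) - u (xs ! i)\<bar> = u (xs ! Suc i) - u (xs ! i)" by simp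
  qed
  also have "\<dots> = u (xs ! (length xs - 1)) - u (xs ! 0)"
    by (rule sum_lessThan_telescope)
  also have "\<dots> \<le> 1"
  proof (cases "xs = []")
    case False
    then show ?thesis using assms(2)[OF in01[of 0]] assms(2)[OF in01[of "length xs - 1"]] by auto
  qed simp
  finally show "(\<Sum>i<length xs - 1. \<bar>u (xs ! Suc i) - u (xs ! i)\<bar>) \<le> 1" .
qed

lemma bv_antimono_on:
  assumes "antimono_on {0..1} u" "\<And>x. x \<in> {0..1} \<Longrightarrow> u x \<in> {0..1}"
  shows "bv 1 u"
proof -
  have "bv 1 (\<lambda>x. 1 - u x)"
    using assms by (intro bv_mono_on) (auto simp: monotone_on_def)
  from bv_diff[OF bv_const[of 1] this] show ?thesis by simp
qed

section \<open>The transfer operator\<close>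

locale bv_map = prob_space \<mu> for \<mu> :: "real measure" +
  fixes T :: "real \<Rightarrow> real" and K :: "real \<Rightarrow> real measure" and C \<rho> :: real
  assumes space_\<mu>: "space \<mu> = {0..1}"
    and T_measurable[measurable]: "T \<in> \<mu> \<rightarrow>\<^sub>M \<mu>"
    and T_preserving: "distr \<mu> \<mu> T = \<mu>"
    and K_kernel: "K \<in> \<mu> \<rightarrow>\<^sub>M prob_algebra \<mu>"
    and K_perron_frobenius: "perron_frobenius \<mu> T (kernel_op K)"
    and C_pos: "C > 0" and \<rho>_nonneg: "0 \<le> \<rho>" and \<rho>_less_1: "\<rho> < 1"
    and K_contracting: "\<And>h n. h \<in> BV \<Longrightarrow> n \<ge> 1 \<Longrightarrow>
      variation01 ((kernel_op K ^^ n) h) \<le> ennreal (C * \<rho> ^ n) * variation01 h"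
begin

abbreviation Kop :: "(real \<Rightarrow> real) \<Rightarrow> real \<Rightarrow> real" where
  "Kop \<equiv> kernel_op K"

definition bm :: "(real \<Rightarrow> real) \<Rightarrow> bool" where
  "bm h \<longleftrightarrow> h \<in> borel_measurable \<mu> \<and> (\<exists>B. \<forall>x\<in>space \<mu>. \<bar>h x\<bar> \<le> B)"

lemma bmI: "h \<in> borel_measurable \<mu> \<Longrightarrow> (\<And>x. x \<in> space \<mu> \<Longrightarrow> \<bar>h x\<bar> \<le> B) \<Longrightarrow> bm h"
  by (auto simp: bm_def)

lemma bm_measurable[measurable_dest]: "bm h \<Longrightarrow> h \<in> borel_measurable \<mu>"
  by (simp add: bm_def)

lemma bmE:
  assumes "bm h" obtains B where "0 \<le> B" "\<And>x. x \<in> space \<mu> \<Longrightarrow> \<bar>h x\<bar> \<le> B"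
  using assms unfolding bm_def by (metis abs_ge_zero order_trans linear)

lemma bm_const: "bm (\<lambda>_. c)"
  by (rule bmI[of _ "\<bar>c\<bar>"]) auto

lemma bm_add: assumes "bm u" "bm v" shows "bm (\<lambda>x. u x + v x)"
proof -
  obtain A where "\<And>x. x \<in> space \<mu> \<Longrightarrow> \<bar>u x\<bar> \<le> A" using bmE[OF assms(1)] by blast
  moreover obtain B where "\<And>x. x \<in> space \<mu> \<Longrightarrow> \<bar>v x\<bar> \<le> B" using bmE[OF assms(2)] by blast
  ultimately show ?thesis using assms[THEN bm_measurable]
    by (intro bmI[of _ "A + B"]) (auto intro: order_trans[OF abs_triangle_ineq] add_mono)
qed

lemma bm_mult: assumes "bm u" "bm v" shows "bm (\<lambda>x. u x * v x)"
proof -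
  obtain A where "0 \<le> A" "\<And>x. x \<in> space \<mu> \<Longrightarrow> \<bar>u x\<bar> \<le> A" using bmE[OF assms(1)] by blast
  moreover obtain B where "\<And>x. x \<in> space \<mu> \<Longrightarrow> \<bar>v x\<bar> \<le> B" using bmE[OF assms(2)] by blast
  ultimately show ?thesis using assms[THEN bm_measurable]
    by (intro bmI[of _ "A * B"]) (auto simp: abs_mult intro!: mult_mono)
qed

lemma bm_cmult: "bm u \<Longrightarrow> bm (\<lambda>x. c * u x)"
  by (intro bm_mult bm_const)

lemma bm_diff: "bm u \<Longrightarrow> bm v \<Longrightarrow> bm (\<lambda>x. u x - v x)"
  using bm_add[of u "\<lambda>x. -1 * v x"] bm_cmult[of v "-1"] by simp

lemma bm_sum: "(\<And>i. i \<in> I \<Longrightarrow> bm (u i)) \<Longrightarrow> bm (\<lambda>x. \<Sum>i\<in>I. u i x)"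
  by (induction I rule: infinite_finite_induct) (auto intro: bm_const bm_add)

lemma T_space: "x \<in> space \<mu> \<Longrightarrow> T x \<in> space \<mu>"
  by (rule measurable_space[OF T_measurable])

lemma T_pow_measurable[measurable]: "(T ^^ n) \<in> \<mu> \<rightarrow>\<^sub>M \<mu>"
  by (rule measurable_compose_n) simp

lemma T_pow_space: "x \<in> space \<mu> \<Longrightarrow> (T ^^ n) x \<in> space \<mu>"
  by (rule measurable_space[OF T_pow_measurable])

lemma distr_T_pow: "distr \<mu> \<mu> (T ^^ n) = \<mu>"
proof (induction n)
  case (Suc n)
  have "distr \<mu> \<mu> (T ^^ Suc n) = distr (distr \<mu> \<mu> (T ^^ n)) \<mu> T"
    by (subst distr_distr) auto
  then show ?case by (simp only: Suc T_preserving)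
qed (simp add: distr_id2 id_def)

lemma integral_T_pow:
  fixes h :: "real \<Rightarrow> 'b::{banach, second_countable_topology}"
  assumes [measurable]: "h \<in> borel_measurable \<mu>"
  shows "(\<integral>x. h ((T ^^ n) x) \<partial>\<mu>) = (\<integral>x. h x \<partial>\<mu>)"
  using integral_distr[of "T ^^ n" \<mu> \<mu> h] by (simp add: distr_T_pow)

lemma bm_T_pow:
  assumes "bm h" shows "bm (\<lambda>x. h ((T ^^ n) x))"
proof -
  note [measurable] = bm_measurable[OF assms]
  obtain B where "\<And>x. x \<in> space \<mu> \<Longrightarrow> \<bar>h x\<bar> \<le> B" using bmE[OF assms(1)] by blast
  then show ?thesis by (intro bmI[of _ B]) (auto intro: T_pow_space)
qed

lemma bm_T: "bm h \<Longrightarrow> bm (\<lambda>x. h (T x))"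
  using bm_T_pow[of h 1] by simp

lemma bm_integrable: assumes "bm h" shows "integrable \<mu> h"
proof -
  note [measurable] = bm_measurable[OF assms]
  obtain B where "\<And>x. x \<in> space \<mu> \<Longrightarrow> \<bar>h x\<bar> \<le> B" using bmE[OF assms(1)] by blast
  then show ?thesis by (intro integrable_const_bound[of _ B]) (auto intro!: AE_I2)
qed

lemma bm_linfty: "bm h \<Longrightarrow> h \<in> linfty \<mu>"
  by (auto simp: bm_def linfty_def intro!: AE_I2)

lemma prob_space_K: "x \<in> space \<mu> \<Longrightarrow> prob_space (K x)"
  and sets_K: "x \<in> space \<mu> \<Longrightarrow> sets (K x) = sets \<mu>"
  and space_K: "x \<in> space \<mu> \<Longrightarrow> space (K x) = space \<mu>"
  using measurable_space[OF K_kernel, of x] by (auto simp: space_prob_algebra dest: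
      sets_eq_imp_space_eq)

lemma bm_integrable_K: assumes "bm h" "x \<in> space \<mu>" shows "integrable (K x) h"
proof -
  interpret Kx: prob_space "K x" by (rule prob_space_K[OF assms(2)])
  note [measurable] = bm_measurable[OF assms(1)]
  note [measurable_cong] = sets_K[OF assms(2)]
  obtain B where "\<And>x. x \<in> space \<mu> \<Longrightarrow> \<bar>h x\<bar> \<le> B" using bmE[OF assms(1)] by blast
  then show ?thesis by (intro Kx.integrable_const_bound[of _ B]) (auto intro!: AE_I2 simp: space_K
      assms(2))
qed

lemma Kop_add: "bm u \<Longrightarrow> bm v \<Longrightarrow> x \<in> space \<mu> \<Longrightarrow> Kop (\<lambda>y. u y + v y) x = Kop u x + Kop v x"
  unfolding kernel_op_def by (intro Bochner_Integration.integral_add bm_integrable_K)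

lemma Kop_cmult: "Kop (\<lambda>y. c * u y) x = c * Kop u x"
  by (simp add: kernel_op_def)

lemma Kop_diff: "bm u \<Longrightarrow> bm v \<Longrightarrow> x \<in> space \<mu> \<Longrightarrow> Kop (\<lambda>y. u y - v y) x = Kop u x - Kop v x"
  unfolding kernel_op_def by (intro Bochner_Integration.integral_diff bm_integrable_K)

lemma Kop_const: "x \<in> space \<mu> \<Longrightarrow> Kop (\<lambda>_. c) x = c"
  using prob_space.prob_space[OF prob_space_K, of x] by (simp add: kernel_op_def)

lemma Kop_le:
  assumes "bm h" "x \<in> space \<mu>" "\<And>y. y \<in> space \<mu> \<Longrightarrow> \<bar>h y\<bar> \<le> B"
  shows "\<bar>Kop h x\<bar> \<le> B"
proof -
  interpret Kx: prob_space "K x" by (rule prob_space_K[OF assms(2)])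
  have "\<bar>Kop h x\<bar> \<le> (\<integral>y. \<bar>h y\<bar> \<partial>K x)"
    unfolding kernel_op_def by (rule integral_abs_bound)
  also have "\<dots> \<le> (\<integral>y. B \<partial>K x)"
    using bm_integrable_K[OF assms(1,2)] assms(2,3)
    by (intro integral_mono) (auto simp: space_K)
  also have "\<dots> = B" by (simp add: Kx.prob_space)
  finally show ?thesis .
qed

lemma bm_Kop: assumes "bm h" shows "bm (Kop h)"
proof -
  note [measurable] = bm_measurable[OF assms]
  obtain B where "\<And>x. x \<in> space \<mu> \<Longrightarrow> \<bar>h x\<bar> \<le> B" using bmE[OF assms(1)] by blast
  then show ?thesis
    using measurable_compose[OF measurable_prob_algebraD[OF K_kernel]
        integral_measurable_subprob_algebra, of h]
    by (intro bmI[of _ B] Kop_le assms) (auto simp: kernel_op_def[abs_def])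
qed

lemma bm_Kop_pow: "bm h \<Longrightarrow> bm ((Kop ^^ n) h)"
  by (induction n) (auto intro: bm_Kop)

lemma Kop_dual: "bm h \<Longrightarrow> bm \<psi> \<Longrightarrow> (\<integral>x. Kop h x * \<psi> x \<partial>\<mu>) = (\<integral>x. h x * \<psi> (T x) \<partial>\<mu>)"
  using K_perron_frobenius bm_integrable bm_linfty unfolding perron_frobenius_def by blast

lemma Kop_pow_dual:
  "bm h \<Longrightarrow> bm \<psi> \<Longrightarrow> (\<integral>x. (Kop ^^ n) h x * \<psi> x \<partial>\<mu>) = (\<integral>x. h x * \<psi> ((T ^^ n) x) \<partial>\<mu>)"
proof (induction n arbitrary: \<psi>)
  case (Suc n)
  have "(\<integral>x. (Kop ^^ Suc n) h x * \<psi> x \<partial>\<mu>) = (\<integral>x. (Kop ^^ n) h x * \<psi> (T x) \<partial>\<mu>)"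
    using Suc.prems by (simp add: Kop_dual bm_Kop_pow)
  also have "\<dots> = (\<integral>x. h x * \<psi> (T ((T ^^ n) x)) \<partial>\<mu>)"
    using Suc.prems by (simp add: Suc.IH bm_T)
  finally show ?case by simp
qed simp

lemma integral_Kop_pow: "bm h \<Longrightarrow> (\<integral>x. (Kop ^^ n) h x \<partial>\<mu>) = (\<integral>x. h x \<partial>\<mu>)"
  using Kop_pow_dual[of h "\<lambda>_. 1" n] by (simp add: bm_const)

lemma abs_le_bv:
  assumes "bm u" "bv V u" "(\<integral>x. u x \<partial>\<mu>) = 0" "x \<in> space \<mu>"
  shows "\<bar>u x\<bar> \<le> V"
proof -
  have i: "integrable \<mu> u" by (rule bm_integrable[OF assms(1)])
  have "u x = (\<integral>y. u x - u y \<partial>\<mu>)"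
    using i by (simp add: assms(3) prob_space)
  also have "\<bar>\<dots>\<bar> \<le> (\<integral>y. \<bar>u x - u y\<bar> \<partial>\<mu>)" by (rule integral_abs_bound)
  also have "\<dots> \<le> (\<integral>y. V \<partial>\<mu>)"
    using i assms(4) by (intro integral_mono) (auto simp: space_\<mu> intro!: bv_diff_le[OF assms(2)])
  finally show ?thesis by (simp add: prob_space)
qed

text \<open>The maximum makes the variation bound hold for \<open>n = 0\<close> as well.\<close>

definition C1 :: real where "C1 = max 1 C"

lemma C1_ge_1: "1 \<le> C1"
  by (simp add: C1_def)

lemma bv_Kop_pow:
  assumes "bv V h" shows "bv (C1 * \<rho> ^ n * V) ((Kop ^^ n) h)"
proof (cases n)
  case 0
  have "1 * V \<le> C1 * V" using C1_ge_1 bv_nonneg[OF assms] by (intro mult_right_mono)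
  then show ?thesis using 0 bv_mono[OF assms] by simp
next
  case (Suc m)
  have V: "0 \<le> V" by (rule bv_nonneg[OF assms])
  have "variation01 ((Kop ^^ n) h) \<le> ennreal (C * \<rho> ^ n) * variation01 h"
    using bv_imp_BV[OF assms] Suc by (intro K_contracting) auto
  also have "\<dots> \<le> ennreal (C * \<rho> ^ n) * ennreal V"
    using assms bv_iff_variation01[OF V] by (intro mult_left_mono) auto
  also have "\<dots> = ennreal (C * \<rho> ^ n * V)"
    using V C_pos \<rho>_nonneg by (simp add: ennreal_mult)
  finally have "bv (C * \<rho> ^ n * V) ((Kop ^^ n) h)"
    using V C_pos \<rho>_nonneg by (subst bv_iff_variation01) auto
  then show ?thesis
    by (rule bv_mono) (use V \<rho>_nonneg in \<open>auto simp: C1_def intro!: mult_right_mono\<close>)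
qed

lemma Kop_pow_le:
  assumes "bm h" "bv V h" "(\<integral>x. h x \<partial>\<mu>) = 0" "x \<in> space \<mu>"
  shows "\<bar>(Kop ^^ n) h x\<bar> \<le> C1 * \<rho> ^ n * V"
  by (rule abs_le_bv[OF bm_Kop_pow[OF assms(1)] bv_Kop_pow[OF assms(2)] _ assms(4)])
     (simp only: integral_Kop_pow[OF assms(1)] assms(3))

lemma summable_geom: "summable (\<lambda>n. C1 * \<rho> ^ n * V)"
  by (rule summable_mult2[OF summable_mult[OF summable_geometric]]) (simp add: \<rho>_nonneg \<rho>_less_1)

lemma summable_geom_Suc: "summable (\<lambda>n. C1 * \<rho> ^ Suc n * V)"
  using summable_ignore_initial_segment[OF summable_geom, of 1 V] by (simp only: Suc_eq_plus1)

definition potential :: "(real \<Rightarrow> real) \<Rightarrow> real \<Rightarrow> real" where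
  "potential h x = (\<Sum>n. (Kop ^^ Suc n) h x)"

context
  fixes h V assumes h: "bm h" "bv V h" "(\<integral>x. h x \<partial>\<mu>) = 0"
begin

lemma summable_abs_Kop_pow:
  assumes "x \<in> space \<mu>" shows "summable (\<lambda>n. \<bar>(Kop ^^ Suc n) h x\<bar>)"
proof (rule summable_comparison_test'[OF summable_geom_Suc[of V], of 0])
  show "norm \<bar>(Kop ^^ Suc n) h x\<bar> \<le> C1 * \<rho> ^ Suc n * V" for n
    using Kop_pow_le[OF h assms, of "Suc n"] by (simp only: real_norm_def abs_idempotent)
qed

lemma summable_Kop_pow: "x \<in> space \<mu> \<Longrightarrow> summable (\<lambda>n. (Kop ^^ Suc n) h x)"
  by (rule summable_rabs_cancel[OF summable_abs_Kop_pow])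

lemma bv_potential: "bv (\<Sum>n. C1 * \<rho> ^ Suc n * V) (potential h)"
  unfolding potential_def[abs_def]
  by (rule bv_suminf[OF bv_Kop_pow[OF h(2)] summable_geom_Suc summable_Kop_pow]) (auto simp: space_\<mu>)

lemma bm_potential: "bm (potential h)"
proof (rule bmI)
  note [measurable] = bm_measurable[OF bm_Kop_pow[OF h(1)]]
  show "potential h \<in> borel_measurable \<mu>"
    unfolding potential_def[abs_def] by measurable
  fix x assume x: "x \<in> space \<mu>"
  note s = summable_abs_Kop_pow[OF x]
  have "\<bar>potential h x\<bar> \<le> (\<Sum>n. \<bar>(Kop ^^ Suc n) h x\<bar>)"
    unfolding potential_def by (rule summable_rabs[OF s])
  also have "\<dots> \<le> (\<Sum>n. C1 * \<rho> ^ Suc n * V)"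
    by (rule suminf_le[OF _ s summable_geom_Suc]) (rule Kop_pow_le[OF h x])
  finally show "\<bar>potential h x\<bar> \<le> (\<Sum>n. C1 * \<rho> ^ Suc n * V)" .
qed

lemma Kop_potential:
  assumes x: "x \<in> space \<mu>"
  shows "Kop (potential h) x = potential h x - Kop h x"
proof -
  interpret Kx: prob_space "K x" by (rule prob_space_K[OF x])
  have int: "integrable (K x) ((Kop ^^ n) h)" for n
    by (rule bm_integrable_K[OF bm_Kop_pow[OF h(1)] x])
  have "(\<lambda>n. \<integral>y. (Kop ^^ Suc n) h y \<partial>K x) sums (\<integral>y. potential h y \<partial>K x)"
    unfolding potential_def
  proof (rule sums_integral[OF int])
    show "AE y in K x. summable (\<lambda>n. norm ((Kop ^^ Suc n) h y))"
      unfolding real_norm_def by (intro AE_I2 summable_abs_Kop_pow) (simp add: space_K[OF x])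
    have "(\<integral>y. \<bar>(Kop ^^ Suc n) h y\<bar> \<partial>K x) \<le> C1 * \<rho> ^ Suc n * V" for n
    proof -
      have "(\<integral>y. \<bar>(Kop ^^ Suc n) h y\<bar> \<partial>K x) \<le> (\<integral>y. C1 * \<rho> ^ Suc n * V \<partial>K x)"
        by (intro integral_mono integrable_abs int Kx.integrable_const Kop_pow_le[OF h]) (simp add:
            space_K[OF x])
      then show ?thesis by (simp add: Kx.prob_space)
    qed
    then show "summable (\<lambda>n. \<integral>y. norm ((Kop ^^ Suc n) h y) \<partial>K x)"
      unfolding real_norm_def
      by (intro summable_comparison_test'[OF summable_geom_Suc[of V], of 0])
         (simp only: real_norm_def Bochner_Integration.integral_nonneg abs_ge_zero abs_of_nonneg)
  qed
  then have "(\<lambda>n. (Kop ^^ Suc (Suc n)) h x) sums Kop (potential h) x"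
    by (simp add: kernel_op_def)
  then have "Kop (potential h) x = (\<Sum>n. (Kop ^^ Suc (Suc n)) h x)"
    by (simp add: sums_unique)
  also have "\<dots> = potential h x - Kop h x"
    using suminf_split_head[OF summable_Kop_pow[OF x]] by (simp add: potential_def)
  finally show ?thesis .
qed

lemma integral_mult_potential:
  assumes \<psi>: "bm \<psi>"
  shows "(\<lambda>n. \<integral>x. h x * \<psi> ((T ^^ Suc n) x) \<partial>\<mu>) sums (\<integral>x. potential h x * \<psi> x \<partial>\<mu>)"
proof -
  have int: "integrable \<mu> (\<lambda>x. (Kop ^^ n) h x * \<psi> x)" for n
    by (intro bm_integrable bm_mult bm_Kop_pow h \<psi>)
  obtain B where B: "0 \<le> B" "\<And>x. x \<in> space \<mu> \<Longrightarrow> \<bar>\<psi> x\<bar> \<le> B" using bmE[OF \<psi>] by blast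
  have le: "\<bar>(Kop ^^ n) h y * \<psi> y\<bar> \<le> C1 * \<rho> ^ n * V * B" if "y \<in> space \<mu>" for y n
    unfolding abs_mult using B Kop_pow_le[OF h that]
        by (intro mult_mono) (auto intro: order_trans[OF abs_ge_zero] that)
  have "(\<lambda>n. \<integral>x. (Kop ^^ Suc n) h x * \<psi> x \<partial>\<mu>) sums (\<integral>x. (\<Sum>n. (Kop ^^ Suc n) h x * \<psi> x) \<partial>\<mu>)"
  proof (rule sums_integral[OF int])
    show "AE y in \<mu>. summable (\<lambda>n. norm ((Kop ^^ Suc n) h y * \<psi> y))"
      using le[of _ "Suc _"]
      by (intro AE_I2 summable_comparison_test'[OF summable_mult2[OF summable_geom_Suc[of V], of B],
          of 0])
         (simp only: real_norm_def abs_idempotent)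
    have "(\<integral>y. \<bar>(Kop ^^ Suc n) h y * \<psi> y\<bar> \<partial>\<mu>) \<le> C1 * \<rho> ^ Suc n * V * B" for n
    proof -
      have "(\<integral>y. \<bar>(Kop ^^ Suc n) h y * \<psi> y\<bar> \<partial>\<mu>) \<le> (\<integral>y. C1 * \<rho> ^ Suc n * V * B \<partial>\<mu>)"
        by (intro integral_mono integrable_abs int integrable_const le)
      then show ?thesis by (simp add: prob_space)
    qed
    then show "summable (\<lambda>n. \<integral>y. norm ((Kop ^^ Suc n) h y * \<psi> y) \<partial>\<mu>)"
      unfolding real_norm_def
      by (intro summable_comparison_test'[OF summable_mult2[OF summable_geom_Suc[of V], of B], of 0])
         (simp only: real_norm_def Bochner_Integration.integral_nonneg abs_ge_zero abs_of_nonneg)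
  qed
  moreover have "(\<integral>x. (\<Sum>n. (Kop ^^ Suc n) h x * \<psi> x) \<partial>\<mu>) = (\<integral>x. potential h x * \<psi> x \<partial>\<mu>)"
    unfolding potential_def
    by (intro Bochner_Integration.integral_cong refl suminf_mult2[symmetric] summable_Kop_pow)
  moreover have "(\<integral>x. (Kop ^^ Suc n) h x * \<psi> x \<partial>\<mu>) = (\<integral>x. h x * \<psi> ((T ^^ Suc n) x) \<partial>\<mu>)" for n
    by (rule Kop_pow_dual[OF h(1) \<psi>])
  ultimately show ?thesis by simp
qed

end

end

section \<open>The central limit theorem for bounded variation observables\<close>

lemma approximate_geometric:
  fixes a :: "nat \<Rightarrow> complex" and z :: complex
  assumes step: "\<And>k. norm (a (Suc k) - z * a k) \<le> \<epsilon>" and z: "norm z \<le> L" and L: "1 \<le> L"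
  shows "norm (a n - z ^ n * a 0) \<le> real n * L ^ n * \<epsilon>"
proof (induction n)
  case (Suc n)
  have \<epsilon>: "0 \<le> \<epsilon>" using step[of 0] norm_ge_zero order_trans by blast
  have "a (Suc n) - z ^ Suc n * a 0 = (a (Suc n) - z * a n) + z * (a n - z ^ n * a 0)"
    by (simp add: algebra_simps)
  then have "norm (a (Suc n) - z ^ Suc n * a 0)
      \<le> norm (a (Suc n) - z * a n) + norm z * norm (a n - z ^ n * a 0)"
    by (metis norm_mult norm_triangle_ineq)
  also have "\<dots> \<le> \<epsilon> + L * (real n * L ^ n * \<epsilon>)"
    using step[of n] z Suc L by (intro add_mono mult_mono) auto
  also have "\<dots> \<le> L ^ Suc n * \<epsilon> + L * (real n * L ^ n * \<epsilon>)"
    using mult_right_mono[OF one_le_power[OF L, of "Suc n"] \<epsilon>] by simp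
  finally show ?case by (simp add: algebra_simps)
qed simp

context bv_map
begin

lemma integrable_norm_bound:
  fixes f :: "real \<Rightarrow> 'b::{banach, second_countable_topology}"
  assumes "f \<in> borel_measurable \<mu>" "\<And>x. x \<in> space \<mu> \<Longrightarrow> norm (f x) \<le> B"
  shows "integrable \<mu> f"
  using assms by (intro integrable_const_bound[of _ B]) (auto intro: AE_I2)

lemma norm_integral_le:
  fixes f :: "real \<Rightarrow> 'b::{banach, second_countable_topology}"
  assumes "f \<in> borel_measurable \<mu>" "\<And>x. x \<in> space \<mu> \<Longrightarrow> norm (f x) \<le> B"
  shows "norm (\<integral>x. f x \<partial>\<mu>) \<le> B"
proof -
  have "norm (\<integral>x. f x \<partial>\<mu>) \<le> (\<integral>x. norm (f x) \<partial>\<mu>)" by (rule integral_norm_bound)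
  also have "\<dots> \<le> (\<integral>x. B \<partial>\<mu>)"
    using integrable_norm_bound[OF assms] assms by (intro integral_mono) auto
  finally show ?thesis by (simp add: prob_space)
qed

lemma Kop_dual_complex:
  fixes \<psi> :: "real \<Rightarrow> complex"
  assumes A: "bm A" and \<psi>[measurable]: "\<psi> \<in> borel_measurable \<mu>" and B: "\<And>x. x \<in> space \<mu>
      \<Longrightarrow> norm (\<psi> x) \<le> B"
  shows "(\<integral>x. complex_of_real (A x) * \<psi> (T x) \<partial>\<mu>) = (\<integral>x. complex_of_real (Kop A x) * \<psi> x \<partial>\<mu>)"
proof -
  have re: "bm (\<lambda>x. Re (\<psi> x))"
    by (rule bmI[of _ B]) (use B abs_Re_le_cmod order_trans in \<open>measurable; blast\<close>)+
  have im: "bm (\<lambda>x. Im (\<psi> x))"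
    by (rule bmI[of _ B]) (use B abs_Im_le_cmod order_trans in \<open>measurable; blast\<close>)+
  have int: "integrable \<mu> (\<lambda>x. complex_of_real (f x) * g x)"
    if f: "bm f" and g: "g \<in> borel_measurable \<mu>" "\<And>x. x \<in> space \<mu> \<Longrightarrow> norm (g x) \<le> B" for f g
  proof -
    obtain F where "0 \<le> F" "\<And>x. x \<in> space \<mu> \<Longrightarrow> \<bar>f x\<bar> \<le> F" using bmE[OF f] by blast
    then show ?thesis using bm_measurable[OF f] g
      by (intro integrable_norm_bound[of _ "F * B"]) (auto simp: norm_mult intro!: mult_mono)
  qed
  have int1: "integrable \<mu> (\<lambda>x. complex_of_real (A x) * \<psi> (T x))"
    by (rule int[OF A]) (auto intro: B T_space)
  have int2: "integrable \<mu> (\<lambda>x. complex_of_real (Kop A x) * \<psi> x)"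
    by (rule int[OF bm_Kop[OF A]]) (auto intro: B)
  show ?thesis
  proof (rule complex_eqI)
    show "Re (\<integral>x. complex_of_real (A x) * \<psi> (T x) \<partial>\<mu>) = Re (\<integral>x. complex_of_real (Kop A x) * \<psi> x \<partial>\<mu>)"
      using Kop_dual[OF A re] by (simp flip: integral_Re[OF int1] integral_Re[OF int2])
    show "Im (\<integral>x. complex_of_real (A x) * \<psi> (T x) \<partial>\<mu>) = Im (\<integral>x. complex_of_real (Kop A x) * \<psi> x \<partial>\<mu>)"
      using Kop_dual[OF A im] by (simp flip: integral_Im[OF int1] integral_Im[OF int2])
  qed
qed

definition birkhoff :: "(real \<Rightarrow> real) \<Rightarrow> nat \<Rightarrow> real \<Rightarrow> real" where
  "birkhoff h n x = (\<Sum>j<n. h ((T ^^ j) x))"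

lemma birkhoff_Suc: "birkhoff h (Suc n) x = h x + birkhoff h n (T x)"
  unfolding birkhoff_def sum.lessThan_Suc_shift by (simp add: funpow_swap1)

lemma birkhoff_measurable: "bm h \<Longrightarrow> birkhoff h n \<in> borel_measurable \<mu>"
  unfolding birkhoff_def[abs_def] by (intro borel_measurable_sum bm_measurable bm_T_pow)

text \<open>
  In the proof, \<open>v\<^sub>1\<close> and \<open>v\<^sub>2\<close> are read off from the terms of order one and two of the equation
  \<open>K (exp (i \<theta> h) v) = (1 - \<theta>\<^sup>2 s / 2) v\<close> for \<open>v = 1 + i \<theta> v\<^sub>1 + \<theta>\<^sup>2 v\<^sub>2\<close>.
\<close>

lemma clt_centered:
  assumes h: "bm h" "bv V h" "(\<integral>x. h x \<partial>\<mu>) = 0"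
  defines "s \<equiv> (\<integral>x. h x * h x \<partial>\<mu>) + 2 * (\<integral>x. potential h x * h x \<partial>\<mu>)"
  shows "(\<lambda>n. \<integral>x. iexp (birkhoff h n x / sqrt (real n)) \<partial>\<mu>) \<longlonglongrightarrow> complex_of_real (exp (- s / 2))"
proof -
  define v1 where "v1 = potential h"
  define u2 where "u2 x = h x * v1 x + (1/2) * (h x * h x) - s / 2" for x
  define v2 where "v2 x = - potential u2 x" for x
  have v1: "bm v1" "bv (\<Sum>n. C1 * \<rho> ^ Suc n * V) v1"
    unfolding v1_def by (rule bm_potential[OF h] bv_potential[OF h])+
  obtain Mh where Mh: "0 \<le> Mh" "\<And>x. x \<in> space \<mu> \<Longrightarrow> \<bar>h x\<bar> \<le> Mh" using bmE[OF h(1)] by blast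
  obtain M1 where M1: "0 \<le> M1" "\<And>x. x \<in> space \<mu> \<Longrightarrow> \<bar>v1 x\<bar> \<le> M1" using bmE[OF v1(1)] by blast
  have u2_bm: "bm u2"
    unfolding u2_def[abs_def] by (intro bm_diff bm_add bm_mult bm_const h v1)
  note Mh' = Mh(2)[unfolded space_\<mu>] and M1' = M1(2)[unfolded space_\<mu>]
  have "\<exists>V2. bv V2 u2"
    using bv_diff[OF bv_add[OF bv_mult[OF h(2) v1(2) Mh' M1']
          bv_cmult[OF bv_mult[OF h(2) h(2) Mh' Mh'], of "1/2"]] bv_const[of "s/2"]]
    unfolding u2_def[abs_def] by blast
  then obtain V2 where V2: "bv V2 u2" by blast
  have hh: "bm (\<lambda>x. h x * h x)" "bm (\<lambda>x. h x * v1 x)" by (intro bm_mult h v1)+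
  have "(\<integral>x. u2 x \<partial>\<mu>) = 0"
    using bm_integrable[OF hh(1)] bm_integrable[OF hh(2)]
    by (simp add: u2_def s_def v1_def prob_space mult.commute[of "potential h _"])
  note u2 = u2_bm V2 this
  have v2: "bm v2"
    using bm_cmult[OF bm_potential[OF u2], of "-1"] by (simp add: v2_def[abs_def])
  have Kv1: "Kop (\<lambda>y. h y + v1 y) x = v1 x" if "x \<in> space \<mu>" for x
    using Kop_add[OF h(1) v1(1) that] Kop_potential[OF h that] by (simp add: v1_def)
  have Kv2: "Kop (\<lambda>y. v2 y - u2 y) x = v2 x" if "x \<in> space \<mu>" for x
    using Kop_diff[OF v2 u2(1) that] Kop_potential[OF u2 that] Kop_cmult[of "-1" "potential u2" x]
    by (simp add: v2_def[abs_def])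
  obtain M2 where M2: "0 \<le> M2" "\<And>x. x \<in> space \<mu> \<Longrightarrow> \<bar>v2 x\<bar> \<le> M2" using bmE[OF v2] by blast
  define M where "M = Mh + M1 + M2"
  have M: "\<bar>h x\<bar> \<le> M" "\<bar>v1 x\<bar> \<le> M" "\<bar>v2 x\<bar> \<le> M" if "x \<in> space \<mu>" for x
    using Mh(2)[OF that] M1(2)[OF that] M2(2)[OF that] Mh(1) M1(1) M2(1) by (auto simp: M_def)
  have M0: "0 \<le> M" using Mh(1) M1(1) M2(1) by (auto simp: M_def)
  note [measurable] = bm_measurable[OF h(1)] bm_measurable[OF v1(1)] bm_measurable[OF v2]
    bm_measurable[OF u2(1)] birkhoff_measurable[OF h(1)]

  define v where "v \<theta> x = 1 + \<i> * of_real (\<theta> * v1 x) + of_real (\<theta>^2 * v2 x)" for \<theta> x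
  define A where "A \<theta> x = (1 - \<theta>^2 * s / 2) + \<theta>^2 * (v2 x - u2 x)" for \<theta> x
  define B where "B \<theta> x = \<theta> * (h x + v1 x)" for \<theta> x
  define S where "S n x = birkhoff h n x" for n x
  define c where "c \<theta> n = (\<integral>x. v \<theta> x * iexp (\<theta> * S n x) \<partial>\<mu>)" for \<theta> n
  have [measurable]: "v \<theta> \<in> borel_measurable \<mu>" "S n \<in> borel_measurable \<mu>" for \<theta> n
    unfolding v_def[abs_def] S_def[abs_def] by measurable
  have A: "bm (A \<theta>)" and B: "bm (B \<theta>)" for \<theta>
    unfolding A_def[abs_def] B_def[abs_def] by (intro bm_diff bm_add bm_mult bm_const h v1 v2 u2)+
  have KA: "Kop (A \<theta>) x = (1 - \<theta>^2 * s / 2) + \<theta>^2 * v2 x" if x: "x \<in> space \<mu>" for \<theta> x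
    unfolding A_def[abs_def]
    by (subst Kop_add) (use x in \<open>auto simp: Kop_const Kop_cmult Kv2 intro!: bm_const bm_cmult
        bm_diff v2 u2\<close>)
  have KB: "Kop (B \<theta>) x = \<theta> * v1 x" if x: "x \<in> space \<mu>" for \<theta> x
    unfolding B_def[abs_def] by (simp add: Kop_cmult Kv1[OF x])
  have v_le: "norm (v \<theta> x) \<le> 1 + 2 * M" and v_1: "norm (v \<theta> x - 1) \<le> 2 * M * \<theta>"
    if \<theta>: "0 \<le> \<theta>" "\<theta> \<le> 1" and x: "x \<in> space \<mu>" for \<theta> x
  proof -
    have "norm (v \<theta> x - 1) = norm (\<i> * of_real (\<theta> * v1 x) + of_real (\<theta>^2 * v2 x))"
      by (simp add: v_def)
    also have "\<dots> \<le> norm (\<i> * of_real (\<theta> * v1 x)) + norm (complex_of_real (\<theta>^2 * v2 x))"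
      by (rule norm_triangle_ineq)
    also have "\<dots> = \<theta> * \<bar>v1 x\<bar> + \<theta> * (\<theta> * \<bar>v2 x\<bar>)"
      using \<theta> by (simp add: norm_mult abs_mult power2_eq_square)
    also have "\<dots> \<le> \<theta> * M + \<theta> * (1 * M)"
      using \<theta> M[OF x] by (intro add_mono mult_left_mono mult_mono) auto
    finally show *: "norm (v \<theta> x - 1) \<le> 2 * M * \<theta>" by simp
    have "2 * M * \<theta> \<le> 2 * M" using \<theta> M0 by (simp add: mult_left_le)
    then show "norm (v \<theta> x) \<le> 1 + 2 * M"
      using * norm_triangle_ineq[of "v \<theta> x - 1" 1] by simp
  qed
  define D where "D = M^2 + M^3 + (1 + 2 * M) * M^3 + \<bar>s\<bar> * M"
  have D0: "0 \<le> D" using M0 by (simp add: D_def)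
  have twist: "norm (v \<theta> x * iexp (\<theta> * h x) - (of_real (A \<theta> x) + \<i> * of_real (B \<theta> x)))
      \<le> (M^2 + M^3 + (1 + 2 * M) * M^3) * \<theta>^3"
    if \<theta>: "0 \<le> \<theta>" "\<theta> \<le> 1" and x: "x \<in> space \<mu>" for \<theta> x
  proof -
    define R where "R = iexp (\<theta> * h x) - (1 + \<i> * of_real (\<theta> * h x) - of_real ((\<theta> * h x)^2 / 2))"
    have "norm R \<le> \<bar>\<theta> * h x\<bar>^3 / fact 3"
    proof -
      have "iexp (\<theta> * h x) - (\<Sum>k\<le>2. (\<i> * complex_of_real (\<theta> * h x))^k / fact k) = R"
        by (simp add: R_def numeral_2_eq_2 power2_eq_square algebra_simps fact_numeral)
      then show ?thesis using iexp_approx1[of "\<theta> * h x" 2] by (simp add: numeral_3_eq_3)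
    qed
    also have "\<dots> \<le> \<bar>\<theta> * h x\<bar>^3"
      using zero_le_power[OF abs_ge_zero, of "\<theta> * h x" 3] by (simp add: fact_numeral)
    also have "\<dots> = \<bar>h x\<bar>^3 * \<theta>^3" using \<theta> by (simp add: abs_mult power_mult_distrib)
    also have "\<dots> \<le> M^3 * \<theta>^3" using \<theta> M(1)[OF x] by (intro mult_right_mono power_mono) auto
    finally have R: "norm R \<le> M^3 * \<theta>^3" .
    let ?Q = "\<i> * of_real (v2 x * h x - v1 x * (h x)^2 / 2) - of_real (\<theta> * v2 x * (h x)^2 / 2)"
    have eq: "v \<theta> x * iexp (\<theta> * h x) - (of_real (A \<theta> x) + \<i> * of_real (B \<theta> x)) =
        of_real (\<theta>^3) * ?Q + v \<theta> x * R"
      unfolding R_def v_def A_def B_def u2_def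
      by (simp add: field_simps power2_eq_square power3_eq_cube)
    have "norm ?Q \<le> norm (\<i> * complex_of_real (v2 x * h x - v1 x * (h x)^2 / 2))
        + norm (complex_of_real (\<theta> * v2 x * (h x)^2 / 2))"
      by (rule norm_triangle_ineq4)
    also have "\<dots> = \<bar>v2 x * h x - v1 x * (h x)^2 / 2\<bar> + \<bar>\<theta> * v2 x * (h x)^2 / 2\<bar>"
      by (simp only: norm_mult norm_ii norm_of_real mult_1)
    also have "\<dots> \<le> (\<bar>v2 x * h x\<bar> + \<bar>v1 x * (h x)^2 / 2\<bar>) + \<bar>\<theta> * v2 x * (h x)^2 / 2\<bar>"
      by (intro add_right_mono abs_triangle_ineq4)
    also have "\<dots> = \<bar>v2 x\<bar> * \<bar>h x\<bar> + \<bar>v1 x\<bar> * \<bar>h x\<bar>^2 / 2 + \<theta> * (\<bar>v2 x\<bar> * \<bar>h x\<bar>^2 / 2)"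
      using \<theta> by (simp add: abs_mult)
    also have "\<dots> \<le> M * M + M * M^2 / 2 + 1 * (M * M^2 / 2)"
      using \<theta> M[OF x] M0 by (intro add_mono mult_mono divide_right_mono power_mono) auto
    also have "\<dots> = M^2 + M^3" by (simp add: power2_eq_square power3_eq_cube)
    finally have Q: "norm ?Q \<le> M^2 + M^3" .
    have "norm (of_real (\<theta>^3) * ?Q + v \<theta> x * R)
        \<le> norm (complex_of_real (\<theta>^3)) * norm ?Q + norm (v \<theta> x) * norm R"
      by (metis norm_triangle_ineq norm_mult)
    also have "\<dots> \<le> \<theta>^3 * (M^2 + M^3) + (1 + 2 * M) * (M^3 * \<theta>^3)"
      using Q R v_le[OF \<theta> x] \<theta> M0 by (intro add_mono mult_mono) (auto simp: norm_power)
    finally show ?thesis unfolding eq by (simp add: algebra_simps)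
  qed
  have eigen: "norm (of_real (Kop (A \<theta>) x) + \<i> * of_real (Kop (B \<theta>) x) - of_real (1 - \<theta>^2 * s / 2)
      * v \<theta> x)
      \<le> \<bar>s\<bar> * M * \<theta>^3"
    if \<theta>: "0 \<le> \<theta>" "\<theta> \<le> 1" and x: "x \<in> space \<mu>" for \<theta> x
  proof -
    let ?Q = "\<i> * of_real (v1 x) + of_real (\<theta> * v2 x)"
    have "of_real (Kop (A \<theta>) x) + \<i> * of_real (Kop (B \<theta>) x) - of_real (1 - \<theta>^2 * s / 2) * v \<theta> x
      = of_real (\<theta>^3 * s / 2) * ?Q"
      unfolding KA[OF x] KB[OF x] v_def
      by (simp add: field_simps power2_eq_square power3_eq_cube)
    then have eq: "norm (of_real (Kop (A \<theta>) x) + \<i> * of_real (Kop (B \<theta>) x) - of_real (1 - \<theta>^2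
        * s / 2) * v \<theta> x)
      = \<theta>^3 * \<bar>s\<bar> / 2 * norm ?Q" using \<theta> by (simp only: norm_mult norm_of_real) (simp add: abs_mult)
    have "norm ?Q \<le> norm (\<i> * complex_of_real (v1 x)) + norm (complex_of_real (\<theta> * v2 x))"
      by (rule norm_triangle_ineq)
    also have "\<dots> = \<bar>v1 x\<bar> + \<theta> * \<bar>v2 x\<bar>" using \<theta> by (simp add: norm_mult abs_mult)
    also have "\<dots> \<le> M + 1 * M" using \<theta> M[OF x] by (intro add_mono mult_mono) auto
    finally have "norm ?Q \<le> 2 * M" by simp
    then have "\<theta>^3 * \<bar>s\<bar> / 2 * norm ?Q \<le> \<theta>^3 * \<bar>s\<bar> / 2 * (2 * M)"
      using \<theta> by (intro mult_left_mono) auto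
    then show ?thesis unfolding eq by (simp add: mult_ac)
  qed

  have S_Suc: "iexp (\<theta> * S (Suc n) x) = iexp (\<theta> * h x) * iexp (\<theta> * S n (T x))" for \<theta> n x
    unfolding S_def birkhoff_Suc by (simp add: exp_add[symmetric] algebra_simps)
  have step: "norm (c \<theta> (Suc n) - of_real (1 - \<theta>^2 * s / 2) * c \<theta> n) \<le> D * \<theta>^3"
    if \<theta>: "0 \<le> \<theta>" "\<theta> \<le> 1" for \<theta> n
  proof -
    define \<psi> where "\<psi> x = iexp (\<theta> * S n x)" for x
    have [measurable]: "\<psi> \<in> borel_measurable \<mu>" unfolding \<psi>_def[abs_def] by measurable
    have \<psi>1: "norm (\<psi> x) = 1" for x by (simp add: \<psi>_def)
    note [measurable] = bm_measurable[OF A] bm_measurable[OF B] bm_measurable[OF bm_Kop[OF A]]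
        bm_measurable[OF bm_Kop[OF B]]
    let ?P = "\<lambda>x. of_real (A \<theta> x) + \<i> * complex_of_real (B \<theta> x)"
    let ?P' = "\<lambda>x. of_real (Kop (A \<theta>) x) + \<i> * complex_of_real (Kop (B \<theta>) x)"
    have int: "integrable \<mu> (\<lambda>x. of_real (f x) * g x)"
      if f: "bm f" and g: "g \<in> borel_measurable \<mu>" "\<And>x. norm (g x) = 1" for f and g :: "real \<Rightarrow> complex"
    proof -
      obtain F where "0 \<le> F" "\<And>x. x \<in> space \<mu> \<Longrightarrow> \<bar>f x\<bar> \<le> F" using bmE[OF f] by blast
      then show ?thesis using bm_measurable[OF f] g
        by (intro integrable_norm_bound[of _ F]) (auto simp: norm_mult)
    qed
    have dual: "(\<integral>x. ?P x * \<psi> (T x) \<partial>\<mu>) = (\<integral>x. ?P' x * \<psi> x \<partial>\<mu>)"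
    proof -
      have "(\<integral>x. ?P x * \<psi> (T x) \<partial>\<mu>) = (\<integral>x. of_real (A \<theta> x) * \<psi> (T x) + \<i> * (of_real (B \<theta> x)
          * \<psi> (T x)) \<partial>\<mu>)"
        by (simp add: algebra_simps)
      also have "\<dots> = (\<integral>x. of_real (A \<theta> x) * \<psi> (T x) \<partial>\<mu>) + \<i> * (\<integral>x. of_real (B \<theta> x) * \<psi> (T x) \<partial>\<mu>)"
        by (subst Bochner_Integration.integral_add) (auto intro!: int A B \<psi>1 integrable_mult_right)
      also have "\<dots> = (\<integral>x. of_real (Kop (A \<theta>) x) * \<psi> x \<partial>\<mu>) + \<i> * (\<integral>x. of_real (Kop (B \<theta>) x) * \<psi> x \<partial>\<mu>)"
        by (simp add: Kop_dual_complex[OF A, of \<psi> 1] Kop_dual_complex[OF B, of \<psi> 1] \<psi>1)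
      also have "\<dots> = (\<integral>x. of_real (Kop (A \<theta>) x) * \<psi> x + \<i> * (of_real (Kop (B \<theta>) x) * \<psi> x) \<partial>\<mu>)"
        by (subst Bochner_Integration.integral_add) (auto intro!: int bm_Kop A B \<psi>1
            integrable_mult_right)
      finally show ?thesis by (simp add: algebra_simps)
    qed
    have iv: "integrable \<mu> (\<lambda>x. v \<theta> x * \<psi> x)" "integrable \<mu> (\<lambda>x. v \<theta> x * iexp (\<theta> * h x) * \<psi> (T x))"
      using v_le[OF \<theta>] by (auto intro!: integrable_norm_bound[of _ "1 + 2 * M"] simp: norm_mult \<psi>1)
    have iP: "integrable \<mu> (\<lambda>x. ?P x * \<psi> (T x))" "integrable \<mu> (\<lambda>x. ?P' x * \<psi> x)"
      unfolding distrib_right mult.assoc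
      by (auto intro!: Bochner_Integration.integrable_add integrable_mult_right int A B bm_Kop \<psi>1)
    have "c \<theta> (Suc n) - of_real (1 - \<theta>^2 * s / 2) * c \<theta> n
      = (\<integral>x. (v \<theta> x * iexp (\<theta> * h x) - ?P x) * \<psi> (T x) \<partial>\<mu>)
        + (\<integral>x. (?P' x - of_real (1 - \<theta>^2 * s / 2) * v \<theta> x) * \<psi> x \<partial>\<mu>)"
    proof -
      have "c \<theta> (Suc n) = (\<integral>x. v \<theta> x * iexp (\<theta> * h x) * \<psi> (T x) \<partial>\<mu>)"
        unfolding c_def S_Suc \<psi>_def by (simp add: mult.assoc)
      moreover have "c \<theta> n = (\<integral>x. v \<theta> x * \<psi> x \<partial>\<mu>)" by (simp add: c_def \<psi>_def)
      moreover have "(\<integral>x. (v \<theta> x * iexp (\<theta> * h x) - ?P x) * \<psi> (T x) \<partial>\<mu>)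
        = (\<integral>x. v \<theta> x * iexp (\<theta> * h x) * \<psi> (T x) \<partial>\<mu>) - (\<integral>x. ?P x * \<psi> (T x) \<partial>\<mu>)"
        unfolding left_diff_distrib by (rule Bochner_Integration.integral_diff[OF iv(2) iP(1)])
      moreover have "(\<integral>x. (?P' x - of_real (1 - \<theta>^2 * s / 2) * v \<theta> x) * \<psi> x \<partial>\<mu>)
        = (\<integral>x. ?P' x * \<psi> x \<partial>\<mu>) - of_real (1 - \<theta>^2 * s / 2) * (\<integral>x. v \<theta> x * \<psi> x \<partial>\<mu>)"
        unfolding left_diff_distrib mult.assoc
        by (subst Bochner_Integration.integral_diff)
           (auto simp only: integral_mult_right_zero mult.assoc intro!: integrable_mult_right iv(1)
               iP(2))
      ultimately show ?thesis using dual by simp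
    qed
    moreover have "norm (\<integral>x. (v \<theta> x * iexp (\<theta> * h x) - ?P x) * \<psi> (T x) \<partial>\<mu>)
        \<le> (M^2 + M^3 + (1 + 2 * M) * M^3) * \<theta>^3"
      by (rule norm_integral_le, measurable) (simp only: norm_mult \<psi>1 mult_1_right twist[OF \<theta>])
    moreover have "norm (\<integral>x. (?P' x - of_real (1 - \<theta>^2 * s / 2) * v \<theta> x) * \<psi> x \<partial>\<mu>) \<le> \<bar>s\<bar> * M * \<theta>^3"
      by (rule norm_integral_le, measurable) (simp only: norm_mult \<psi>1 mult_1_right eigen[OF \<theta>])
    ultimately have "norm (c \<theta> (Suc n) - of_real (1 - \<theta>^2 * s / 2) * c \<theta> n)
       \<le> (M^2 + M^3 + (1 + 2 * M) * M^3) * \<theta>^3 + \<bar>s\<bar> * M * \<theta>^3"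
      by (simp only:) (rule order_trans[OF norm_triangle_ineq add_mono])
    then show ?thesis by (simp add: D_def algebra_simps)
  qed

  define L where "L = exp (\<bar>s\<bar> / 2)"
  have L1: "1 \<le> L" by (simp add: L_def)
  have bound: "norm ((\<integral>x. iexp (birkhoff h n x / sqrt (real n)) \<partial>\<mu>) - of_real ((1
      + (- s / 2) / real n) ^ n))
      \<le> (2 * M + L * D + L * (2 * M)) * (1 / sqrt (real n))" if n: "n \<ge> 1" for n
  proof -
    define \<theta> where "\<theta> = 1 / sqrt (real n)"
    have \<theta>: "0 \<le> \<theta>" "\<theta> \<le> 1" "\<theta>^2 = 1 / real n" using n by (auto simp: \<theta>_def power_divide)
    define z where "z = 1 + (- s / 2) / real n"
    have z: "1 - \<theta>^2 * s / 2 = z" by (simp add: \<theta>(3) z_def)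
    define l where "l = 1 + (\<bar>s\<bar> / 2) / real n"
    have "\<bar>(- s / 2) / real n\<bar> = (\<bar>s\<bar> / 2) / real n" by (simp add: abs_mult)
    then have "\<bar>z\<bar> \<le> l" unfolding z_def l_def by linarith
    moreover have "1 \<le> l" by (simp add: l_def)
    ultimately have l: "1 \<le> l" "\<bar>z\<bar> \<le> l" by simp_all
    have ln: "l ^ n \<le> L"
    proof -
      have "l ^ n \<le> exp ((\<bar>s\<bar> / 2) / real n) ^ n"
        using l exp_ge_add_one_self[of "(\<bar>s\<bar> / 2) / real n"] by (intro power_mono) (auto simp: l_def)
      also have "\<dots> = L" using n by (simp add: L_def exp_of_nat_mult[symmetric])
      finally show ?thesis .
    qed
    have zn: "\<bar>z ^ n\<bar> \<le> L"
      using power_mono[OF l(2), of n] ln by (simp add: power_abs)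
    have "norm (c \<theta> n - of_real z ^ n * c \<theta> 0) \<le> real n * l ^ n * (D * \<theta>^3)"
      using step[OF \<theta>(1,2)] l unfolding z by (intro approximate_geometric) auto
    also have "\<dots> \<le> real n * L * (D * \<theta>^3)"
      using ln D0 \<theta> by (intro mult_right_mono mult_left_mono) auto
    also have "\<dots> = L * D * \<theta> * (real n * \<theta>^2)" by (simp add: power3_eq_cube power2_eq_square)
    also have "\<dots> = L * D * \<theta>" using n by (simp add: \<theta>(3))
    finally have 1: "norm (c \<theta> n - of_real z ^ n * c \<theta> 0) \<le> L * D * \<theta>" .
    have int_e: "integrable \<mu> (\<lambda>x. iexp (\<theta> * S n x))" for n
      by (rule integrable_norm_bound[of _ 1]) auto
    have int_v: "integrable \<mu> (\<lambda>x. v \<theta> x * iexp (\<theta> * S n x))" for n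
      using v_le[OF \<theta>(1,2)] by (auto intro!: integrable_norm_bound[of _ "1 + 2 * M"] simp: norm_mult)
    have 2: "norm (c \<theta> n - (\<integral>x. iexp (\<theta> * S n x) \<partial>\<mu>)) \<le> 2 * M * \<theta>" for n
    proof -
      have "c \<theta> n - (\<integral>x. iexp (\<theta> * S n x) \<partial>\<mu>) = (\<integral>x. (v \<theta> x - 1) * iexp (\<theta> * S n x) \<partial>\<mu>)"
        unfolding c_def left_diff_distrib by (simp only: mult_1 Bochner_Integration.integral_diff[OF
            int_v int_e])
      also have "norm \<dots> \<le> 2 * M * \<theta>"
        by (rule norm_integral_le, measurable) (simp only: norm_mult norm_exp_i_times mult_1_right
            v_1[OF \<theta>(1,2)])
      finally show ?thesis .
    qed
    have "norm (c \<theta> 0 - 1) \<le> 2 * M * \<theta>"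
      using 2[of 0] by (simp add: S_def birkhoff_def prob_space)
    then have 3: "norm (of_real z ^ n * (c \<theta> 0 - 1)) \<le> L * (2 * M * \<theta>)"
      unfolding norm_mult using zn L1 by (intro mult_mono) (auto simp flip: of_real_power)
    let ?E = "\<integral>x. iexp (\<theta> * S n x) \<partial>\<mu>"
    have "?E - of_real z ^ n = - (c \<theta> n - ?E) + (c \<theta> n - of_real z ^ n * c \<theta> 0) + of_real z ^ n
        * (c \<theta> 0 - 1)"
      by (simp add: algebra_simps)
    then have "norm (?E - of_real z ^ n) \<le> norm (c \<theta> n - ?E) + norm (c \<theta> n - of_real z ^ n * c \<theta> 0)
        + norm (of_real z ^ n * (c \<theta> 0 - 1))"
      by (simp only:) (rule norm_triangle_ineq[THEN order_trans],
        rule add_right_mono, rule norm_triangle_ineq[THEN order_trans], simp only: norm_minus_cancel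
            order_refl)
    also have "\<dots> \<le> 2 * M * \<theta> + L * D * \<theta> + L * (2 * M * \<theta>)"
      using 1 2[of n] 3 by linarith
    finally show ?thesis
      by (simp add: \<theta>_def S_def z_def algebra_simps)
  qed
  have lim: "(\<lambda>n. complex_of_real ((1 + (- s / 2) / real n) ^ n)) \<longlonglongrightarrow> of_real (exp (- s / 2))"
    by (intro tendsto_of_real tendsto_exp_limit_sequentially)
  have "(\<lambda>n. (2 * M + L * D + L * (2 * M)) * (1 / sqrt (real n))) \<longlonglongrightarrow> (2 * M + L * D + L * (2 * M)) * 0"
    by (intro tendsto_mult tendsto_const) real_asymp
  then have "(\<lambda>n. (2 * M + L * D + L * (2 * M)) * (1 / sqrt (real n))) \<longlonglongrightarrow> 0" by simp
  then have "(\<lambda>n. (\<integral>x. iexp (birkhoff h n x / sqrt (real n)) \<partial>\<mu>) - of_real ((1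
      + (- s / 2) / real n) ^ n)) \<longlonglongrightarrow> 0"
    by (rule Lim_null_comparison[rotated]) (use bound in \<open>auto simp: eventually_sequentially intro!:
        exI[of _ 1]\<close>)
  from tendsto_add[OF this lim] show ?thesis by simp
qed

end

section \<open>Covariances of bounded variation observables\<close>

context bv_map
begin

definition ctr :: "(real \<Rightarrow> real) \<Rightarrow> real \<Rightarrow> real" where
  "ctr h x = h x - (\<integral>y. h y \<partial>\<mu>)"

definition covk :: "(real \<Rightarrow> real) \<Rightarrow> (real \<Rightarrow> real) \<Rightarrow> nat \<Rightarrow> real" where
  "covk u v k = (\<integral>x. u x * v ((T ^^ k) x) \<partial>\<mu>) - (\<integral>x. u x \<partial>\<mu>) * (\<integral>x. v x \<partial>\<mu>)"

definition long_run_cov :: "(real \<Rightarrow> real) \<Rightarrow> (real \<Rightarrow> real) \<Rightarrow> real" where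
  "long_run_cov u v = covk u v 0 + (\<Sum>k. covk u v (Suc k)) + (\<Sum>k. covk v u (Suc k))"

lemma bm_ctr: "bm h \<Longrightarrow> bm (ctr h)"
  unfolding ctr_def[abs_def] by (intro bm_diff bm_const)

lemma bv_ctr: "bv V h \<Longrightarrow> bv V (ctr h)"
  unfolding ctr_def[abs_def] using bv_diff[OF _ bv_const] by fastforce

lemma integral_ctr: "bm h \<Longrightarrow> (\<integral>x. ctr h x \<partial>\<mu>) = 0"
  using bm_integrable[of h] by (simp add: ctr_def prob_space)

lemma covk_ctr:
  assumes u: "bm u" and v: "bm v"
  shows "covk u v k = (\<integral>x. ctr u x * ctr v ((T ^^ k) x) \<partial>\<mu>)"
proof -
  define a b where "a = (\<integral>x. u x \<partial>\<mu>)" and "b = (\<integral>x. v x \<partial>\<mu>)"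
  note int = bm_integrable[OF bm_mult[OF u bm_T_pow[OF v, of k]]] bm_integrable[OF u]
      bm_integrable[OF bm_T_pow[OF v, of k]]
  have "(\<integral>x. ctr u x * ctr v ((T ^^ k) x) \<partial>\<mu>)
      = (\<integral>x. u x * v ((T ^^ k) x) - b * u x - a * v ((T ^^ k) x) + a * b \<partial>\<mu>)"
    by (simp add: ctr_def a_def[symmetric] b_def[symmetric] algebra_simps)
  also have "\<dots> = (\<integral>x. u x * v ((T ^^ k) x) \<partial>\<mu>) - b * a - a * (\<integral>x. v ((T ^^ k) x) \<partial>\<mu>) + a * b"
    using int by (simp add: prob_space a_def[symmetric])
  also have "(\<integral>x. v ((T ^^ k) x) \<partial>\<mu>) = b"
    unfolding b_def by (rule integral_T_pow[OF bm_measurable[OF v]])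
  finally show ?thesis by (simp add: covk_def a_def b_def)
qed

lemma covk_zero_commute: "covk u v 0 = covk v u 0"
  by (simp add: covk_def mult.commute)

lemma summable_covk:
  assumes u: "bm u" "bv V u" and v: "bm v"
  shows "summable (\<lambda>k. covk u v (Suc k))"
  unfolding covk_ctr[OF u(1) v]
  using integral_mult_potential[OF bm_ctr[OF u(1)] bv_ctr[OF u(2)] integral_ctr[OF u(1)] bm_ctr[OF v]]
  by (rule sums_summable)

lemma suminf_covk:
  assumes u: "bm u" "bv V u" and v: "bm v"
  shows "(\<Sum>k. covk u v (Suc k)) = (\<integral>x. potential (ctr u) x * ctr v x \<partial>\<mu>)"
  unfolding covk_ctr[OF u(1) v]
  using integral_mult_potential[OF bm_ctr[OF u(1)] bv_ctr[OF u(2)] integral_ctr[OF u(1)] bm_ctr[OF v]]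
  by (rule sums_unique[symmetric])

lemma clt:
  assumes h: "bm h" "bv V h"
  shows "(\<lambda>n. \<integral>x. iexp ((\<Sum>j=1..n. ctr h ((T ^^ j) x)) / sqrt (real n)) \<partial>\<mu>)
    \<longlonglongrightarrow> complex_of_real (exp (- long_run_cov h h / 2))"
proof -
  note c = bm_ctr[OF h(1)] bv_ctr[OF h(2)] integral_ctr[OF h(1)]
  note [measurable] = birkhoff_measurable[OF c(1)]
  have "(\<Sum>j=1..n. ctr h ((T ^^ j) x)) = birkhoff (ctr h) n ((T ^^ 1) x)" for n x
    by (simp add: birkhoff_def sum.atLeast1_atMost_eq funpow_swap1)
  moreover have "(\<integral>x. iexp (birkhoff (ctr h) n ((T ^^ 1) x) / sqrt (real n)) \<partial>\<mu>)
    = (\<integral>x. iexp (birkhoff (ctr h) n x / sqrt (real n)) \<partial>\<mu>)" for n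
    by (rule integral_T_pow[where n = 1 and h = "\<lambda>x. iexp (birkhoff (ctr h) n x / sqrt (real n))"])
        measurable
  moreover have "(\<integral>x. ctr h x * ctr h x \<partial>\<mu>) + 2 * (\<integral>x. potential (ctr h) x * ctr h x \<partial>\<mu>)
      = long_run_cov h h"
    by (simp add: long_run_cov_def suminf_covk[OF h h(1)] covk_ctr[OF h(1) h(1), of 0])
  ultimately show ?thesis using clt_centered[OF c] by simp
qed

lemma long_run_cov_commute: "long_run_cov u v = long_run_cov v u"
  by (simp add: long_run_cov_def covk_zero_commute[of u v])

lemma covk_sum:
  assumes "\<And>i. i \<in> I \<Longrightarrow> bm (u i)" "\<And>j. j \<in> J \<Longrightarrow> bm (v j)"
  shows "covk (\<lambda>x. \<Sum>i\<in>I. a i * u i x) (\<lambda>x. \<Sum>j\<in>J. b j * v j x) k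
    = (\<Sum>i\<in>I. \<Sum>j\<in>J. a i * b j * covk (u i) (v j) k)"
proof -
  have i: "integrable \<mu> (\<lambda>x. u i x * v j ((T ^^ k) x))" "integrable \<mu> (u i)" "integrable \<mu> (v j)"
    if "i \<in> I" "j \<in> J" for i j
    using assms(1)[OF that(1)] assms(2)[OF that(2)] by (auto intro!: bm_integrable bm_mult bm_T_pow)
  have i1: "integrable \<mu> (u i)" if "i \<in> I" for i using assms(1)[OF that] by (rule bm_integrable)
  have i2: "integrable \<mu> (v i)" if "i \<in> J" for i using assms(2)[OF that] by (rule bm_integrable)
  have "(\<integral>x. (\<Sum>i\<in>I. a i * u i x) * (\<Sum>j\<in>J. b j * v j ((T ^^ k) x)) \<partial>\<mu>)
     = (\<integral>x. (\<Sum>i\<in>I. \<Sum>j\<in>J. (a i * b j) * (u i x * v j ((T ^^ k) x))) \<partial>\<mu>)"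
    by (simp add: sum_product mult_ac)
  also have "\<dots> = (\<Sum>i\<in>I. \<Sum>j\<in>J. (a i * b j) * (\<integral>x. u i x * v j ((T ^^ k) x) \<partial>\<mu>))"
    using i by (simp add: Bochner_Integration.integral_sum)
  finally have 1: "(\<integral>x. (\<Sum>i\<in>I. a i * u i x) * (\<Sum>j\<in>J. b j * v j ((T ^^ k) x)) \<partial>\<mu>) = \<dots>" .
  have "(\<integral>x. (\<Sum>i\<in>I. a i * u i x) \<partial>\<mu>) * (\<integral>x. (\<Sum>j\<in>J. b j * v j x) \<partial>\<mu>)
    = (\<Sum>i\<in>I. \<Sum>j\<in>J. (a i * b j) * ((\<integral>x. u i x \<partial>\<mu>) * (\<integral>x. v j x \<partial>\<mu>)))"
    using i1 i2 by (simp add: Bochner_Integration.integral_sum sum_product mult_ac)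
  with 1 show ?thesis
    by (simp add: covk_def sum_subtractf right_diff_distrib)
qed

lemma long_run_cov_sum:
  fixes u :: "'b \<Rightarrow> real \<Rightarrow> real" and v :: "'c \<Rightarrow> real \<Rightarrow> real"
  assumes u: "\<And>i. i \<in> I \<Longrightarrow> bm (u i)" "\<And>i. i \<in> I \<Longrightarrow> bv V (u i)"
    and v: "\<And>j. j \<in> J \<Longrightarrow> bm (v j)" "\<And>j. j \<in> J \<Longrightarrow> bv V (v j)"
  shows "long_run_cov (\<lambda>x. \<Sum>i\<in>I. a i * u i x) (\<lambda>x. \<Sum>j\<in>J. b j * v j x)
    = (\<Sum>i\<in>I. \<Sum>j\<in>J. a i * b j * long_run_cov (u i) (v j))"
proof -
  have s: "summable (\<lambda>k. covk (u i) (v j) (Suc k))" "summable (\<lambda>k. covk (v j) (u i) (Suc k))"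
    if "i \<in> I" "j \<in> J" for i j
    using summable_covk[OF u(1,2) v(1)] summable_covk[OF v(1,2) u(1)] that by blast+
  have uv: "covk (\<lambda>x. \<Sum>i\<in>I. a i * u i x) (\<lambda>x. \<Sum>j\<in>J. b j * v j x) k
      = (\<Sum>i\<in>I. \<Sum>j\<in>J. a i * b j * covk (u i) (v j) k)" for k
    by (rule covk_sum) (use u v in auto)
  have vu: "covk (\<lambda>x. \<Sum>j\<in>J. b j * v j x) (\<lambda>x. \<Sum>i\<in>I. a i * u i x) k
      = (\<Sum>i\<in>I. \<Sum>j\<in>J. a i * b j * covk (v j) (u i) k)" for k
    by (subst sum.swap, subst covk_sum) (use u v in \<open>auto simp: mult_ac\<close>)
  have pull: "(\<Sum>k. \<Sum>i\<in>I. \<Sum>j\<in>J. a i * b j * c i j k) = (\<Sum>i\<in>I. \<Sum>j\<in>J. a i * b j * (\<Sum>k. c i j k))"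
    if c: "\<And>i j. i \<in> I \<Longrightarrow> j \<in> J \<Longrightarrow> summable (c i j)" for c :: "'b \<Rightarrow> 'c \<Rightarrow> nat \<Rightarrow> real"
  proof -
    have "(\<Sum>k. \<Sum>i\<in>I. \<Sum>j\<in>J. a i * b j * c i j k) = (\<Sum>i\<in>I. \<Sum>k. \<Sum>j\<in>J. a i * b j * c i j k)"
      by (rule suminf_sum) (intro summable_sum summable_mult c)
    also have "\<dots> = (\<Sum>i\<in>I. \<Sum>j\<in>J. \<Sum>k. a i * b j * c i j k)"
      by (intro sum.cong refl suminf_sum summable_mult c)
    also have "\<dots> = (\<Sum>i\<in>I. \<Sum>j\<in>J. a i * b j * (\<Sum>k. c i j k))"
      by (intro sum.cong refl suminf_mult c)
    finally show ?thesis .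
  qed
  show ?thesis
    unfolding long_run_cov_def uv vu
    by (simp add: pull s sum.distrib distrib_left)
qed

definition mad :: "(real \<Rightarrow> real) \<Rightarrow> real" where
  "mad h = (\<integral>x. \<bar>ctr h x\<bar> \<partial>\<mu>)"

lemma mad_nonneg: "0 \<le> mad h"
  by (simp add: mad_def)

text \<open>The geometric mean of a bound in terms of \<open>v\<close> with decay and one in terms of \<open>u\<close> without.\<close>

lemma covk_le:
  assumes u: "bm u" "bv V u" and v: "bm v" "\<And>x. x \<in> space \<mu> \<Longrightarrow> \<bar>ctr v x\<bar> \<le> 1"
  shows "\<bar>covk u v k\<bar> \<le> sqrt (C1 * V) * sqrt \<rho> ^ k * sqrt (mad u * mad v)"
proof -
  note cu = bm_ctr[OF u(1)] bv_ctr[OF u(2)] integral_ctr[OF u(1)]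
  note cv = bm_ctr[OF v(1)]
  have V: "0 \<le> V" by (rule bv_nonneg[OF u(2)])
  have 1: "\<bar>covk u v k\<bar> \<le> mad u"
  proof -
    have "\<bar>covk u v k\<bar> \<le> (\<integral>x. \<bar>ctr u x * ctr v ((T ^^ k) x)\<bar> \<partial>\<mu>)"
      unfolding covk_ctr[OF u(1) v(1)] by (rule integral_abs_bound)
    also have "\<dots> \<le> mad u"
      unfolding mad_def
    proof (rule integral_mono)
      show "integrable \<mu> (\<lambda>x. \<bar>ctr u x * ctr v ((T ^^ k) x)\<bar>)"
        by (intro integrable_abs bm_integrable bm_mult bm_T_pow cu cv)
      show "integrable \<mu> (\<lambda>x. \<bar>ctr u x\<bar>)"
        by (intro integrable_abs bm_integrable cu)
      show "\<bar>ctr u x * ctr v ((T ^^ k) x)\<bar> \<le> \<bar>ctr u x\<bar>" if "x \<in> space \<mu>" for x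
        using v(2)[OF T_pow_space[OF that]] by (simp add: abs_mult mult_left_le)
    qed
    finally show ?thesis .
  qed
  have 2: "\<bar>covk u v k\<bar> \<le> C1 * \<rho> ^ k * V * mad v"
  proof -
    have "covk u v k = (\<integral>x. (Kop ^^ k) (ctr u) x * ctr v x \<partial>\<mu>)"
      unfolding covk_ctr[OF u(1) v(1)] by (rule Kop_pow_dual[OF cu(1) cv, symmetric])
    also have "\<bar>\<dots>\<bar> \<le> (\<integral>x. \<bar>(Kop ^^ k) (ctr u) x * ctr v x\<bar> \<partial>\<mu>)"
      by (rule integral_abs_bound)
    also have "\<dots> \<le> (\<integral>x. C1 * \<rho> ^ k * V * \<bar>ctr v x\<bar> \<partial>\<mu>)"
    proof (rule integral_mono)
      show "integrable \<mu> (\<lambda>x. \<bar>(Kop ^^ k) (ctr u) x * ctr v x\<bar>)"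
        by (intro integrable_abs bm_integrable bm_mult bm_Kop_pow cu cv)
      show "integrable \<mu> (\<lambda>x. C1 * \<rho> ^ k * V * \<bar>ctr v x\<bar>)"
        by (intro integrable_mult_right integrable_abs bm_integrable cv)
      show "\<bar>(Kop ^^ k) (ctr u) x * ctr v x\<bar> \<le> C1 * \<rho> ^ k * V * \<bar>ctr v x\<bar>" if "x \<in> space \<mu>" for x
        using Kop_pow_le[OF cu that] by (simp add: abs_mult mult_right_mono)
    qed
    finally show ?thesis by (simp add: mad_def)
  qed
  have "\<bar>covk u v k\<bar>\<^sup>2 \<le> mad u * (C1 * \<rho> ^ k * V * mad v)"
    unfolding power2_eq_square by (intro mult_mono 1 2 mad_nonneg abs_ge_zero)
  then have "\<bar>covk u v k\<bar> \<le> sqrt (mad u * (C1 * \<rho> ^ k * V * mad v))"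
    by (rule real_le_rsqrt)
  also have "\<dots> = sqrt (C1 * V) * sqrt \<rho> ^ k * sqrt (mad u * mad v)"
    by (simp add: real_sqrt_mult real_sqrt_power mult_ac)
  finally show ?thesis .
qed

lemma sqrt_\<rho>: "0 \<le> sqrt \<rho>" "sqrt \<rho> < 1"
  using \<rho>_nonneg \<rho>_less_1 real_sqrt_less_mono[of \<rho> 1] by auto

lemma suminf_covk_le:
  assumes u: "bm u" "bv V u" and v: "bm v" "\<And>x. x \<in> space \<mu> \<Longrightarrow> \<bar>ctr v x\<bar> \<le> 1"
  shows "\<bar>\<Sum>k. covk u v (Suc k)\<bar> \<le> sqrt (C1 * V) / (1 - sqrt \<rho>) * sqrt (mad u * mad v)"
proof -
  let ?b = "\<lambda>k. sqrt (C1 * V) * sqrt \<rho> ^ k * sqrt (mad u * mad v)"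
  have sb: "summable ?b"
    by (rule summable_mult2[OF summable_mult[OF summable_geometric]]) (use sqrt_\<rho> in simp)
  have le: "\<bar>covk u v (Suc k)\<bar> \<le> ?b k" for k
  proof -
    have "\<bar>covk u v (Suc k)\<bar> \<le> ?b (Suc k)" by (rule covk_le[OF u v])
    also have "\<dots> \<le> ?b k"
      using sqrt_\<rho> bv_nonneg[OF u(2)] mad_nonneg C1_ge_1
      by (intro mult_right_mono mult_left_mono power_decreasing) auto
    finally show ?thesis .
  qed
  have s: "summable (\<lambda>k. \<bar>covk u v (Suc k)\<bar>)"
    by (rule summable_comparison_test'[OF sb, of 0]) (use le in simp)
  have "\<bar>\<Sum>k. covk u v (Suc k)\<bar> \<le> (\<Sum>k. \<bar>covk u v (Suc k)\<bar>)" by (rule summable_rabs[OF s])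
  also have "\<dots> \<le> (\<Sum>k. ?b k)" by (rule suminf_le[OF le s sb])
  also have "\<dots> = sqrt (C1 * V) * (1 / (1 - sqrt \<rho>)) * sqrt (mad u * mad v)"
    using sqrt_\<rho> by (intro sums_unique[symmetric] sums_mult2[OF sums_mult[OF geometric_sums]]) auto
  finally show ?thesis by simp
qed

lemma long_run_cov_le:
  assumes u: "bm u" "bv V u" "\<And>x. x \<in> space \<mu> \<Longrightarrow> \<bar>ctr u x\<bar> \<le> 1"
    and v: "bm v" "bv V v" "\<And>x. x \<in> space \<mu> \<Longrightarrow> \<bar>ctr v x\<bar> \<le> 1"
  shows "\<bar>long_run_cov u v\<bar> \<le> 3 * sqrt (C1 * V) / (1 - sqrt \<rho>) * sqrt (mad u * mad v)"
proof -
  let ?m = "sqrt (mad u * mad v)" let ?c = "sqrt (C1 * V)"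
  have nn: "0 \<le> ?c" "0 \<le> ?m" using C1_ge_1 bv_nonneg[OF u(2)] mad_nonneg by auto
  have "\<bar>covk u v 0\<bar> \<le> ?c * ?m" using covk_le[OF u(1,2) v(1,3), of 0] by simp
  also have "\<dots> \<le> (?c / (1 - sqrt \<rho>)) * ?m"
    using sqrt_\<rho> nn by (intro mult_right_mono) (auto simp: field_simps intro: mult_left_le)
  finally have "\<bar>covk u v 0\<bar> \<le> (?c / (1 - sqrt \<rho>)) * ?m" .
  moreover have "\<bar>\<Sum>k. covk u v (Suc k)\<bar> \<le> (?c / (1 - sqrt \<rho>)) * ?m"
    by (rule suminf_covk_le[OF u(1,2) v(1,3)])
  moreover have "\<bar>\<Sum>k. covk v u (Suc k)\<bar> \<le> (?c / (1 - sqrt \<rho>)) * ?m"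
    using suminf_covk_le[OF v(1,2) u(1,3)] by (simp add: mult.commute)
  ultimately show ?thesis unfolding long_run_cov_def by simp
qed

lemma covk_shift:
  assumes "bm u" "bm v" "i \<le> j"
  shows "(\<integral>x. ctr u ((T ^^ i) x) * ctr v ((T ^^ j) x) \<partial>\<mu>) = covk u v (j - i)"
proof -
  have "(\<integral>x. ctr u ((T ^^ i) x) * ctr v ((T ^^ j) x) \<partial>\<mu>)
    = (\<integral>x. (\<lambda>y. ctr u y * ctr v ((T ^^ (j - i)) y)) ((T ^^ i) x) \<partial>\<mu>)"
    using funpow_add[of "j - i" i T] assms(3) by (simp add: comp_def fun_eq_iff)
  also have "\<dots> = covk u v (j - i)"
    unfolding covk_ctr[OF assms(1,2)]
    by (rule integral_T_pow) (intro bm_measurable bm_mult bm_ctr bm_T_pow assms)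
  finally show ?thesis .
qed

lemma variance_sum_le:
  assumes h: "bm h" "bv V h" "\<And>x. x \<in> space \<mu> \<Longrightarrow> \<bar>ctr h x\<bar> \<le> 1"
  shows "(\<integral>x. (\<Sum>j=1..n. ctr h ((T ^^ j) x))\<^sup>2 \<partial>\<mu>) \<le> real n * (2 * sqrt (C1 * V) / (1 - sqrt \<rho>) * mad h)"
proof -
  define b where "b k = sqrt (C1 * V) * sqrt \<rho> ^ k * mad h" for k
  have b0: "0 \<le> b k" for k using C1_ge_1 bv_nonneg[OF h(2)] mad_nonneg sqrt_\<rho>(1) by (auto simp: b_def)
  have b: "\<bar>covk h h k\<bar> \<le> b k" for k
    using covk_le[OF h(1,2) h(1,3), of k] mad_nonneg[of h] by (simp add: b_def)
  have sb: "summable b" and sumb: "suminf b = sqrt (C1 * V) / (1 - sqrt \<rho>) * mad h"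
  proof -
    have "(\<lambda>k. sqrt (C1 * V) * sqrt \<rho> ^ k * mad h) sums (sqrt (C1 * V) * (1 / (1 - sqrt \<rho>)) * mad h)"
      by (rule sums_mult2[OF sums_mult[OF geometric_sums]]) (use sqrt_\<rho> in auto)
    then show "summable b" "suminf b = sqrt (C1 * V) / (1 - sqrt \<rho>) * mad h"
      by (auto simp: b_def[abs_def] sums_iff)
  qed
  have int: "integrable \<mu> (\<lambda>x. ctr h ((T ^^ i) x) * ctr h ((T ^^ j) x))" for i j
    by (intro bm_integrable bm_mult bm_T_pow bm_ctr h)
  have "(\<integral>x. (\<Sum>j=1..n. ctr h ((T ^^ j) x))\<^sup>2 \<partial>\<mu>)
    = (\<Sum>i=1..n. \<Sum>j=1..n. \<integral>x. ctr h ((T ^^ i) x) * ctr h ((T ^^ j) x) \<partial>\<mu>)"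
    using int by (simp add: power2_eq_square sum_product Bochner_Integration.integral_sum)
  also have "\<dots> \<le> (\<Sum>i=1..n. 2 * suminf b)"
  proof (rule sum_mono)
    fix i assume i: "i \<in> {1..n}"
    have "(\<Sum>j=1..n. \<integral>x. ctr h ((T ^^ i) x) * ctr h ((T ^^ j) x) \<partial>\<mu>) \<le> (\<Sum>j=1..n. b (if i
        \<le> j then j - i else i - j))"
    proof (rule sum_mono)
      fix j
      have "(\<integral>x. ctr h ((T ^^ i) x) * ctr h ((T ^^ j) x) \<partial>\<mu>) = covk h h (if i
          \<le> j then j - i else i - j)"
        using covk_shift[OF h(1) h(1), of i j] covk_shift[OF h(1) h(1), of j i]
            by (auto simp: mult.commute)
      then show "(\<integral>x. ctr h ((T ^^ i) x) * ctr h ((T ^^ j) x) \<partial>\<mu>) \<le> b (if i \<le> j then j - i else i - j)"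
        using b[of "if i \<le> j then j - i else i - j"] by linarith
    qed
    also have "\<dots> = (\<Sum>j\<in>{1..n} \<inter> {j. i \<le> j}. b (j - i)) + (\<Sum>j\<in>{1..n} \<inter> - {j. i \<le> j}. b (i - j))"
      by (subst sum.If_cases[symmetric]) (auto intro!: sum.cong)
    also have "(\<Sum>j\<in>{1..n} \<inter> {j. i \<le> j}. b (j - i)) = sum b ((\<lambda>j. j - i) ` ({1..n} \<inter> {j. i \<le> j}))"
      by (subst sum.reindex) (auto simp: inj_on_def)
    also have "\<dots> \<le> suminf b" by (rule sum_le_suminf[OF sb]) (auto simp: b0)
    also have "(\<Sum>j\<in>{1..n} \<inter> - {j. i \<le> j}. b (i - j)) = sum b ((\<lambda>j. i - j) ` ({1..n} \<inter> - {j. i \<le> j}))"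
      by (subst sum.reindex) (auto simp: inj_on_def)
    also have "\<dots> \<le> suminf b" by (rule sum_le_suminf[OF sb]) (auto simp: b0)
    finally show "(\<Sum>j=1..n. \<integral>x. ctr h ((T ^^ i) x) * ctr h ((T ^^ j) x) \<partial>\<mu>) \<le> 2 * suminf b" by simp
  qed
  finally show ?thesis by (simp add: sumb)
qed

end

section \<open>Weak convergence of random sequences\<close>

inductive trig_poly :: "((nat \<Rightarrow> real) \<Rightarrow> real) \<Rightarrow> bool" where
  cos: "trig_poly (\<lambda>w. c * cos ((\<Sum>j<N. a j * w j) + b))"
| add: "trig_poly p \<Longrightarrow> trig_poly q \<Longrightarrow> trig_poly (\<lambda>w. p w + q w)"

lemma trig_poly_const: "trig_poly (\<lambda>_. c)"
  using trig_poly.cos[where c=c and N=0 and b=0] by simp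

lemma trig_poly_cos_mult_cos:
  "trig_poly (\<lambda>w. (c * cos ((\<Sum>j<N. a j * w j) + b)) * (c' * cos ((\<Sum>j<N'. a' j * w j) + b')))"
proof -
  define L where "L = max N N'"
  define d where "d j = (if j < N then a j else 0)" for j
  define d' where "d' j = (if j < N' then a' j else 0)" for j
  have ext: "(\<Sum>j<N. a j * w j) = (\<Sum>j<L. d j * w j)" "(\<Sum>j<N'. a' j * w j) = (\<Sum>j<L. d' j * w j)" for w
    unfolding L_def d_def d'_def by (auto intro!: sum.mono_neutral_cong_left split: if_splits)
  have eq: "(c * cos ((\<Sum>j<N. a j * w j) + b)) * (c' * cos ((\<Sum>j<N'. a' j * w j) + b'))
    = (c * c' / 2) * cos ((\<Sum>j<L. (d j - d' j) * w j) + (b - b'))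
      + (c * c' / 2) * cos ((\<Sum>j<L. (d j + d' j) * w j) + (b + b'))" for w
  proof -
    let ?x = "(\<Sum>j<L. d j * w j) + b" and ?y = "(\<Sum>j<L. d' j * w j) + b'"
    have "(\<Sum>j<L. (d j - d' j) * w j) + (b - b') = ?x - ?y" "(\<Sum>j<L. (d j + d' j) * w j) + (b + b')
        = ?x + ?y"
      by (simp_all add: left_diff_distrib distrib_right sum_subtractf sum.distrib)
    then show ?thesis unfolding ext by (simp only: cos_diff cos_add) (simp add: algebra_simps)
  qed
  show ?thesis unfolding eq by (intro trig_poly.intros)
qed

lemma trig_poly_mult: "trig_poly p \<Longrightarrow> trig_poly q \<Longrightarrow> trig_poly (\<lambda>w. p w * q w)"
proof (induction p rule: trig_poly.induct)
  case (cos c a N b)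
  from cos.prems show ?case
  proof (induction q rule: trig_poly.induct)
    case (add p q)
    then show ?case using trig_poly.add[OF add.IH] by (simp add: distrib_left)
  qed (rule trig_poly_cos_mult_cos)
next
  case (add p p')
  then show ?case using trig_poly.add[OF add.IH] by (simp add: distrib_right)
qed

lemma trig_poly_continuous: "trig_poly p \<Longrightarrow> continuous_on UNIV p"
proof (induction rule: trig_poly.induct)
  case (cos c a N b)
  then show ?case by (intro continuous_intros continuous_on_product_coordinates)
qed (intro continuous_intros)

lemma trig_poly_bounded: "trig_poly p \<Longrightarrow> \<exists>B. \<forall>w. \<bar>p w\<bar> \<le> B"
proof (induction rule: trig_poly.induct)
  case (cos c a N b)
  then show ?case by (intro exI[of _ "\<bar>c\<bar>"]) (simp add: abs_mult mult_left_le)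
next
  case (add p q)
  then obtain A B where "\<forall>w. \<bar>p w\<bar> \<le> A" "\<forall>w. \<bar>q w\<bar> \<le> B" by blast
  then show ?case by (intro exI[of _ "A + B"]) (meson abs_triangle_ineq add_mono order_trans)
qed

lemma trig_poly_polynomial:
  fixes g :: "real \<Rightarrow> real"
  assumes "real_polynomial_function g" "trig_poly p"
  shows "trig_poly (\<lambda>w. g (p w))"
  using assms(1)
proof (induction rule: real_polynomial_function.induct)
  case (linear f)
  then obtain c where "f = (\<lambda>x. x * c)" by (auto simp: real_bounded_linear)
  then show ?case using trig_poly_mult[OF assms(2) trig_poly_const[of c]] by simp
qed (auto intro: trig_poly_const trig_poly.add trig_poly_mult)

lemma abs_le_interval: "\<bar>x\<bar> \<le> r \<longleftrightarrow> - r \<le> x \<and> x \<le> r" for x r :: real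
  by linarith

lemma trig_poly_separates:
  assumes "w \<noteq> w'" shows "\<exists>p. trig_poly p \<and> p w \<noteq> p w'"
proof -
  obtain k where k: "w k \<noteq> w' k" using assms by auto
  define r where "r = 1 / (1 + \<bar>w k\<bar> + \<bar>w' k\<bar>)"
  have r: "0 < r" by (simp add: r_def add_pos_nonneg)
  have le: "\<bar>r * w k\<bar> \<le> pi / 2" "\<bar>r * w' k\<bar> \<le> pi / 2"
  proof -
    have "\<bar>r * w k\<bar> \<le> 1" "\<bar>r * w' k\<bar> \<le> 1" by (auto simp: r_def field_simps abs_mult)
    then show "\<bar>r * w k\<bar> \<le> pi / 2" "\<bar>r * w' k\<bar> \<le> pi / 2" using pi_ge_two by linarith+
  qed
  define p where "p = (\<lambda>w. 1 * cos ((\<Sum>j<Suc k. (if j = k then r else 0) * w j) + (- pi / 2)))"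
  have p: "p u = sin (r * u k)" for u
    by (simp add: p_def if_distrib if_distribR cos_diff cong: if_cong)
  have "trig_poly p" unfolding p_def by (rule trig_poly.cos)
  moreover have "p w \<noteq> p w'"
    using sin_inj_pi[of "r * w k" "r * w' k"] le r k
        by (auto simp only: p abs_le_interval mult_cancel_left)
  ultimately show ?thesis by blast
qed

lemma cube_eq_PiE: "{w. \<forall>j. \<bar>w j\<bar> \<le> (R j :: real)} = PiE UNIV (\<lambda>j. {- R j .. R j})"
  by (auto simp: PiE_def Pi_def abs_le_interval)

lemma compact_cube: "compact {w. \<forall>j::nat. \<bar>w j\<bar> \<le> (R j :: real)}"
proof -
  have "compactin (product_topology (\<lambda>_::nat. euclidean) UNIV) (PiE UNIV (\<lambda>j. {- R j .. R j}))"
    by (subst compactin_PiE) (auto simp: compactin_euclidean_iff)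
  then show ?thesis by (simp add: cube_eq_PiE euclidean_product_topology compactin_euclidean_iff)
qed

text \<open>
  A continuous function bounded by \<open>B\<close> is approximated on a compact cube by a trigonometric
  polynomial \<open>p\<close>; composing \<open>p\<close> with a polynomial that approximates truncation at \<open>\<plusminus> B\<close>
  controls the approximant off the cube as well.
\<close>

lemma trig_poly_approximation:
  fixes \<phi> :: "(nat \<Rightarrow> real) \<Rightarrow> real"
  assumes \<phi>: "continuous_on UNIV \<phi>" "\<And>w. \<bar>\<phi> w\<bar> \<le> B" and "0 < \<epsilon>"
  obtains q where "trig_poly q" "\<And>w. \<bar>q w\<bar> \<le> B + \<epsilon>"
    "\<And>w. (\<And>j. \<bar>w j\<bar> \<le> R j) \<Longrightarrow> \<bar>\<phi> w - q w\<bar> \<le> 2 * \<epsilon>"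
proof -
  let ?K = "{w. \<forall>j::nat. \<bar>w j\<bar> \<le> (R j :: real)}"
  have "\<exists>p. trig_poly p \<and> (\<forall>x\<in>?K. \<bar>\<phi> x - p x\<bar> < \<epsilon>)"
    by (rule Stone_Weierstrass_HOL[OF compact_cube])
       (use assms in \<open>auto intro: trig_poly_const trig_poly.add trig_poly_mult trig_poly_separates
          continuous_on_subset[OF trig_poly_continuous] continuous_on_subset[OF \<phi>(1)]\<close>)
  then obtain p where p: "trig_poly p" "\<And>x. x \<in> ?K \<Longrightarrow> \<bar>\<phi> x - p x\<bar> < \<epsilon>" by blast
  obtain P where P: "\<And>w. \<bar>p w\<bar> \<le> P" using trig_poly_bounded[OF p(1)] by blast
  have B: "0 \<le> B" using \<phi>(2)[of undefined] by linarith
  define clip where "clip y = max (- B) (min B y)" for y :: real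
  have clip: "\<bar>clip y\<bar> \<le> B" "\<bar>clip x - clip y\<bar> \<le> \<bar>x - y\<bar>" "\<bar>y\<bar> \<le> B \<Longrightarrow> clip y = y" for x y
    using B by (auto simp: clip_def max_def min_def abs_if split: if_splits)
  obtain g where g: "real_polynomial_function g" "\<And>y. y \<in> {-P..P} \<Longrightarrow> \<bar>clip y - g y\<bar> < \<epsilon>"
  proof (rule Stone_Weierstrass_real_polynomial_function[of "{-P..P}" clip \<epsilon>])
    show "continuous_on {-P..P} clip" unfolding clip_def[abs_def] by (intro continuous_intros)
  qed (use \<open>0 < \<epsilon>\<close> in auto)
  have gp: "\<bar>clip (p w) - g (p w)\<bar> < \<epsilon>" for w
    using P[of w] by (intro g(2)) auto
  show thesis
  proof (rule that)
    show "trig_poly (\<lambda>w. g (p w))" by (rule trig_poly_polynomial[OF g(1) p(1)])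
    show "\<bar>g (p w)\<bar> \<le> B + \<epsilon>" for w using gp[of w] clip(1)[of "p w"] by linarith
    show "\<bar>\<phi> w - g (p w)\<bar> \<le> 2 * \<epsilon>" if "\<And>j. \<bar>w j\<bar> \<le> R j" for w
      using that p(2)[of w] gp[of w] clip(2)[of "\<phi> w" "p w"] clip(3)[OF \<phi>(2), of w] by auto
  qed
qed

lemma borel_measurable_coordinate:
  assumes [measurable]: "X \<in> borel_measurable M"
  shows "(\<lambda>x. (X x :: nat \<Rightarrow> real) j) \<in> borel_measurable M"
  using measurable_compose[OF assms borel_measurable_continuous_onI[OF
      continuous_on_product_coordinates]]
  by simp

lemma measurable_cube:
  fixes X :: "'a \<Rightarrow> nat \<Rightarrow> real"
  assumes X: "X \<in> borel_measurable M"
  shows "{x\<in>space M. \<forall>j. \<bar>X x j\<bar> \<le> (R j :: real)} \<in> sets M"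
  using borel_measurable_coordinate[OF X] by measurable

lemma (in prob_space) prob_not_cube_le:
  fixes X :: "'a \<Rightarrow> nat \<Rightarrow> real"
  assumes X: "X \<in> borel_measurable M"
    and R: "\<And>j. prob {x\<in>space M. R j < \<bar>X x j\<bar>} \<le> \<epsilon> * (1/2)^Suc j"
  shows "1 - prob {x\<in>space M. \<forall>j. \<bar>X x j\<bar> \<le> R j} \<le> \<epsilon>"
proof -
  note [measurable] = borel_measurable_coordinate[OF X]
  have s: "(\<lambda>j. \<epsilon> * (1/2)^Suc j) sums \<epsilon>"
    using sums_mult[OF power_half_series, of \<epsilon>] by simp
  have sp: "summable (\<lambda>j. prob {x\<in>space M. R j < \<bar>X x j\<bar>})"
    by (rule summable_comparison_test'[OF sums_summable[OF s], of 0]) (use R in simp)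
  have "1 - prob {x\<in>space M. \<forall>j. \<bar>X x j\<bar> \<le> R j} = prob (space M - {x\<in>space M. \<forall>j. \<bar>X x j\<bar> \<le> R j})"
    by (rule prob_compl[symmetric]) (rule measurable_cube[OF X])
  also have "space M - {x\<in>space M. \<forall>j. \<bar>X x j\<bar> \<le> R j} = (\<Union>j. {x\<in>space M. R j < \<bar>X x j\<bar>})"
    by (auto simp: not_le) (meson not_le)
  also have "prob \<dots> \<le> (\<Sum>j. prob {x\<in>space M. R j < \<bar>X x j\<bar>})"
    by (rule finite_measure_subadditive_countably[OF _ sp]) auto
  also have "\<dots> \<le> (\<Sum>j. \<epsilon> * (1/2)^Suc j)"
    by (rule suminf_le[OF R sp sums_summable[OF s]])
  also have "\<dots> = \<epsilon>" by (rule sums_unique[OF s, symmetric])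
  finally show ?thesis .
qed

lemma (in prob_space) integral_diff_le_off_event:
  fixes u v :: "'a \<Rightarrow> real"
  assumes [measurable]: "u \<in> borel_measurable M" "v \<in> borel_measurable M" "A \<in> sets M"
    and u: "\<And>x. x \<in> space M \<Longrightarrow> \<bar>u x\<bar> \<le> B" and v: "\<And>x. x \<in> space M \<Longrightarrow> \<bar>v x\<bar> \<le> B"
    and A: "\<And>x. x \<in> A \<Longrightarrow> \<bar>u x - v x\<bar> \<le> d" and d: "0 \<le> d" and pA: "1 - prob A \<le> \<epsilon>"
  shows "\<bar>(\<integral>x. u x \<partial>M) - (\<integral>x. v x \<partial>M)\<bar> \<le> d + 2 * B * \<epsilon>"
proof -
  obtain x0 where "x0 \<in> space M" using not_empty by blast
  then have B: "0 \<le> B" using u[of x0] by linarith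
  have int: "integrable M u" "integrable M v"
    using u v by (auto intro!: integrable_const_bound[of _ B] AE_I2)
  have iA: "integrable M (indicator A :: 'a \<Rightarrow> real)" by (simp add: less_top[symmetric])
  have "\<bar>(\<integral>x. u x \<partial>M) - (\<integral>x. v x \<partial>M)\<bar> = \<bar>\<integral>x. u x - v x \<partial>M\<bar>"
    using int by simp
  also have "\<dots> \<le> (\<integral>x. \<bar>u x - v x\<bar> \<partial>M)" by (rule integral_abs_bound)
  also have "\<dots> \<le> (\<integral>x. d + 2 * B * (1 - indicator A x) \<partial>M)"
  proof (rule integral_mono)
    show "\<bar>u x - v x\<bar> \<le> d + 2 * B * (1 - indicator A x)" if "x \<in> space M" for x
      using A[of x] u[OF that] v[OF that] d by (auto simp: indicator_def)
  qed (use int iA in \<open>auto intro!: Bochner_Integration.integrable_add integrable_mult_right\<close>)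
  also have "\<dots> = d + 2 * B * (1 - prob A)"
    using iA by (simp add: prob_space)
  also have "\<dots> \<le> d + 2 * B * \<epsilon>" using pA B by (intro add_left_mono mult_left_mono) auto
  finally show ?thesis .
qed

lemma (in prob_space) tight_real:
  fixes X :: "'a \<Rightarrow> real"
  assumes [measurable]: "X \<in> borel_measurable M" and "0 < \<epsilon>"
  shows "\<exists>R. prob {x\<in>space M. R < \<bar>X x\<bar>} \<le> \<epsilon>"
proof -
  have "(\<lambda>n. prob {x\<in>space M. real n < \<bar>X x\<bar>}) \<longlonglongrightarrow> prob (\<Inter>n. {x\<in>space M. real n < \<bar>X x\<bar>})"
    by (rule finite_Lim_measure_decseq) (auto simp: decseq_def)
  also have "(\<Inter>n. {x\<in>space M. real n < \<bar>X x\<bar>}) = {}"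
  proof -
    have "\<exists>n. \<not> real n < \<bar>X x\<bar>" for x using real_arch_simple[of "\<bar>X x\<bar>"] by (auto simp: not_less)
    then show ?thesis by auto
  qed
  finally have "\<forall>\<^sub>F n in sequentially. prob {x\<in>space M. real n < \<bar>X x\<bar>} < \<epsilon>"
    using \<open>0 < \<epsilon>\<close> by (simp add: order_tendstoD)
  then show ?thesis by (meson eventually_happens less_imp_le trivial_limit_sequentially)
qed

theorem weak_convergence_sequences:
  fixes X :: "nat \<Rightarrow> 'a \<Rightarrow> nat \<Rightarrow> real" and W :: "'b \<Rightarrow> nat \<Rightarrow> real" and \<phi> :: "(nat \<Rightarrow> real) \<Rightarrow> real"
  assumes M: "prob_space M" and N: "prob_space N"
    and X: "\<And>n. X n \<in> borel_measurable M" and W: "W \<in> borel_measurable N"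
    and char: "\<And>a J. (\<lambda>n. \<integral>x. iexp (\<Sum>j<J. a j * X n x j) \<partial>M) \<longlonglongrightarrow> (\<integral>x. iexp (\<Sum>j<J. a j * W x j) \<partial>N)"
    and tight: "\<And>j \<epsilon>. 0 < \<epsilon> \<Longrightarrow> \<exists>R. \<forall>n. measure M {x\<in>space M. R < \<bar>X n x j\<bar>} \<le> \<epsilon>"
    and \<phi>: "continuous_on UNIV \<phi>" "bounded (range \<phi>)"
  shows "(\<lambda>n. \<integral>x. \<phi> (X n x) \<partial>M) \<longlonglongrightarrow> (\<integral>x. \<phi> (W x) \<partial>N)"
proof -
  interpret M: prob_space M by fact
  interpret N: prob_space N by fact
  note [measurable] = borel_measurable_coordinate[OF X] borel_measurable_coordinate[OF W]
  have mp: "(\<lambda>x. q (X n x)) \<in> borel_measurable M" "(\<lambda>x. q (W x)) \<in> borel_measurable N"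
    if "continuous_on UNIV q" for q :: "(nat \<Rightarrow> real) \<Rightarrow> real" and n
    using measurable_compose[OF X borel_measurable_continuous_onI[OF that]]
      measurable_compose[OF W borel_measurable_continuous_onI[OF that]] by auto
  have trig: "(\<lambda>n. \<integral>x. q (X n x) \<partial>M) \<longlonglongrightarrow> (\<integral>x. q (W x) \<partial>N)" if "trig_poly q" for q
    using that
  proof (induction rule: trig_poly.induct)
    case (cos c a J b)
    have cos_eq: "(\<integral>x. c * cos ((\<Sum>j<J. a j * Z x j) + b) \<partial>P)
        = c * Re (iexp b * (\<integral>x. iexp (\<Sum>j<J. a j * Z x j) \<partial>P))"
      if P: "prob_space P" and Z: "\<And>j. (\<lambda>x. Z x j) \<in> borel_measurable P" for P :: "'c measure" and Z
    proof -
      interpret P: prob_space P by fact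
      note [measurable] = Z
      have i: "integrable P (\<lambda>x. iexp b * iexp (\<Sum>j<J. a j * Z x j))"
        by (rule P.integrable_const_bound[of _ 1]) (auto simp: norm_mult simp del: of_real_sum)
      have "iexp b * iexp (\<Sum>j<J. a j * Z x j) = iexp ((\<Sum>j<J. a j * Z x j) + b)" for x
        by (simp add: exp_add[symmetric] algebra_simps)
      then have "cos ((\<Sum>j<J. a j * Z x j) + b) = Re (iexp b * iexp (\<Sum>j<J. a j * Z x j))" for x
        by (simp only: Re_exp) simp
      then have "(\<integral>x. c * cos ((\<Sum>j<J. a j * Z x j) + b) \<partial>P)
          = c * (\<integral>x. Re (iexp b * iexp (\<Sum>j<J. a j * Z x j)) \<partial>P)"
        by (simp only: integral_mult_right_zero)
      also have "\<dots> = c * Re (\<integral>x. iexp b * iexp (\<Sum>j<J. a j * Z x j) \<partial>P)"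
        by (simp only: integral_Re[OF i])
      finally show ?thesis by (simp only: integral_mult_right_zero)
    qed
    show ?case
      unfolding cos_eq[OF M borel_measurable_coordinate[OF X]] cos_eq[OF N
          borel_measurable_coordinate[OF W]]
      by (intro tendsto_intros char)
  next
    case (add p q)
    have i: "integrable M (\<lambda>x. r (X n x))" "integrable N (\<lambda>x. r (W x))" if r: "trig_poly r" for r n
    proof -
      obtain B where "\<And>w. \<bar>r w\<bar> \<le> B" using trig_poly_bounded[OF r] by blast
      then show "integrable M (\<lambda>x. r (X n x))" "integrable N (\<lambda>x. r (W x))"
        using mp[OF trig_poly_continuous[OF r]]
        by (auto intro!: M.integrable_const_bound[of _ B] N.integrable_const_bound[of _ B])
    qed
    show ?case using tendsto_add[OF add.IH] by (simp add: i add.hyps)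
  qed
  obtain B0 where B0: "\<And>w. \<bar>\<phi> w\<bar> \<le> B0" using \<phi>(2) by (auto simp: bounded_iff)
  have B: "0 \<le> B0" using B0[of undefined] by linarith
  show ?thesis
  proof (rule LIMSEQ_I)
    fix r :: real assume r: "0 < r"
    define D where "D = 4 + 4 * (B0 + 1) + 1"
    define \<epsilon> where "\<epsilon> = min 1 (r / D)"
    have D: "0 < D" using B by (simp add: D_def)
    have \<epsilon>: "0 < \<epsilon>" "\<epsilon> \<le> 1" "\<epsilon> * D \<le> r" using r D by (auto simp: \<epsilon>_def field_simps min_def)
    have "\<exists>R. \<forall>j. (\<forall>n. M.prob {x\<in>space M. R j < \<bar>X n x j\<bar>}
        \<le> \<epsilon> * (1/2)^Suc j) \<and> N.prob {x\<in>space N. R j < \<bar>W x j\<bar>} \<le> \<epsilon> * (1/2)^Suc j"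
    proof (intro choice allI)
      fix j
      have e: "0 < \<epsilon> * (1/2)^Suc j" using \<epsilon> by simp
      obtain R1 where R1: "\<And>n. M.prob {x\<in>space M. R1 < \<bar>X n x j\<bar>} \<le> \<epsilon> * (1/2)^Suc j"
          using tight[OF e] by blast
      obtain R2 where R2: "N.prob {x\<in>space N. R2 < \<bar>W x j\<bar>} \<le> \<epsilon> * (1/2)^Suc j"
        using N.tight_real[OF borel_measurable_coordinate[OF W] e] by blast
      have "M.prob {x\<in>space M. max R1 R2 < \<bar>X n x j\<bar>} \<le> M.prob {x\<in>space M. R1 < \<bar>X n x j\<bar>}" for n
        by (rule M.finite_measure_mono) auto
      moreover have "N.prob {x\<in>space N. max R1 R2 < \<bar>W x j\<bar>} \<le> N.prob {x\<in>space N. R2 < \<bar>W x j\<bar>}"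
        by (rule N.finite_measure_mono) auto
      ultimately show "\<exists>R. (\<forall>n. M.prob {x\<in>space M. R < \<bar>X n x j\<bar>}
          \<le> \<epsilon> * (1/2)^Suc j) \<and> N.prob {x\<in>space N. R < \<bar>W x j\<bar>} \<le> \<epsilon> * (1/2)^Suc j"
        using R1 R2 by (intro exI[of _ "max R1 R2"]) (meson order_trans)
    qed
    then obtain R where R: "\<And>j n. M.prob {x\<in>space M. R j < \<bar>X n x j\<bar>} \<le> \<epsilon> * (1/2)^Suc j"
      "\<And>j. N.prob {x\<in>space N. R j < \<bar>W x j\<bar>} \<le> \<epsilon> * (1/2)^Suc j" by blast
    obtain q where q: "trig_poly q" "\<And>w. \<bar>q w\<bar> \<le> B0 + \<epsilon>"
      "\<And>w. (\<And>j. \<bar>w j\<bar> \<le> R j) \<Longrightarrow> \<bar>\<phi> w - q w\<bar> \<le> 2 * \<epsilon>"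
      using trig_poly_approximation[OF \<phi>(1) B0 \<epsilon>(1)] by blast
    have q': "\<bar>q w\<bar> \<le> B0 + 1" "\<bar>\<phi> w\<bar> \<le> B0 + 1" for w using q(2)[of w] B0[of w] \<epsilon> by linarith+
    have X\<phi>: "\<bar>(\<integral>x. \<phi> (X n x) \<partial>M) - (\<integral>x. q (X n x) \<partial>M)\<bar> \<le> 2 * \<epsilon> + 2 * (B0 + 1) * \<epsilon>" for n
      by (rule M.integral_diff_le_off_event[OF mp(1)[OF \<phi>(1)] mp(1)[OF trig_poly_continuous[OF
          q(1)]] measurable_cube[OF X, where R=R] q'(2,1)])
         (use q(3) \<epsilon> M.prob_not_cube_le[OF X R(1)] in auto)
    have W\<phi>: "\<bar>(\<integral>x. \<phi> (W x) \<partial>N) - (\<integral>x. q (W x) \<partial>N)\<bar> \<le> 2 * \<epsilon> + 2 * (B0 + 1) * \<epsilon>"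
      by (rule N.integral_diff_le_off_event[OF mp(2)[OF \<phi>(1)] mp(2)[OF trig_poly_continuous[OF
          q(1)]] measurable_cube[OF W, where R=R] q'(2,1)])
         (use q(3) \<epsilon> N.prob_not_cube_le[OF W R(2)] in auto)
    obtain n0 where n0: "\<And>n. n \<ge> n0 \<Longrightarrow> \<bar>(\<integral>x. q (X n x) \<partial>M) - (\<integral>x. q (W x) \<partial>N)\<bar> < \<epsilon>"
      using LIMSEQ_D[OF trig[OF q(1)] \<epsilon>(1)] by (auto simp: real_norm_def)
    show "\<exists>n0. \<forall>n\<ge>n0. norm ((\<integral>x. \<phi> (X n x) \<partial>M) - (\<integral>x. \<phi> (W x) \<partial>N)) < r"
    proof (intro exI[of _ n0] allI impI)
      fix n assume "n \<ge> n0"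
      define \<eta> where "\<eta> = 2 * \<epsilon> + 2 * (B0 + 1) * \<epsilon>"
      from n0[OF \<open>n \<ge> n0\<close>] X\<phi>[of n, folded \<eta>_def] W\<phi>[folded \<eta>_def] have "\<bar>(\<integral>x. \<phi> (X n x) \<partial>M)
          - (\<integral>x. \<phi> (W x) \<partial>N)\<bar> < 2 * \<eta> + \<epsilon>"
        by linarith
      also have "\<dots> = \<epsilon> * D" by (simp add: D_def \<eta>_def algebra_simps)
      finally show "norm ((\<integral>x. \<phi> (X n x) \<partial>M) - (\<integral>x. \<phi> (W x) \<partial>N)) < r" using \<epsilon>(3) by simp
    qed
  qed
qed

section \<open>Gaussian sequences\<close>

definition psd :: "(nat \<Rightarrow> nat \<Rightarrow> real) \<Rightarrow> bool" where
  "psd c \<longleftrightarrow> (\<forall>i j. c i j = c j i) \<and> (\<forall>S x. finite S \<longrightarrow> 0 \<le> (\<Sum>i\<in>S. \<Sum>j\<in>S. x i * x j * c i j))"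

lemma psd_commute: "psd c \<Longrightarrow> c i j = c j i"
  by (auto simp: psd_def)

lemma psd_quadratic: "psd c \<Longrightarrow> finite S \<Longrightarrow> 0 \<le> (\<Sum>i\<in>S. \<Sum>j\<in>S. x i * x j * c i j)"
  by (auto simp: psd_def)

lemma psd_diagonal: "psd c \<Longrightarrow> 0 \<le> c k k"
  using psd_quadratic[of c "{k}" "\<lambda>_. 1"] by simp

lemma psd_add_coordinate:
  assumes c: "psd c" and S: "finite S"
  shows "0 \<le> (\<Sum>i\<in>S. \<Sum>j\<in>S. x i * x j * c i j) + 2 * t * (\<Sum>i\<in>S. x i * c i k) + t^2 * c k k"
proof -
  define y where "y i = (if i \<in> S then x i else 0)" for i
  define e where "e i = (if i = k then t else 0)" for i
  let ?S = "insert k S"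
  have y: "(\<Sum>i\<in>?S. y i * f i) = (\<Sum>i\<in>S. x i * f i)" for f
    unfolding y_def using S by (intro sum.mono_neutral_cong_right) auto
  have e: "(\<Sum>i\<in>?S. e i * f i) = t * f k" for f
    unfolding e_def using S by (simp add: if_distrib if_distribR sum.delta cong: if_cong)
  have "(\<Sum>i\<in>?S. \<Sum>j\<in>?S. (y i + e i) * (y j + e j) * c i j)
    = (\<Sum>i\<in>?S. y i * (\<Sum>j\<in>?S. y j * c i j)) + (\<Sum>i\<in>?S. y i * (\<Sum>j\<in>?S. e j * c i j))
      + (\<Sum>i\<in>?S. e i * (\<Sum>j\<in>?S. y j * c i j)) + (\<Sum>i\<in>?S. e i * (\<Sum>j\<in>?S. e j * c i j))"
    by (simp only: sum_distrib_left sum.distrib[symmetric]) (simp only: algebra_simps)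
  also have "\<dots> = (\<Sum>i\<in>S. x i * (\<Sum>j\<in>S. x j * c i j)) + (\<Sum>i\<in>S. x i * (t * c i k))
      + t * (\<Sum>j\<in>S. x j * c k j) + t * (t * c k k)"
    by (simp only: y e)
  also have "\<dots> = (\<Sum>i\<in>S. \<Sum>j\<in>S. x i * x j * c i j) + 2 * t * (\<Sum>i\<in>S. x i * c i k) + t^2 * c k k"
  proof -
    have "(\<Sum>j\<in>S. x j * c k j) = (\<Sum>i\<in>S. x i * c i k)"
      by (intro sum.cong refl) (metis psd_commute[OF c])
    then show ?thesis
      by (simp add: sum_distrib_left sum_distrib_right power2_eq_square mult_ac sum.distrib)
  qed
  finally show ?thesis using psd_quadratic[OF c, of ?S "\<lambda>i. y i + e i"] S by simp
qed

lemma psd_zero: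
  assumes c: "psd c" and k: "c k k = 0"
  shows "c i k = 0"
proof (rule ccontr)
  assume nz: "c i k \<noteq> 0"
  have "0 \<le> c i i + 2 * t * c i k" for t
    using psd_add_coordinate[OF c, of "{i}" "\<lambda>_. 1" t k] by (simp add: k)
  from this[of "- (c i i + 1) / (2 * c i k)"] nz show False by (simp add: field_simps)
qed

text \<open>
  Cholesky factorisation by successive Schur complements. A vanishing pivot needs no special
  treatment: its row vanishes by \<open>psd_zero\<close>, and division by zero gives zero.
\<close>

definition schur_step :: "(nat \<Rightarrow> nat \<Rightarrow> real) \<Rightarrow> nat \<Rightarrow> nat \<Rightarrow> nat \<Rightarrow> real" where
  "schur_step d k i j = d i j - d i k * d j k / d k k"

primrec schur :: "(nat \<Rightarrow> nat \<Rightarrow> real) \<Rightarrow> nat \<Rightarrow> nat \<Rightarrow> nat \<Rightarrow> real" where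
  "schur c 0 = c"
| "schur c (Suc k) = schur_step (schur c k) k"

lemma psd_schur: "psd c \<Longrightarrow> psd (schur c k)"
proof (induction k)
  case 0
  then show ?case by (simp add: psd_def)
next
  case (Suc k)
  define d where "d = schur c k"
  have d: "psd d" using Suc by (simp add: d_def)
  show ?case
    unfolding psd_def
  proof (intro conjI allI impI)
    show "schur c (Suc k) i j = schur c (Suc k) j i" for i j
      using psd_commute[OF d, of i j] by (simp add: schur_step_def d_def[symmetric] mult.commute)
    fix S :: "nat set" and x :: "nat \<Rightarrow> real" assume S: "finite S"
    let ?Q = "\<Sum>i\<in>S. \<Sum>j\<in>S. x i * x j * d i j" and ?l = "\<Sum>i\<in>S. x i * d i k"
    have "(\<Sum>i\<in>S. \<Sum>j\<in>S. x i * x j * schur c (Suc k) i j) = ?Q - ?l * ?l / d k k"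
      by (simp add: schur_step_def d_def[symmetric] right_diff_distrib sum_subtractf sum_product
          sum_divide_distrib mult_ac)
    also have "0 \<le> \<dots>"
    proof (cases "d k k = 0")
      case True
      then show ?thesis using psd_quadratic[OF d S] by simp
    next
      case False
      then show ?thesis
        using psd_add_coordinate[OF d S, of x "- ?l / d k k" k]
        by (simp add: power2_eq_square field_simps)
    qed
    finally show "0 \<le> (\<Sum>i\<in>S. \<Sum>j\<in>S. x i * x j * schur c (Suc k) i j)" .
  qed
qed

lemma schur_eq_0:
  assumes "psd c" shows "i < k \<Longrightarrow> schur c k i j = 0"
proof (induction k arbitrary: i j)
  case (Suc k)
  show ?case
  proof (cases "i < k")
    case True
    then show ?thesis using Suc.IH by (simp add: schur_step_def)
  next
    case False
    with Suc.prems have i: "i = k" by simp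
    show ?thesis
    proof (cases "schur c k k k = 0")
      case True
      then show ?thesis
        using psd_zero[OF psd_schur[OF assms] True] psd_commute[OF psd_schur[OF assms], of k k j] i
            by (simp add: schur_step_def)
    next
      case False
      then show ?thesis using psd_commute[OF psd_schur[OF assms], of k k j] i
          by (simp add: schur_step_def)
    qed
  qed
qed simp

definition cholesky :: "(nat \<Rightarrow> nat \<Rightarrow> real) \<Rightarrow> nat \<Rightarrow> nat \<Rightarrow> real" where
  "cholesky c i k = schur c k i k / sqrt (schur c k k k)"

lemma cholesky_upper: "psd c \<Longrightarrow> i < k \<Longrightarrow> cholesky c i k = 0"
  by (simp add: cholesky_def schur_eq_0)

lemma cholesky_remainder:
  assumes "psd c" shows "c i j = (\<Sum>k<m. cholesky c i k * cholesky c j k) + schur c m i j"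
proof (induction m)
  case (Suc m)
  have "cholesky c i m * cholesky c j m = schur c m i m * schur c m j m / schur c m m m"
    using psd_diagonal[OF psd_schur[OF assms]] by (simp add: cholesky_def)
  then show ?case using Suc by (simp add: schur_step_def)
qed simp

lemma cholesky:
  assumes "psd c" "i < m" shows "c i j = (\<Sum>k<m. cholesky c i k * cholesky c j k)"
  using cholesky_remainder[OF assms(1), of i j m] schur_eq_0[OF assms] by simp

theorem gaussian_sequence_exists:
  assumes c: "psd c"
  obtains P :: "(nat \<Rightarrow> real) measure" and W :: "(nat \<Rightarrow> real) \<Rightarrow> nat \<Rightarrow> real" where
    "prob_space P" "W \<in> borel_measurable P"
    "\<And>a J. (\<integral>x. iexp (\<Sum>j<J. a j * W x j) \<partial>P) = complex_of_real (exp (- (\<Sum>i<J. \<Sum>j<J. a i * a j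
        * c i j) / 2))"
proof -
  interpret normal: real_distribution std_normal_distribution by (rule real_dist_normal_dist)
  interpret P: product_prob_space "\<lambda>_::nat. std_normal_distribution" UNIV ..
  define P where "P = PiM (UNIV :: nat set) (\<lambda>_. std_normal_distribution)"
  have prob_P: "prob_space P" unfolding P_def by (rule P.prob_space_axioms)
  interpret PP: prob_space P by (rule prob_P)
  have coord[measurable]: "(\<lambda>\<omega>. \<omega> k) \<in> borel_measurable P" for k
    using measurable_component_singleton[of k UNIV "\<lambda>_. std_normal_distribution"] by (simp add: P_def)
  have distr_coord: "distr P borel (\<lambda>\<omega>. \<omega> k) = std_normal_distribution" for k
    using P.PiM_component[of k] by (simp add: P_def cong: distr_cong)
  have indep: "PP.indep_vars (\<lambda>_. borel) (\<lambda>k \<omega>. \<omega> k) UNIV"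
  proof (subst PP.indep_vars_iff_distr_eq_PiM')
    have "distr P (PiM UNIV (\<lambda>_. borel)) (\<lambda>x. \<lambda>i\<in>UNIV. x i) = distr P P (\<lambda>x. x)"
      by (rule distr_cong) (auto simp: P_def intro!: sets_PiM_cong)
    then show "distr P (PiM UNIV (\<lambda>_. borel)) (\<lambda>x. \<lambda>i\<in>UNIV. x i)
        = PiM UNIV (\<lambda>i. distr P borel (\<lambda>\<omega>. \<omega> i))"
      unfolding distr_coord by (simp add: P_def)
  qed auto
  define W where "W \<omega> j = (\<Sum>k\<le>j. cholesky c j k * \<omega> k)" for \<omega> :: "nat \<Rightarrow> real" and j
  have W: "W \<in> borel_measurable P"
    unfolding W_def by (rule measurable_coordinatewise_then_product) measurable
  have char: "(\<integral>x. iexp (\<Sum>j<J. a j * W x j) \<partial>P)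
      = complex_of_real (exp (- (\<Sum>i<J. \<Sum>j<J. a i * a j * c i j) / 2))" for a J
  proof -
    define b where "b k = (\<Sum>j<J. a j * cholesky c j k)" for k
    have Wj: "W \<omega> j = (\<Sum>k<J. cholesky c j k * \<omega> k)" if "j < J" for \<omega> j
      unfolding W_def using that cholesky_upper[OF c] by (intro sum.mono_neutral_left) auto
    have "(\<Sum>j<J. a j * W \<omega> j) = (\<Sum>k<J. b k * \<omega> k)" for \<omega>
      unfolding b_def sum_distrib_right by (subst sum.swap) (simp add: Wj sum_distrib_left mult.assoc)
    then have "(\<integral>x. iexp (\<Sum>j<J. a j * W x j) \<partial>P) = char (distr P borel (\<lambda>\<omega>. \<Sum>k<J. b k * \<omega> k)) 1"
      by (simp add: char_def integral_distr)
    also have "\<dots> = (\<Prod>k<J. char (distr P borel (\<lambda>\<omega>. b k * \<omega> k)) 1)"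
      by (rule PP.char_distr_sum)
         (rule PP.indep_vars_compose2[OF PP.indep_vars_subset[OF indep subset_UNIV]], measurable)
    also have "\<dots> = (\<Prod>k<J. complex_of_real (exp (- ((b k)\<^sup>2 / 2))))"
    proof (rule prod.cong[OF refl])
      fix k
      have "char (distr P borel (\<lambda>\<omega>. b k * \<omega> k)) 1 = char (distr P borel (\<lambda>\<omega>. \<omega> k)) (b k)"
        by (simp add: char_def integral_distr)
      then show "char (distr P borel (\<lambda>\<omega>. b k * \<omega> k)) 1 = complex_of_real (exp (- ((b k)\<^sup>2 / 2)))"
        by (simp add: distr_coord char_std_normal_distribution)
    qed
    also have "\<dots> = complex_of_real (exp (\<Sum>k<J. - ((b k)\<^sup>2 / 2)))"
      by (simp only: exp_sum[OF finite_lessThan] of_real_prod)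
    also have "(\<Sum>k<J. - ((b k)\<^sup>2 / 2)) = - (\<Sum>k<J. (b k)\<^sup>2) / 2"
      by (simp add: sum_negf sum_divide_distrib)
    also have "(\<Sum>k<J. (b k)\<^sup>2) = (\<Sum>i<J. \<Sum>j<J. a i * a j * c i j)"
    proof -
      have "(\<Sum>k<J. (b k)\<^sup>2) = (\<Sum>k<J. \<Sum>i<J. \<Sum>j<J. a i * a j * (cholesky c i k * cholesky c j k))"
        by (simp add: b_def power2_eq_square sum_product mult_ac)
      also have "\<dots> = (\<Sum>i<J. \<Sum>k<J. \<Sum>j<J. a i * a j * (cholesky c i k * cholesky c j k))"
        by (rule sum.swap)
      also have "\<dots> = (\<Sum>i<J. \<Sum>j<J. \<Sum>k<J. a i * a j * (cholesky c i k * cholesky c j k))"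
        by (intro sum.cong refl sum.swap)
      also have "\<dots> = (\<Sum>i<J. \<Sum>j<J. a i * a j * c i j)"
        by (intro sum.cong refl) (simp add: cholesky[OF c, of _ J] sum_distrib_left)
      finally show ?thesis .
    qed
    finally show ?thesis .
  qed
  show thesis by (rule that[OF prob_P W char])
qed

section \<open>Weak convergence in metric spaces and Gaussian limits\<close>

text \<open>A bounded continuous function is the increasing limit of its Lipschitz inf-convolutions.\<close>

lemma weak_convergence_lipschitz:
  fixes X :: "nat \<Rightarrow> 'a \<Rightarrow> 'm::metric_space" and Z :: "'b \<Rightarrow> 'm" and \<phi> :: "'m \<Rightarrow> real"
  assumes M: "prob_space M" and N: "prob_space N"
    and X: "\<And>n. X n \<in> borel_measurable M" and Z: "Z \<in> borel_measurable N"
    and lip: "\<And>(\<psi> :: 'm \<Rightarrow> real) L B. 0 \<le> L \<Longrightarrow> (\<And>x y. \<bar>\<psi> x - \<psi> y\<bar> \<le> L * dist x y) \<Longrightarrow> (\<And>x. \<bar>\<psi> x\<bar> \<le> B) \<Longrightarrow>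
      (\<lambda>n. \<integral>x. \<psi> (X n x) \<partial>M) \<longlonglongrightarrow> (\<integral>x. \<psi> (Z x) \<partial>N)"
    and \<phi>: "continuous_on UNIV \<phi>" "bounded (range \<phi>)"
  shows "(\<lambda>n. \<integral>x. \<phi> (X n x) \<partial>M) \<longlonglongrightarrow> (\<integral>x. \<phi> (Z x) \<partial>N)"
proof -
  interpret M: prob_space M by fact
  interpret N: prob_space N by fact
  have lower: "\<forall>\<^sub>F n in sequentially. (\<integral>x. \<phi> (Z x) \<partial>N) - \<epsilon> < (\<integral>x. \<phi> (X n x) \<partial>M)"
    if \<phi>: "continuous_on UNIV \<phi>" "bounded (range \<phi>)" and \<epsilon>: "0 < \<epsilon>" for \<phi> :: "'m \<Rightarrow> real" and \<epsilon>
  proof -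
    obtain B where B: "\<And>w. \<bar>\<phi> w\<bar> \<le> B" using \<phi>(2) by (auto simp: bounded_iff)
    have B0: "0 \<le> B" using B[of undefined] by linarith
    define g where "g k x = (INF y. \<phi> y + real k * dist x y)" for k x
    have ge: "- B \<le> \<phi> y + real k * dist x y" for k x y
    proof -
      have "0 \<le> real k * dist x y" by simp
      then show ?thesis using B[of y] by linarith
    qed
    have bdd: "bdd_below (range (\<lambda>y. \<phi> y + real k * dist x y))" for k x
      using ge by (auto intro!: bdd_belowI[of _ "- B"])
    have g_le: "g k x \<le> \<phi> y + real k * dist x y" for k x y
      unfolding g_def by (rule cINF_lower[OF bdd]) simp
    have g_\<phi>: "g k x \<le> \<phi> x" for k x using g_le[of k x x] by simp
    have g_ge: "- B \<le> g k x" for k x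
      unfolding g_def by (rule cINF_greatest) (auto intro: ge)
    have gB: "\<bar>g k x\<bar> \<le> B" for k x using g_\<phi>[of k x] g_ge[of k x] B[of x] by linarith
    have one: "g k x - g k y \<le> real k * dist x y" for k x y
    proof -
      have "g k x - real k * dist x y \<le> g k y"
        unfolding g_def[of k y]
      proof (rule cINF_greatest)
        fix z
        have "g k x \<le> \<phi> z + real k * dist x z" by (rule g_le)
        also have "\<dots> \<le> \<phi> z + real k * (dist x y + dist y z)"
          by (intro add_left_mono mult_left_mono dist_triangle) auto
        finally show "g k x - real k * dist x y \<le> \<phi> z + real k * dist y z" by (simp add: algebra_simps)
      qed simp
      then show ?thesis by simp
    qed
    have lipg: "\<bar>g k x - g k y\<bar> \<le> real k * dist x y" for k x y
      using one[of k x y] one[of k y x] by (simp add: dist_commute abs_le_iff)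
    have contg: "continuous_on UNIV (g k)" for k
      by (rule lipschitz_on_continuous_on[of "real k"]) (auto simp: lipschitz_on_def dist_real_def lipg)
    have g_lim: "(\<lambda>k. g k x) \<longlonglongrightarrow> \<phi> x" for x
    proof (rule LIMSEQ_I)
      fix r :: real assume r: "0 < r"
      obtain d where d: "0 < d" "\<And>y. dist y x < d \<Longrightarrow> dist (\<phi> y) (\<phi> x) < r / 2"
        using \<phi>(1) half_gt_zero[OF r] unfolding continuous_on_iff by (metis UNIV_I)
      obtain k0 :: nat where k0: "2 * B / d < real k0" using reals_Archimedean2 by blast
      show "\<exists>k0. \<forall>k\<ge>k0. norm (g k x - \<phi> x) < r"
      proof (intro exI[of _ k0] allI impI)
        fix k assume k: "k \<ge> k0"
        have "\<phi> x - r / 2 \<le> g k x"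
          unfolding g_def
        proof (rule cINF_greatest)
          fix y
          show "\<phi> x - r / 2 \<le> \<phi> y + real k * dist x y"
          proof (cases "dist x y < d")
            case True
            then have "dist (\<phi> y) (\<phi> x) < r / 2" by (intro d(2)) (simp add: dist_commute)
            then have "\<phi> x - r / 2 \<le> \<phi> y" unfolding dist_real_def abs_less_iff by linarith
            moreover have "0 \<le> real k * dist x y" by simp
            ultimately show ?thesis by linarith
          next
            case False
            have "2 * B \<le> real k0 * d" using k0 d(1) by (simp add: field_simps)
            also have "\<dots> \<le> real k * dist x y" using False k d(1) by (intro mult_mono) auto
            finally show ?thesis using B[of x] B[of y] r by linarith
          qed
        qed simp
        then show "norm (g k x - \<phi> x) < r" using g_\<phi>[of k x] r by simp
      qed
    qed
    have mZ: "(\<lambda>x. h (Z x)) \<in> borel_measurable N" and mX: "(\<lambda>x. h (X n x)) \<in> borel_measurable M"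
      if "continuous_on UNIV h" for h :: "'m \<Rightarrow> real" and n
      using measurable_compose[OF Z borel_measurable_continuous_onI[OF that]]
        measurable_compose[OF X borel_measurable_continuous_onI[OF that]] by auto
    have "(\<lambda>k. \<integral>x. g k (Z x) \<partial>N) \<longlonglongrightarrow> (\<integral>x. \<phi> (Z x) \<partial>N)"
      by (rule integral_dominated_convergence[where w="\<lambda>_. B"])
         (auto simp: mZ \<phi>(1) contg g_lim gB)
    from LIMSEQ_D[OF this half_gt_zero[OF \<epsilon>]] obtain k where k: "\<bar>(\<integral>x. g k (Z x) \<partial>N)
        - (\<integral>x. \<phi> (Z x) \<partial>N)\<bar> < \<epsilon> / 2"
      by (auto simp: real_norm_def)
    have "(\<lambda>n. \<integral>x. g k (X n x) \<partial>M) \<longlonglongrightarrow> (\<integral>x. g k (Z x) \<partial>N)"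
      by (rule lip[of "real k" _ B]) (auto simp: lipg gB)
    then have "\<forall>\<^sub>F n in sequentially. (\<integral>x. g k (Z x) \<partial>N) - \<epsilon> / 2 < (\<integral>x. g k (X n x) \<partial>M)"
      by (rule order_tendstoD(1)) (use \<epsilon> in simp)
    then show ?thesis
    proof eventually_elim
      case (elim n)
      have "(\<integral>x. g k (X n x) \<partial>M) \<le> (\<integral>x. \<phi> (X n x) \<partial>M)"
        using mX[OF \<phi>(1)] mX[OF contg]
        by (intro integral_mono M.integrable_const_bound[of _ B]) (auto simp: B gB g_\<phi>)
      with elim k show ?case by linarith
    qed
  qed
  show ?thesis
  proof (rule LIMSEQ_I)
    fix r :: real assume r: "0 < r"
    have neg: "continuous_on UNIV (\<lambda>x. - \<phi> x)" "bounded (range (\<lambda>x. - \<phi> x))"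
      using \<phi> by (auto intro!: continuous_intros simp: bounded_iff)
    have "\<forall>\<^sub>F n in sequentially. norm ((\<integral>x. \<phi> (X n x) \<partial>M) - (\<integral>x. \<phi> (Z x) \<partial>N)) < r"
      using lower[OF \<phi> r] lower[OF neg r] by eventually_elim (simp add: abs_less_iff)
    then show "\<exists>n0. \<forall>n\<ge>n0. norm ((\<integral>x. \<phi> (X n x) \<partial>M) - (\<integral>x. \<phi> (Z x) \<partial>N)) < r"
      by (simp add: eventually_sequentially)
  qed
qed

lemma char_normal_density:
  assumes "0 < \<sigma>"
  shows "char (density lborel (\<lambda>x. ennreal (normal_density 0 \<sigma> x))) t
      = complex_of_real (exp (- (\<sigma>\<^sup>2 * t\<^sup>2) / 2))"
proof -
  interpret normal: real_distribution std_normal_distribution by (rule real_dist_normal_dist)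
  have "distributed std_normal_distribution lborel (\<lambda>x. x) (normal_density 0 1)"
    by (auto simp: distributed_def intro!: distr_id2)
  then have "distributed std_normal_distribution lborel (\<lambda>x. 0 + \<sigma> * x) (normal_density (0 + \<sigma>
      * 0) (\<bar>\<sigma>\<bar> * 1))"
    using assms by (intro normal.normal_density_affine) auto
  then have "density lborel (\<lambda>x. ennreal (normal_density 0 \<sigma> x))
      = distr std_normal_distribution borel (\<lambda>x. \<sigma> * x)"
    using assms by (simp add: distributed_def cong: distr_cong)
  also have "char \<dots> t = char std_normal_distribution (\<sigma> * t)"
    by (simp add: char_def integral_distr mult_ac)
  finally show ?thesis by (simp add: char_std_normal_distribution power_mult_distrib)
qed

definition gaussian_law :: "real \<Rightarrow> real measure" where
  "gaussian_law \<sigma> = (if \<sigma> = 0 then return borel 0 else density lborel (\<lambda>x. ennreal (normal_density 0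
      \<sigma> x)))"

lemma real_distribution_gaussian_law: "0 \<le> \<sigma> \<Longrightarrow> real_distribution (gaussian_law \<sigma>)"
  by (auto simp: gaussian_law_def real_distribution_def real_distribution_axioms_def
      intro!: prob_space_return prob_space_normal_density)

lemma char_gaussian_law: "0 \<le> \<sigma> \<Longrightarrow> char (gaussian_law \<sigma>) t = complex_of_real (exp (- (\<sigma>\<^sup>2 * t\<^sup>2) / 2))"
  by (auto simp: gaussian_law_def char_normal_density) (simp add: char_def integral_return)

lemma gaussian_law_second_moment:
  assumes "0 \<le> \<sigma>"
  shows "has_bochner_integral (gaussian_law \<sigma>) (\<lambda>x. x\<^sup>2) (\<sigma>\<^sup>2)"
proof (cases "\<sigma> = 0")
  case True
  interpret R: prob_space "return borel (0::real)" by (rule prob_space_return) simp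
  have "integrable (return borel (0::real)) (\<lambda>x. x\<^sup>2)"
    by (rule R.integrable_const_bound[of _ 0]) (auto simp: AE_return)
  then show ?thesis using True by (simp add: gaussian_law_def has_bochner_integral_iff integral_return)
next
  case False
  with assms have \<sigma>: "0 < \<sigma>" by simp
  from normal_moment_even[OF \<sigma>, of 0 1] have "has_bochner_integral lborel (\<lambda>x. normal_density 0 \<sigma> x
      *\<^sub>R x\<^sup>2) (\<sigma>\<^sup>2)"
    by (simp add: power2_eq_square)
  from has_bochner_integral_density[OF _ _ _ this] show ?thesis
    using False by (simp add: gaussian_law_def)
qed

text \<open>The variances converge because the limiting characteristic function does not vanish near \<open>0\<close>.\<close>

lemma gaussian_limit:
  fixes V :: "'a \<Rightarrow> real"
  assumes "prob_space P" and V[measurable]: "V \<in> borel_measurable P"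
    and lim: "\<And>t. (\<lambda>m. complex_of_real (exp (- (v m * t\<^sup>2) / 2))) \<longlonglongrightarrow> (\<integral>x. iexp (t * V x) \<partial>P)"
    and v: "\<And>m. 0 \<le> v m"
  obtains \<sigma> where "0 \<le> \<sigma>" "v \<longlonglongrightarrow> \<sigma>\<^sup>2" "distr P borel V = gaussian_law \<sigma>"
proof -
  interpret prob_space P by fact
  interpret D: real_distribution "distr P borel V" by (rule real_distribution_distr[OF V])
  have char: "(\<integral>x. iexp (t * V x) \<partial>P) = char (distr P borel V) t" for t
    by (simp add: char_def integral_distr)
  have "isCont (char (distr P borel V)) 0" by (rule D.isCont_char)
  then have "\<forall>\<^sub>F t in at 0. char (distr P borel V) t \<noteq> 0"
    using D.char_zero by (intro tendsto_imp_eventually_ne[of _ 1]) (auto simp: isCont_def)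
  then obtain d where d: "0 < d" "\<And>t. t \<noteq> 0 \<Longrightarrow> dist t 0 < d \<Longrightarrow> char (distr P borel V) t \<noteq> 0"
    by (auto simp: eventually_at)
  define t where "t = d / 2"
  have t: "t \<noteq> 0" "char (distr P borel V) t \<noteq> 0"
    using d(1) d(2)[of t] by (auto simp: t_def)
  define l where "l = Re (char (distr P borel V) t)"
  have lim_t: "(\<lambda>m. exp (- (v m * t\<^sup>2) / 2)) \<longlonglongrightarrow> l"
    using tendsto_Re[OF lim[of t, unfolded char]] by (simp add: l_def)
  have "char (distr P borel V) t = complex_of_real l"
    by (rule LIMSEQ_unique[OF lim[unfolded char] tendsto_of_real[OF lim_t]])
  then have "l \<noteq> 0" using t by auto
  moreover have "0 \<le> l" by (rule LIMSEQ_le_const[OF lim_t]) auto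
  ultimately have l: "0 < l" by simp
  have "(\<lambda>m. - 2 * ln (exp (- (v m * t\<^sup>2) / 2)) / t\<^sup>2) \<longlonglongrightarrow> - 2 * ln l / t\<^sup>2"
    using t(1) l by (intro tendsto_intros lim_t) auto
  then have v_lim: "v \<longlonglongrightarrow> - 2 * ln l / t\<^sup>2" using t(1) by simp
  define \<sigma> where "\<sigma> = sqrt (- 2 * ln l / t\<^sup>2)"
  have "0 \<le> - 2 * ln l / t\<^sup>2" by (rule LIMSEQ_le_const[OF v_lim]) (use v in auto)
  then have \<sigma>: "0 \<le> \<sigma>" "\<sigma>\<^sup>2 = - 2 * ln l / t\<^sup>2" by (auto simp: \<sigma>_def)
  have "char (distr P borel V) = char (gaussian_law \<sigma>)"
  proof
    fix s
    have "(\<lambda>m. complex_of_real (exp (- (v m * s\<^sup>2) / 2))) \<longlonglongrightarrow> complex_of_real (exp (- (\<sigma>\<^sup>2 * s\<^sup>2) / 2))"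
      using v_lim unfolding \<sigma>(2)[symmetric] by (intro tendsto_intros) auto
    then show "char (distr P borel V) s = char (gaussian_law \<sigma>) s"
      using LIMSEQ_unique[OF lim[of s, unfolded char]] by (simp add: char_gaussian_law[OF \<sigma>(1)])
  qed
  then have "distr P borel V = gaussian_law \<sigma>"
    by (rule Levy_uniqueness[OF D.real_distribution_axioms real_distribution_gaussian_law[OF \<sigma>(1)]])
  with \<sigma>(1) v_lim show thesis unfolding \<sigma>(2)[symmetric] by (rule that)
qed

section \<open>The space of integrable functions\<close>

lemma l1_rel_refl: "integrable lborel u \<Longrightarrow> l1_rel u u"
  by (simp add: l1_rel_def)

lemma integrable_rep_l1: "integrable lborel (rep_l1 x)"
  using Quotient_rep_reflp[OF Quotient_l1, of x] by (simp add: l1_rel_def)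

lemma abs_rep_l1: "abs_l1 (rep_l1 x) = x"
  by (rule Quotient_abs_rep[OF Quotient_l1])

lemma rep_abs_l1_AE:
  assumes "integrable lborel u" shows "AE t in lborel. rep_l1 (abs_l1 u) t = u t"
  using Quotient_rep_abs[OF Quotient_l1, OF l1_rel_refl[OF assms]] by (simp add: l1_rel_def)

lemma norm_abs_l1: "integrable lborel u \<Longrightarrow> norm (abs_l1 u) = (\<integral>t. \<bar>u t\<bar> \<partial>lborel)"
  by (rule norm_l1.abs_eq) (rule l1_rel_refl)

lemma abs_l1_minus:
  "integrable lborel u \<Longrightarrow> integrable lborel v \<Longrightarrow> abs_l1 u - abs_l1 v = abs_l1 (\<lambda>t. u t - v t)"
  by (rule minus_l1.abs_eq) (rule l1_rel_refl; assumption)+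

lemma dist_abs_l1:
  "integrable lborel u \<Longrightarrow> integrable lborel v \<Longrightarrow> dist (abs_l1 u) (abs_l1 v) = (\<integral>t. \<bar>u t - v t\<bar> \<partial>lborel)"
  by (simp add: dist_norm abs_l1_minus norm_abs_l1)

lemma abs_l1_sum:
  assumes "finite J" "\<And>j. j \<in> J \<Longrightarrow> integrable lborel (u j)"
  shows "abs_l1 (\<lambda>t. \<Sum>j\<in>J. c j * u j t) = (\<Sum>j\<in>J. c j *\<^sub>R abs_l1 (u j))"
  using assms
proof (induction J rule: finite_induct)
  case empty
  then show ?case by (simp add: zero_l1_def)
next
  case (insert j J)
  have "abs_l1 (\<lambda>t. \<Sum>j\<in>insert j J. c j * u j t) = abs_l1 (\<lambda>t. c j * u j t + (\<Sum>j\<in>J. c j * u j t))"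
    using insert.hyps by simp
  also have "\<dots> = abs_l1 (\<lambda>t. c j * u j t) + abs_l1 (\<lambda>t. \<Sum>j\<in>J. c j * u j t)"
    by (rule plus_l1.abs_eq[symmetric]; rule l1_rel_refl)
       (auto intro!: integrable_mult_right Bochner_Integration.integrable_sum insert.prems)
  also have "abs_l1 (\<lambda>t. c j * u j t) = c j *\<^sub>R abs_l1 (u j)"
    by (rule scaleR_l1.abs_eq[symmetric], rule l1_rel_refl) (auto intro!: insert.prems)
  finally show ?case using insert by simp
qed

lemma AE_summable:
  fixes u :: "nat \<Rightarrow> 'a \<Rightarrow> real"
  assumes u: "\<And>k. integrable M (u k)" "\<And>k x. 0 \<le> u k x" and s: "summable (\<lambda>k. \<integral>x. u k x \<partial>M)"
  shows "AE x in M. summable (\<lambda>k. u k x)"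
proof -
  have "(\<integral>\<^sup>+x. (\<Sum>k. ennreal (u k x)) \<partial>M) = (\<Sum>k. \<integral>\<^sup>+x. ennreal (u k x) \<partial>M)"
    using u by (intro nn_integral_suminf) auto
  also have "\<dots> = (\<Sum>k. ennreal (\<integral>x. u k x \<partial>M))"
    using u by (simp add: nn_integral_eq_integral)
  also have "\<dots> = ennreal (\<Sum>k. \<integral>x. u k x \<partial>M)"
    using s u by (intro suminf_ennreal2) auto
  finally have "(\<integral>\<^sup>+x. (\<Sum>k. ennreal (u k x)) \<partial>M) \<noteq> \<infinity>" by simp
  then have "AE x in M. (\<Sum>k. ennreal (u k x)) \<noteq> \<infinity>"
    using u by (intro nn_integral_PInf_AE) auto
  then show ?thesis
    by eventually_elim (use u in \<open>auto intro: summable_suminf_not_top\<close>)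
qed

lemma l1_absolutely_summable:
  fixes x :: "nat \<Rightarrow> l1"
  assumes s: "summable (\<lambda>k. norm (x k))"
  obtains z where "(\<lambda>n. \<Sum>k<n. x k) \<longlonglongrightarrow> z"
proof -
  define u where "u k = rep_l1 (x k)" for k
  have u: "integrable lborel (u k)" and x: "abs_l1 (u k) = x k" for k
    by (auto simp: u_def integrable_rep_l1 abs_rep_l1)
  have nrm: "norm (x k) = (\<integral>t. \<bar>u k t\<bar> \<partial>lborel)" for k
    using norm_abs_l1[OF u, of k] by (simp add: x)
  have ae: "AE t in lborel. summable (\<lambda>k. \<bar>u k t\<bar>)"
    using u s by (intro AE_summable) (auto simp: nrm)
  define v where "v t = (\<Sum>k. u k t)" for t
  have v: "integrable lborel v"
    unfolding v_def using u ae s by (intro integrable_suminf) (auto simp: nrm)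
  have lim: "(\<lambda>n. \<integral>t. \<bar>(\<Sum>k<n. u k t) - v t\<bar> \<partial>lborel) \<longlonglongrightarrow> (\<integral>(t::real). 0 \<partial>lborel)"
  proof (rule integral_dominated_convergence)
    show "integrable lborel (\<lambda>t. 2 * (\<Sum>k. \<bar>u k t\<bar>))"
      using u ae s by (intro integrable_mult_right integrable_suminf) (auto simp: nrm)
    show "AE t in lborel. (\<lambda>n. \<bar>(\<Sum>k<n. u k t) - v t\<bar>) \<longlonglongrightarrow> 0"
      using ae
    proof eventually_elim
      case (elim t)
      have "(\<lambda>n. (\<Sum>k<n. u k t)) \<longlonglongrightarrow> v t"
        unfolding v_def by (rule summable_LIMSEQ[OF summable_rabs_cancel[OF elim]])
      then have "(\<lambda>n. (\<Sum>k<n. u k t) - v t) \<longlonglongrightarrow> 0" by (simp add: LIM_zero)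
      then show ?case by (rule tendsto_rabs_zero)
    qed
    show "AE t in lborel. norm \<bar>(\<Sum>k<n. u k t) - v t\<bar> \<le> 2 * (\<Sum>k. \<bar>u k t\<bar>)" for n
      using ae
    proof eventually_elim
      case (elim t)
      have "\<bar>\<Sum>k<n. u k t\<bar> \<le> (\<Sum>k<n. \<bar>u k t\<bar>)" by (rule sum_abs)
      also have "\<dots> \<le> (\<Sum>k. \<bar>u k t\<bar>)" by (rule sum_le_suminf[OF elim]) auto
      finally have "\<bar>\<Sum>k<n. u k t\<bar> \<le> (\<Sum>k. \<bar>u k t\<bar>)" .
      moreover have "\<bar>v t\<bar> \<le> (\<Sum>k. \<bar>u k t\<bar>)" unfolding v_def by (rule summable_rabs[OF elim])
      ultimately show ?case by simp
    qed
  qed (use u v in auto)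
  have "dist (\<Sum>k<n. x k) (abs_l1 v) = (\<integral>t. \<bar>(\<Sum>k<n. u k t) - v t\<bar> \<partial>lborel)" for n
  proof -
    have "(\<Sum>k<n. x k) = abs_l1 (\<lambda>t. \<Sum>k<n. 1 * u k t)"
      by (subst abs_l1_sum) (auto simp: u x)
    then show ?thesis using u v by (simp add: dist_abs_l1)
  qed
  with lim have "(\<lambda>n. \<Sum>k<n. x k) \<longlonglongrightarrow> abs_l1 v" by (subst tendsto_dist_iff) simp
  then show thesis by (rule that)
qed

lemma linfty_measurable: "g \<in> linfty M \<Longrightarrow> g \<in> borel_measurable M"
  by (simp add: linfty_def)

lemma linfty_integrable_mult:
  assumes g: "g \<in> linfty lborel" and u: "integrable lborel u"
  shows "integrable lborel (\<lambda>t. g t * u t)"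
proof -
  obtain c where c: "AE t in lborel. \<bar>g t\<bar> \<le> c" using g by (auto simp: linfty_def)
  show ?thesis
  proof (rule Bochner_Integration.integrable_bound[of _ "\<lambda>t. c * u t"])
    show "AE t in lborel. norm (g t * u t) \<le> norm (c * u t)"
      using c by eventually_elim (auto simp: abs_mult intro!: mult_right_mono)
  qed (use g[THEN linfty_measurable] u in auto)
qed

lemma l1_pair_abs:
  assumes g: "g \<in> linfty lborel" and u: "integrable lborel u"
  shows "l1_pair g (abs_l1 u) = (\<integral>t. g t * u t \<partial>lborel)"
  unfolding l1_pair_def
proof (rule integral_cong_AE)
  show "AE t in lborel. g t * rep_l1 (abs_l1 u) t = g t * u t"
    using rep_abs_l1_AE[OF u] by eventually_elim simp
qed (use linfty_integrable_mult[OF g integrable_rep_l1] linfty_integrable_mult[OF g u] in auto)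

lemma bounded_linear_l1_pair:
  assumes g: "g \<in> linfty lborel"
  shows "bounded_linear (l1_pair g)"
proof -
  obtain c where c: "AE t in lborel. \<bar>g t\<bar> \<le> c" using g by (auto simp: linfty_def)
  show ?thesis
  proof (rule bounded_linear_intro[where K=c])
    fix x y :: l1
    have "x + y = abs_l1 (\<lambda>t. rep_l1 x t + rep_l1 y t)"
      using plus_l1.abs_eq[OF l1_rel_refl[OF integrable_rep_l1] l1_rel_refl[OF integrable_rep_l1],
          of x y]
      by (simp add: abs_rep_l1)
    then show "l1_pair g (x + y) = l1_pair g x + l1_pair g y"
      using linfty_integrable_mult[OF g integrable_rep_l1]
      by (simp add: l1_pair_abs[OF g] integrable_rep_l1 distrib_left) (simp add: l1_pair_def)
  next
    fix r :: real and x :: l1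
    have "r *\<^sub>R x = abs_l1 (\<lambda>t. r * rep_l1 x t)"
      using scaleR_l1.abs_eq[OF l1_rel_refl[OF integrable_rep_l1], of r x] by (simp add: abs_rep_l1)
    then show "l1_pair g (r *\<^sub>R x) = r *\<^sub>R l1_pair g x"
      by (simp add: l1_pair_abs[OF g] integrable_rep_l1 mult.left_commute[of _ r]) (simp add:
          l1_pair_def)
  next
    fix x :: l1
    have "\<bar>l1_pair g x\<bar> \<le> (\<integral>t. \<bar>g t * rep_l1 x t\<bar> \<partial>lborel)"
      unfolding l1_pair_def by (rule integral_abs_bound)
    also have "\<dots> \<le> (\<integral>t. c * \<bar>rep_l1 x t\<bar> \<partial>lborel)"
    proof (rule integral_mono_AE)
      show "AE t in lborel. \<bar>g t * rep_l1 x t\<bar> \<le> c * \<bar>rep_l1 x t\<bar>"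
        using c by eventually_elim (auto simp: abs_mult intro!: mult_right_mono)
    qed (use linfty_integrable_mult[OF g integrable_rep_l1] integrable_rep_l1 in auto)
    also have "\<dots> = c * norm (abs_l1 (rep_l1 x))" by (simp add: norm_abs_l1 integrable_rep_l1)
    finally show "norm (l1_pair g x) \<le> norm x * c" by (simp add: abs_rep_l1 mult.commute)
  qed
qed

text \<open>
  \<open>right_pt m t\<close> is the first point of the grid \<open>\<int> / (m + 1)\<close> strictly to the right of \<open>t\<close> (the
  empirical process is only right-continuous), and \<open>right_idx m t\<close> is its number in the
  enumeration \<open>rat_point\<close> of the rationals.
\<close>

definition rat_point :: "nat \<Rightarrow> real" where
  "rat_point j = real_of_rat (from_nat j)"

definition right_idx :: "nat \<Rightarrow> real \<Rightarrow> nat" where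
  "right_idx m t = to_nat (of_int (\<lfloor>real (Suc m) * t\<rfloor> + 1) / of_nat (Suc m) :: rat)"

definition right_pt :: "nat \<Rightarrow> real \<Rightarrow> real" where
  "right_pt m t = rat_point (right_idx m t)"

lemma right_pt_eq: "right_pt m t = (of_int \<lfloor>real (Suc m) * t\<rfloor> + 1) / real (Suc m)"
  by (simp add: right_pt_def rat_point_def right_idx_def of_rat_divide of_rat_add)

lemma right_pt_bounds: "t < right_pt m t" "right_pt m t \<le> t + 1 / real (Suc m)" "right_pt m t \<le> t + 1"
proof -
  have "real (Suc m) * t < of_int \<lfloor>real (Suc m) * t\<rfloor> + 1" by linarith
  then show "t < right_pt m t" by (simp add: right_pt_eq pos_less_divide_eq mult.commute del:
      of_nat_Suc)
  have "of_int \<lfloor>real (Suc m) * t\<rfloor> \<le> real (Suc m) * t" by linarith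
  then have "right_pt m t \<le> (real (Suc m) * t + 1) / real (Suc m)"
    unfolding right_pt_eq by (intro divide_right_mono) auto
  also have "\<dots> = t + 1 / real (Suc m)" by (simp add: add_divide_distrib del: of_nat_Suc)
  finally show *: "right_pt m t \<le> t + 1 / real (Suc m)" .
  have "1 / real (Suc m) \<le> 1" by simp
  with * show "right_pt m t \<le> t + 1" by linarith
qed

lemma right_pt_tendsto: "filterlim (\<lambda>m. right_pt m t) (at_right t) sequentially"
proof -
  have "(\<lambda>m. t + 1 / real (Suc m)) \<longlonglongrightarrow> t + 0"
    by (rule tendsto_add[OF tendsto_const LIMSEQ_Suc[OF lim_1_over_n]])
  then have up: "(\<lambda>m. t + 1 / real (Suc m)) \<longlonglongrightarrow> t" by simp
  have "(\<lambda>m. right_pt m t) \<longlonglongrightarrow> t"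
    by (rule tendsto_sandwich[OF _ _ tendsto_const up])
       (use right_pt_bounds in \<open>auto intro!: always_eventually less_imp_le simp del: of_nat_Suc\<close>)
  moreover have "right_pt m t \<noteq> t" for m using right_pt_bounds(1)[of t m] by simp
  ultimately show ?thesis
    using right_pt_bounds(1) by (auto simp: filterlim_at intro!: always_eventually)
qed

lemma right_idx_measurable[measurable]: "right_idx m \<in> borel \<rightarrow>\<^sub>M count_space UNIV"
  unfolding right_idx_def[abs_def] by measurable

lemma right_pt_measurable[measurable]: "right_pt m \<in> borel_measurable borel"
  unfolding right_pt_def[abs_def] by measurable

definition step_proj :: "nat \<Rightarrow> (nat \<Rightarrow> real) \<Rightarrow> real \<Rightarrow> real" where
  "step_proj m w t = (if \<bar>t\<bar> \<le> real m then w (right_idx m t) else 0)"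

definition grid :: "nat \<Rightarrow> nat set" where
  "grid m = right_idx m ` {t. \<bar>t\<bar> \<le> real m}"

definition cell :: "nat \<Rightarrow> nat \<Rightarrow> real \<Rightarrow> real" where
  "cell m j t = (if \<bar>t\<bar> \<le> real m \<and> right_idx m t = j then 1 else 0)"

lemma finite_grid: "finite (grid m)"
proof -
  have "grid m \<subseteq> (\<lambda>i. to_nat (of_int (i + 1) / of_nat (Suc m) :: rat)) ` {- int (Suc m
      * m) .. int (Suc m * m)}"
  proof
    fix j assume "j \<in> grid m"
    then obtain t where t: "\<bar>t\<bar> \<le> real m" "j = right_idx m t" by (auto simp: grid_def)
    have "\<bar>real (Suc m) * t\<bar> \<le> real (Suc m) * real m"
      using t(1) by (simp add: abs_mult mult_left_mono del: of_nat_Suc)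
    moreover have "real (Suc m) * real m = real_of_int (int (Suc m * m))" by (simp add: algebra_simps)
    ultimately have "\<bar>real (Suc m) * t\<bar> \<le> real_of_int (int (Suc m * m))" by (simp only:)
    then have "- int (Suc m * m) \<le> \<lfloor>real (Suc m) * t\<rfloor>" "\<lfloor>real (Suc m) * t\<rfloor> \<le> int (Suc m * m)"
      unfolding le_floor_iff floor_le_iff of_int_minus by linarith+
    then show "j \<in> (\<lambda>i. to_nat (of_int (i + 1) / of_nat (Suc m) :: rat)) ` {- int (Suc m
        * m) .. int (Suc m * m)}"
      by (auto simp: t(2) right_idx_def simp del: of_nat_Suc)
  qed
  then show ?thesis by (rule finite_subset) simp
qed

lemma cell_measurable[measurable]: "cell m j \<in> borel_measurable borel"
  unfolding cell_def[abs_def] by measurable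

lemma integrable_bounded_interval:
  fixes u :: "real \<Rightarrow> real"
  assumes [measurable]: "u \<in> borel_measurable borel" and "\<And>t. \<bar>u t\<bar> \<le> B" "\<And>t. \<bar>t\<bar> > r \<Longrightarrow> u t = 0"
  shows "integrable lborel u"
proof (rule Bochner_Integration.integrable_bound[of _ "\<lambda>t. B * indicator {-r..r} t"])
  show "AE t in lborel. norm (u t) \<le> norm (B * indicator {-r..r} t)"
  proof (rule AE_I2)
    fix t show "norm (u t) \<le> norm (B * indicator {-r..r} t)"
      using assms(2)[of t] assms(3)[of t] by (cases "\<bar>t\<bar> > r") (auto simp: indicator_def abs_le_iff)
  qed
qed (auto intro!: integrable_mult_right integrable_real_indicator simp: emeasure_lborel_Icc_eq)

lemma integrable_cell: "integrable lborel (cell m j)"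
  by (rule integrable_bounded_interval[of _ 1 "real m"]) (auto simp: cell_def)

lemma step_proj_eq_sum: "step_proj m w t = (\<Sum>j\<in>grid m. w j * cell m j t)"
proof (cases "\<bar>t\<bar> \<le> real m")
  case True
  then have "right_idx m t \<in> grid m" by (auto simp: grid_def)
  then show ?thesis
    using True finite_grid[of m] by (simp add: step_proj_def cell_def if_distrib cong: if_cong)
qed (simp add: step_proj_def cell_def)

lemma step_proj_measurable[measurable]: "step_proj m w \<in> borel_measurable borel"
  unfolding step_proj_eq_sum[abs_def] by measurable

lemma integrable_step_proj: "integrable lborel (step_proj m w)"
  unfolding step_proj_eq_sum[abs_def]
  by (intro Bochner_Integration.integrable_sum integrable_mult_right integrable_cell)

definition step_l1 :: "nat \<Rightarrow> (nat \<Rightarrow> real) \<Rightarrow> l1" where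
  "step_l1 m w = abs_l1 (step_proj m w)"

lemma step_l1_eq_sum: "step_l1 m w = (\<Sum>j\<in>grid m. w j *\<^sub>R abs_l1 (cell m j))"
  unfolding step_l1_def step_proj_eq_sum[abs_def]
  by (rule abs_l1_sum) (auto intro: finite_grid integrable_cell)

lemma continuous_on_step_l1: "continuous_on UNIV (step_l1 m)"
  unfolding step_l1_eq_sum[abs_def] by (intro continuous_intros continuous_on_product_coordinates)

lemma step_l1_tendsto:
  assumes [measurable]: "u \<in> borel_measurable borel"
    and lim: "\<And>t. (\<lambda>m. u (right_pt m t)) \<longlonglongrightarrow> u t"
    and le: "\<And>m t. \<bar>u (right_pt m t)\<bar> \<le> w t" and w: "integrable lborel w"
  shows "integrable lborel u" "(\<lambda>m. step_l1 m (\<lambda>j. u (rat_point j))) \<longlonglongrightarrow> abs_l1 u"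
proof -
  have u_le: "\<bar>u t\<bar> \<le> w t" for t
    by (rule LIMSEQ_le_const2[OF tendsto_rabs[OF lim]]) (auto intro: le)
  show u: "integrable lborel u"
    by (rule Bochner_Integration.integrable_bound[OF w]) (use u_le in \<open>auto intro!: AE_I2 intro:
        order_trans[OF _ abs_ge_self]\<close>)
  have proj: "step_proj m (\<lambda>j. u (rat_point j)) t = (if \<bar>t\<bar> \<le> real m then u (right_pt m t) else 0)"
      for m t
    by (simp add: step_proj_def right_pt_def)
  have "(\<lambda>m. \<integral>t. \<bar>step_proj m (\<lambda>j. u (rat_point j)) t - u t\<bar> \<partial>lborel) \<longlonglongrightarrow> (\<integral>(t::real). 0 \<partial>lborel)"
  proof (rule integral_dominated_convergence[where w="\<lambda>t. 2 * w t"])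
    show "AE t in lborel. (\<lambda>m. \<bar>step_proj m (\<lambda>j. u (rat_point j)) t - u t\<bar>) \<longlonglongrightarrow> 0"
    proof (rule AE_I2)
      fix t :: real
      obtain m0 :: nat where m0: "\<bar>t\<bar> \<le> real m0" using real_arch_simple by blast
      have "\<forall>\<^sub>F m in sequentially. step_proj m (\<lambda>j. u (rat_point j)) t = u (right_pt m t)"
        unfolding proj using m0 by (auto simp: eventually_sequentially intro!: exI[of _ m0])
      then have "(\<lambda>m. step_proj m (\<lambda>j. u (rat_point j)) t) \<longlonglongrightarrow> u t"
        using lim[of t] by (simp add: tendsto_cong)
      then show "(\<lambda>m. \<bar>step_proj m (\<lambda>j. u (rat_point j)) t - u t\<bar>) \<longlonglongrightarrow> 0"
        by (intro tendsto_rabs_zero) (simp add: LIM_zero)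
    qed
    show "AE t in lborel. norm \<bar>step_proj m (\<lambda>j. u (rat_point j)) t - u t\<bar> \<le> 2 * w t" for m
    proof (rule AE_I2)
      fix t
      show "norm \<bar>step_proj m (\<lambda>j. u (rat_point j)) t - u t\<bar> \<le> 2 * w t"
        using le[of m t] u_le[of t] by (auto simp: proj)
    qed
  qed (use w in auto)
  then have "(\<lambda>m. dist (step_l1 m (\<lambda>j. u (rat_point j))) (abs_l1 u)) \<longlonglongrightarrow> 0"
    by (simp add: step_l1_def dist_abs_l1 integrable_step_proj u)
  then show "(\<lambda>m. step_l1 m (\<lambda>j. u (rat_point j))) \<longlonglongrightarrow> abs_l1 u"
    by (subst tendsto_dist_iff)
qed

section \<open>The empirical process of a monotone observable\<close>

locale monotone_observable = bv_map +
  fixes f :: "real \<Rightarrow> real"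
  assumes sets_\<mu>: "sets \<mu> = sets (restrict_space borel {0..1})"
    and f_monotone: "mono_on {0<..<1} f \<or> antimono_on {0<..<1} f"
    and f_tail: "(\<integral>\<^sup>+t\<in>{0..}. ennreal (sqrt (prob {x \<in> {0<..<1}. \<bar>f x\<bar> > t})) \<partial>lborel) < \<infinity>"
begin

lemma f_measurable[measurable]: "f \<in> borel_measurable \<mu>"
proof -
  have r: "f \<in> borel_measurable (restrict_space borel {0<..<1})"
    using f_monotone
  proof
    assume "mono_on {0<..<1} f"
    then show ?thesis by (intro borel_measurable_mono_on_fnc) auto
  next
    assume "antimono_on {0<..<1} f"
    then have "mono_on {0<..<1} (\<lambda>x. - f x)" by (auto simp: monotone_on_def)
    then have "(\<lambda>x. - f x) \<in> borel_measurable (restrict_space borel {0<..<1})"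
      by (intro borel_measurable_mono_on_fnc) auto
    then have "(\<lambda>x. - (- f x)) \<in> borel_measurable (restrict_space borel {0<..<1})"
        by (rule borel_measurable_uminus)
    then show ?thesis by simp
  qed
  then have [measurable]: "(\<lambda>x. indicator {0<..<1} x *\<^sub>R f x) \<in> borel_measurable borel"
    by (subst (asm) borel_measurable_restrict_space_iff) auto
  have "(\<lambda>x. if x = 0 then f 0 else if x = 1 then f 1 else indicator {0<..<1} x *\<^sub>R f x) \<in>
      borel_measurable borel"
    by measurable
  then have "(\<lambda>x. if x = 0 then f 0 else if x = 1 then f 1 else indicator {0<..<1} x *\<^sub>R f x) \<in>
      borel_measurable \<mu>"
    unfolding measurable_cong_sets[OF sets_\<mu> refl] by (rule measurable_restrict_space1)
  then show ?thesis
    by (rule measurable_cong[THEN iffD1, rotated]) (auto simp: space_\<mu> indicator_def)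
qed

definition below :: "real \<Rightarrow> real \<Rightarrow> real" where
  "below t x = (if f x \<le> t then 1 else 0)"

lemma below_measurable[measurable]: "below t \<in> borel_measurable \<mu>"
  unfolding below_def[abs_def] by measurable

lemma bm_below: "bm (below t)"
  by (rule bmI[of _ 1]) (auto simp: below_def)

lemma bv_below: "bv 3 (below t)"
proof -
  define m0 m1 :: real where
    "m0 = (if mono_on {0<..<1} f then 1 else 0)" and "m1 = (if mono_on {0<..<1} f then 0 else 1)"
  define m where "m x = (if x \<le> 0 then m0 else if 1 \<le> x then m1 else below t x)" for x :: real
  have "bv 1 m"
  proof (cases "mono_on {0<..<1} f")
    case True
    have "m y \<le> m x" if "x \<in> {0..1}" "y \<in> {0..1}" "x \<le> y" for x y
    proof (cases "x \<le> 0 \<or> 1 \<le> y")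
      case False
      then have "x \<in> {0<..<1}" "y \<in> {0<..<1}" using that by auto
      then have "f x \<le> f y" using True that(3) by (auto simp: monotone_on_def)
      then show ?thesis using False that by (auto simp: m_def below_def)
    qed (use True that in \<open>auto simp: m_def m0_def m1_def below_def\<close>)
    then have "antimono_on {0..1} m" by (auto simp: monotone_on_def)
    then show ?thesis by (rule bv_antimono_on) (auto simp: m_def m0_def m1_def below_def)
  next
    case False
    with f_monotone have "antimono_on {0<..<1} f" by blast
    have "m x \<le> m y" if "x \<in> {0..1}" "y \<in> {0..1}" "x \<le> y" for x y
    proof (cases "x \<le> 0 \<or> 1 \<le> y")
      case in01: False
      then have "x \<in> {0<..<1}" "y \<in> {0<..<1}" using that by auto
      then have "f y \<le> f x" using \<open>antimono_on {0<..<1} f\<close> that(3) by (auto simp: monotone_on_def)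
      then show ?thesis using in01 that by (auto simp: m_def below_def)
    qed (use False that in \<open>auto simp: m_def m0_def m1_def below_def\<close>)
    then have "mono_on {0..1} m" by (auto simp: monotone_on_def)
    then show ?thesis by (rule bv_mono_on) (auto simp: m_def m0_def m1_def below_def)
  qed
  moreover have "bv (\<bar>below t 0 - m0\<bar> * 1) (\<lambda>x. (below t 0 - m0) * (if x \<le> 0 then 1 else 0))"
    by (intro bv_cmult bv_antimono_on) (auto simp: monotone_on_def)
  then have "bv 1 (\<lambda>x. (below t 0 - m0) * (if x \<le> 0 then 1 else 0))"
    by (rule bv_mono) (auto simp: below_def m0_def)
  moreover have "bv (\<bar>below t 1 - m1\<bar> * 1) (\<lambda>x. (below t 1 - m1) * (if 1 \<le> x then 1 else 0))"
    by (intro bv_cmult bv_mono_on) (auto simp: monotone_on_def)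
  then have "bv 1 (\<lambda>x. (below t 1 - m1) * (if 1 \<le> x then 1 else 0))"
    by (rule bv_mono) (auto simp: below_def m1_def)
  ultimately have "bv (1 + 1 + 1) (\<lambda>x. m x + (below t 0 - m0) * (if x
      \<le> 0 then 1 else 0) + (below t 1 - m1) * (if 1 \<le> x then 1 else 0))"
    by (intro bv_add)
  then have "bv (1 + 1 + 1) (below t)"
    by (rule bv_cong) (auto simp: m_def)
  then show ?thesis by simp
qed

definition F :: "real \<Rightarrow> real" where
  "F t = (\<integral>x. below t x \<partial>\<mu>)"

lemma F_prob: "F t = prob {x\<in>space \<mu>. f x \<le> t}"
proof -
  have "F t = (\<integral>x. indicator {x\<in>space \<mu>. f x \<le> t} x \<partial>\<mu>)"
    unfolding F_def by (intro Bochner_Integration.integral_cong) (auto simp: below_def)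
  then show ?thesis by simp
qed

lemma F_cdf: "F t = cdf (distr \<mu> borel f) t"
  unfolding F_prob cdf_def by (subst measure_distr) (auto intro!: arg_cong[where f=prob])

lemma F_bounds: "0 \<le> F t" "F t \<le> 1"
  by (auto simp: F_prob)

lemma F_mono: "s \<le> t \<Longrightarrow> F s \<le> F t"
  unfolding F_prob by (intro finite_measure_mono) auto

lemma F_measurable[measurable]: "F \<in> borel_measurable borel"
  by (rule borel_measurable_mono) (auto simp: mono_def F_mono)

lemma F_right_continuous: "(F \<longlongrightarrow> F t) (at_right t)"
proof -
  interpret D: real_distribution "distr \<mu> borel f" by (rule real_distribution_distr) measurable
  have "continuous (at_right t) (cdf (distr \<mu> borel f))" by (rule D.cdf_is_right_cont)
  then show ?thesis by (simp add: continuous_within F_cdf[abs_def])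
qed

lemma F_right_pt: "(\<lambda>m. F (right_pt m t)) \<longlonglongrightarrow> F t"
  by (rule filterlim_compose[OF F_right_continuous right_pt_tendsto])

lemma ctr_below: "ctr (below t) x = below t x - F t"
  by (simp add: ctr_def F_def)

lemma mad_01:
  assumes h: "bm h" "\<And>x. x \<in> space \<mu> \<Longrightarrow> h x \<in> {0, 1}"
  shows "mad h = 2 * (\<integral>x. h x \<partial>\<mu>) * (1 - (\<integral>x. h x \<partial>\<mu>))" "(\<integral>x. h x \<partial>\<mu>) \<in> {0..1}"
    "x \<in> space \<mu> \<Longrightarrow> \<bar>ctr h x\<bar> \<le> 1"
proof -
  define p where "p = (\<integral>x. h x \<partial>\<mu>)"
  note i = bm_integrable[OF h(1)]
  have "0 \<le> p" unfolding p_def using h(2) by (intro integral_nonneg_AE AE_I2) force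
  moreover have "p \<le> (\<integral>x. 1 \<partial>\<mu>)" unfolding p_def using h(2) i by (intro integral_mono) force+
  ultimately have p: "0 \<le> p" "p \<le> 1" by (auto simp: prob_space)
  then show "(\<integral>x. h x \<partial>\<mu>) \<in> {0..1}" by (simp add: p_def)
  show "x \<in> space \<mu> \<Longrightarrow> \<bar>ctr h x\<bar> \<le> 1"
    using h(2)[of x] p by (auto simp: ctr_def p_def[symmetric])
  have "mad h = (\<integral>x. h x * (1 - p) + (1 - h x) * p \<partial>\<mu>)"
    unfolding mad_def ctr_def p_def[symmetric]
    using h(2) p by (intro Bochner_Integration.integral_cong refl) force
  also have "\<dots> = p * (1 - p) + (1 - p) * p"
    using i by (simp add: prob_space p_def[symmetric])
  finally show "mad h = 2 * (\<integral>x. h x \<partial>\<mu>) * (1 - (\<integral>x. h x \<partial>\<mu>))"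
    by (simp add: p_def[symmetric])
qed

lemma below_01: "below t x \<in> {0, 1}"
  by (simp add: below_def)

lemma abs_ctr_below_le: "x \<in> space \<mu> \<Longrightarrow> \<bar>ctr (below t) x\<bar> \<le> 1"
  by (rule mad_01(3)[OF bm_below below_01])

lemma mad_below: "mad (below t) = 2 * F t * (1 - F t)"
  using mad_01(1)[OF bm_below below_01] by (simp add: F_def)

definition slice :: "real \<Rightarrow> real \<Rightarrow> real \<Rightarrow> real" where
  "slice s t x = below t x - below s x"

lemma bm_slice: "bm (slice s t)"
  unfolding slice_def[abs_def] by (intro bm_diff bm_below)

lemma bv_slice: "bv 6 (slice s t)"
  using bv_diff[OF bv_below bv_below] by (simp add: slice_def[abs_def])

lemma bv_below6: "bv 6 (below t)"
  by (rule bv_mono[OF bv_below]) simp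

lemma integral_slice: "(\<integral>x. slice s t x \<partial>\<mu>) = F t - F s"
  using bm_integrable[OF bm_below] by (simp add: slice_def F_def)

lemma ctr_slice: "ctr (slice s t) x = ctr (below t) x - ctr (below s) x"
  using integral_slice by (simp add: ctr_def F_def slice_def)

lemma slice_01: "s \<le> t \<Longrightarrow> slice s t x \<in> {0, 1}"
  by (auto simp: slice_def below_def)

lemma abs_ctr_slice_le: "s \<le> t \<Longrightarrow> x \<in> space \<mu> \<Longrightarrow> \<bar>ctr (slice s t) x\<bar> \<le> 1"
  by (rule mad_01(3)[OF bm_slice slice_01])

lemma mad_slice: "s \<le> t \<Longrightarrow> mad (slice s t) \<le> 2 * (F t - F s)"
  using mad_01(1,2)[OF bm_slice slice_01, of s t] by (simp add: integral_slice mult_left_le)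

text \<open>
  The shift by \<open>2\<close> makes \<open>tail2 t\<close> bound the distribution function at all points of \<open>[t, t + 1]\<close>,
  in particular at \<open>right_pt m t\<close>.
\<close>

definition tail2 :: "real \<Rightarrow> real" where
  "tail2 t = prob {x\<in>space \<mu>. \<bar>t\<bar> - 2 < \<bar>f x\<bar>}"

definition tail :: "real \<Rightarrow> real" where
  "tail t = sqrt (tail2 t)"

lemma tail2_bounds: "0 \<le> tail2 t" "tail2 t \<le> 1"
  by (auto simp: tail2_def)

lemma tail_bounds: "0 \<le> tail t" "tail t \<le> 1"
  using tail2_bounds by (auto simp: tail_def)

lemma tail_sq: "(tail t)\<^sup>2 = tail2 t"
  using tail2_bounds by (simp add: tail_def)

lemma tail2_le_tail: "tail2 t \<le> tail t"
  using tail_bounds[of t] by (simp add: tail_sq[symmetric] power2_eq_square mult_left_le)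

lemma tail2_measurable[measurable]: "tail2 \<in> borel_measurable borel"
proof -
  have "antimono (\<lambda>r. prob {x\<in>space \<mu>. r < \<bar>f x\<bar>})"
    by (auto simp: antimono_def intro!: finite_measure_mono)
  then have "mono (\<lambda>r. - prob {x\<in>space \<mu>. r < \<bar>f x\<bar>})" by (auto simp: mono_def antimono_def)
  then have "(\<lambda>r. - prob {x\<in>space \<mu>. r < \<bar>f x\<bar>}) \<in> borel_measurable borel"
      by (rule borel_measurable_mono)
  then have "(\<lambda>r. - (- prob {x\<in>space \<mu>. r < \<bar>f x\<bar>})) \<in> borel_measurable borel"
      by (rule borel_measurable_uminus)
  then have [measurable]: "(\<lambda>r. prob {x\<in>space \<mu>. r < \<bar>f x\<bar>}) \<in> borel_measurable borel" by simp
  show ?thesis unfolding tail2_def[abs_def] by measurable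
qed

lemma tail_measurable[measurable]: "tail \<in> borel_measurable borel"
  unfolding tail_def[abs_def] by measurable

lemma F_tail:
  assumes "t \<le> d" "d \<le> t + 1"
  shows "F d * (1 - F d) \<le> tail2 t"
proof (cases "0 \<le> t")
  case True
  have "1 - F d = prob {x\<in>space \<mu>. d < f x}"
  proof -
    have "{x\<in>space \<mu>. d < f x} = space \<mu> - {x\<in>space \<mu>. f x \<le> d}" by auto
    then show ?thesis unfolding F_prob by (simp add: prob_compl)
  qed
  also have "\<dots> \<le> tail2 t"
    unfolding tail2_def using True assms by (intro finite_measure_mono) auto
  finally have "1 - F d \<le> tail2 t" .
  moreover have "F d * (1 - F d) \<le> 1 * (1 - F d)" using F_bounds by (intro mult_right_mono) auto
  ultimately show ?thesis by simp
next
  case False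
  have "F d \<le> tail2 t"
    unfolding tail2_def F_prob using False assms by (intro finite_measure_mono) auto
  moreover have "F d * (1 - F d) \<le> F d" using F_bounds by (simp add: mult_left_le)
  ultimately show ?thesis by simp
qed

lemma F_diff_tail:
  assumes "t \<le> d" "d \<le> t + 1"
  shows "F d - F t \<le> tail2 t"
proof -
  have "F d - F t = prob ({x\<in>space \<mu>. f x \<le> d} - {x\<in>space \<mu>. f x \<le> t})"
    unfolding F_prob using assms by (intro finite_measure_Diff[symmetric]) auto
  also have "\<dots> \<le> tail2 t"
    unfolding tail2_def using assms by (intro finite_measure_mono) auto
  finally show ?thesis .
qed

lemma abs_ctr_below_tail:
  assumes "t \<le> d" "d \<le> t + 1" "x \<in> space \<mu>"
  shows "\<bar>ctr (below d) x\<bar> \<le> tail2 t + indicator {t. \<bar>t\<bar> - 2 < \<bar>f x\<bar>} t"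
proof (cases "\<bar>t\<bar> - 2 < \<bar>f x\<bar>")
  case True
  then show ?thesis using abs_ctr_below_le[OF assms(3), of d] tail2_bounds[of t] by simp
next
  case False
  show ?thesis
  proof (cases "0 \<le> t")
    case True
    then have b: "below d x = 1" using False assms by (auto simp: below_def)
    have "1 - F d = prob {x\<in>space \<mu>. d < f x}"
    proof -
      have "{x\<in>space \<mu>. d < f x} = space \<mu> - {x\<in>space \<mu>. f x \<le> d}" by auto
      then show ?thesis unfolding F_prob by (simp add: prob_compl)
    qed
    also have "\<dots> \<le> tail2 t"
      unfolding tail2_def using True assms by (intro finite_measure_mono) auto
    finally show ?thesis using False b F_bounds[of d] by (simp add: ctr_below)
  next
    case t: False
    then have b: "below d x = 0" using False assms by (auto simp: below_def)
    have "F d \<le> tail2 t"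
      unfolding tail2_def F_prob using t assms by (intro finite_measure_mono) auto
    then show ?thesis using False b F_bounds[of d] by (simp add: ctr_below)
  qed
qed

lemma integrable_tail: "integrable lborel tail"
proof -
  define g where "g r = sqrt (prob {x\<in>{0<..<1}. \<bar>f x\<bar> > r})" for r :: real
  have sub: "{x\<in>{0<..<1}. \<bar>f x\<bar> > r} = {x\<in>space \<mu>. r < \<bar>f x\<bar> \<and> 0 < x \<and> x < 1}" for r
    by (auto simp: space_\<mu>)
  have id: "(\<lambda>x. x) \<in> borel_measurable \<mu>"
    unfolding measurable_cong_sets[OF sets_\<mu> refl] by (rule measurable_restrict_space1) simp
  have ms: "{x\<in>{0<..<1}. \<bar>f x\<bar> > r} \<in> sets \<mu>" for r
  proof -
    note [measurable] = id
    show ?thesis unfolding sub by measurable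
  qed
  have "g s \<le> g r" if "r \<le> s" for r s
    unfolding g_def using that by (intro real_sqrt_le_mono finite_measure_mono ms) auto
  then have "mono (\<lambda>r. - g r)" by (auto simp: mono_def)
  then have "(\<lambda>r. - g r) \<in> borel_measurable borel" by (rule borel_measurable_mono)
  then have "(\<lambda>r. - (- g r)) \<in> borel_measurable borel" by (rule borel_measurable_uminus)
  then have [measurable]: "g \<in> borel_measurable borel" by simp
  define B where "B = max \<bar>f 0\<bar> \<bar>f 1\<bar> + 2"
  have gi: "set_integrable lborel {0..} g"
    unfolding set_integrable_def
  proof (rule integrableI_bounded)
    have "ennreal (norm (indicator {0..} t *\<^sub>R g t)) = ennreal (g t) * indicator {0..} t" for t :: real
      by (auto simp: indicator_def g_def)
    then show "(\<integral>\<^sup>+t. ennreal (norm (indicator {0..} t *\<^sub>R g t)) \<partial>lborel) < \<infinity>"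
      using f_tail by (simp add: g_def)
  qed measurable
  define G where "G t = indicator {0..} t * g t" for t
  have G: "integrable lborel G" using gi by (simp add: set_integrable_def G_def[abs_def])
  have G1: "integrable lborel (\<lambda>t. G (-2 + 1 * t))"
      by (subst lborel_integrable_real_affine_iff) (auto simp: G)
  have G2: "integrable lborel (\<lambda>t. G (-2 + (-1) * t))"
      by (subst lborel_integrable_real_affine_iff) (auto simp: G)
  have I: "integrable lborel (\<lambda>t. indicator {- B .. B} t :: real)"
    by (intro integrable_real_indicator) (auto simp: emeasure_lborel_Icc_eq)
  have G0: "0 \<le> G r" for r by (auto simp: G_def g_def)
  have le: "tail t \<le> G (-2 + 1 * t) + G (-2 + (-1) * t) + indicator {- B .. B} t" for t
  proof (cases "\<bar>t\<bar> \<le> B")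
    case True
    from G0[of "-2 + 1 * t"] G0[of "-2 + (-1) * t"] True show ?thesis
      using tail_bounds[of t] by (simp add: abs_le_iff)
  next
    case False
    then have big: "\<bar>f 0\<bar> \<le> \<bar>t\<bar> - 2" "\<bar>f 1\<bar> \<le> \<bar>t\<bar> - 2" "0 \<le> \<bar>t\<bar> - 2" by (auto simp: B_def)
    have "{x\<in>space \<mu>. \<bar>t\<bar> - 2 < \<bar>f x\<bar>} = {x\<in>{0<..<1}. \<bar>f x\<bar> > \<bar>t\<bar> - 2}"
    proof -
      have "x \<in> {0<..<1}" if "x \<in> {0..1}" "\<bar>t\<bar> - 2 < \<bar>f x\<bar>" for x
        using that big by (cases "x = 0"; cases "x = 1") auto
      then show ?thesis by (auto simp: space_\<mu>)
    qed
    then have "tail t = G (\<bar>t\<bar> - 2)" using big by (simp add: tail_def tail2_def G_def g_def)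
    then show ?thesis
      using G0[of "-2 + 1 * t"] G0[of "-2 + (-1) * t"] by (cases "0 \<le> t") (auto simp: algebra_simps)
  qed
  show ?thesis
    by (rule Bochner_Integration.integrable_bound[OF Bochner_Integration.integrable_add[OF
        Bochner_Integration.integrable_add[OF G1 G2] I]])
       (use le tail_bounds in \<open>auto intro!: AE_I2 intro: order_trans[OF _ abs_ge_self]\<close>)
qed

lemma integrable_tail2: "integrable lborel tail2"
  by (rule Bochner_Integration.integrable_bound[OF integrable_tail])
     (use tail2_bounds tail2_le_tail tail_bounds in \<open>auto intro!: AE_I2\<close>)

end

context monotone_observable
begin

definition emp :: "nat \<Rightarrow> real \<Rightarrow> real \<Rightarrow> real" where
  "emp n x t = (\<Sum>j=1..n. ctr (below t) ((T ^^ j) x)) / sqrt (real n)"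

lemma empirical_process_eq_emp: "empirical_process \<mu> (\<lambda>k x. f ((T ^^ k) x)) n = emp n"
proof (intro ext)
  fix x t
  show "empirical_process \<mu> (\<lambda>k x. f ((T ^^ k) x)) n x t = emp n x t"
  proof (cases "n = 0")
    case False
    have "indicator {..t} y = (if y \<le> t then 1 else 0 :: real)" for y by (simp add: indicator_def)
    then have "(\<Sum>j=1..n. ctr (below t) ((T ^^ j) x))
        = (\<Sum>j=1..n. indicator {..t} (f ((T ^^ j) x))) - real n * F t"
      by (simp add: ctr_below below_def sum_subtractf)
    moreover have "r * ((1 / (r * r)) * S - c) = (S - r * r * c) / r" if "0 < r" for r S c :: real
      using that by (simp add: field_simps)
    from this[of "sqrt (real n)"] have "sqrt (real n) * ((1 / real n) * S - c)
        = (S - real n * c) / sqrt (real n)" for S c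
      using False by simp
    ultimately show ?thesis
      by (simp only: empirical_process_def emp_def F_cdf funpow_0)
  qed (simp add: empirical_process_def emp_def)
qed

lemma below_joint_measurable[measurable]:
  "(\<lambda>(x, t). below t x) \<in> borel_measurable (\<mu> \<Otimes>\<^sub>M borel)"
  unfolding below_def by measurable

lemma below_pow_joint_measurable[measurable]:
  "(\<lambda>(x, t). below t ((T ^^ j) x)) \<in> borel_measurable (\<mu> \<Otimes>\<^sub>M borel)"
  unfolding below_def by measurable

lemma emp_joint_measurable[measurable]: "(\<lambda>(x, t). emp n x t) \<in> borel_measurable (\<mu> \<Otimes>\<^sub>M borel)"
  unfolding emp_def ctr_below split_beta'
  by (intro borel_measurable_divide borel_measurable_sum borel_measurable_diff borel_measurable_const)
     (use below_pow_joint_measurable in \<open>auto simp: split_beta'\<close>)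

lemma emp_measurable1[measurable]: "(\<lambda>x. emp n x t) \<in> borel_measurable \<mu>"
  unfolding emp_def ctr_below by measurable

lemma emp_measurable2[measurable]: "x \<in> space \<mu> \<Longrightarrow> emp n x \<in> borel_measurable borel"
  using measurable_compose[OF measurable_Pair1' emp_joint_measurable[of n], of x] by simp

lemma emp_right_pt: "(\<lambda>m. emp n x (right_pt m t)) \<longlonglongrightarrow> emp n x t"
proof -
  have "(\<lambda>m. below (right_pt m t) y) \<longlonglongrightarrow> below t y" for y
  proof (cases "f y \<le> t")
    case True
    then have "below (right_pt m t) y = 1" for m
      using right_pt_bounds(1)[of t m] by (simp add: below_def)
    then show ?thesis using True by (simp add: below_def)
  next
    case False
    have "(\<lambda>m. right_pt m t) \<longlonglongrightarrow> t" using right_pt_tendsto by (simp add: filterlim_at)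
    then have "\<forall>\<^sub>F m in sequentially. right_pt m t < f y"
        by (rule order_tendstoD(2)) (use False in simp)
    then have "\<forall>\<^sub>F m in sequentially. below (right_pt m t) y = below t y"
      by eventually_elim (use False in \<open>simp add: below_def\<close>)
    then show ?thesis by (rule tendsto_eventually)
  qed
  then show ?thesis
    unfolding emp_def ctr_below
    by (cases "n = 0") (auto intro!: tendsto_divide tendsto_sum tendsto_diff F_right_pt)
qed

lemma emp_dominated:
  fixes n :: nat
  assumes x: "x \<in> space \<mu>"
  defines "w \<equiv> \<lambda>t. (\<Sum>j=1..n. tail2 t + indicator {t. \<bar>t\<bar> - 2 < \<bar>f ((T ^^ j) x)\<bar>} t) / sqrt (real n)"
  shows "integrable lborel w" "\<bar>emp n x (right_pt m t)\<bar> \<le> w t"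
proof -
  have i: "integrable lborel (\<lambda>t. indicator {t. \<bar>t\<bar> - 2 < r} t :: real)" for r :: real
  proof (rule integrable_bounded_interval[of _ 1 "r + 2"])
  qed (auto simp: indicator_def)
  show "integrable lborel w"
    unfolding w_def by (intro integrable_divide Bochner_Integration.integrable_sum
        Bochner_Integration.integrable_add integrable_tail2 i)
  have "\<bar>\<Sum>j=1..n. ctr (below (right_pt m t)) ((T ^^ j) x)\<bar>
      \<le> (\<Sum>j=1..n. \<bar>ctr (below (right_pt m t)) ((T ^^ j) x)\<bar>)"
    by (rule sum_abs)
  also have "\<dots> \<le> (\<Sum>j=1..n. tail2 t + indicator {t. \<bar>t\<bar> - 2 < \<bar>f ((T ^^ j) x)\<bar>} t)"
    using right_pt_bounds[where t=t and m=m] by (intro sum_mono abs_ctr_below_tail T_pow_space x) auto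
  finally show "\<bar>emp n x (right_pt m t)\<bar> \<le> w t"
    unfolding emp_def w_def by (simp add: divide_right_mono)
qed

definition emp_seq :: "nat \<Rightarrow> real \<Rightarrow> nat \<Rightarrow> real" where
  "emp_seq n x j = emp n x (rat_point j)"

lemma
  assumes x: "x \<in> space \<mu>"
  shows integrable_emp: "integrable lborel (emp n x)"
    and step_emp_tendsto: "(\<lambda>m. step_l1 m (emp_seq n x)) \<longlonglongrightarrow> abs_l1 (emp n x)"
  using step_l1_tendsto[OF emp_measurable2[OF x] emp_right_pt emp_dominated(2)[OF x]
      emp_dominated(1)[OF x], of n]
  by (auto simp: emp_seq_def[abs_def])

lemma emp_seq_measurable[measurable]: "emp_seq n \<in> borel_measurable \<mu>"
  unfolding emp_seq_def[abs_def] by (rule measurable_coordinatewise_then_product) measurable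

lemma step_l1_measurable[measurable (raw)]:
  "X \<in> borel_measurable M \<Longrightarrow> (\<lambda>x. step_l1 m (X x)) \<in> borel_measurable M"
  by (rule measurable_compose[OF _ borel_measurable_continuous_onI[OF continuous_on_step_l1]])

lemma emp_l1_measurable[measurable]: "(\<lambda>x. abs_l1 (emp n x)) \<in> borel_measurable \<mu>"
  by (rule borel_measurable_LIMSEQ_metric[OF _ step_emp_tendsto]) measurable

definition var_const :: real where
  "var_const = 2 * sqrt (C1 * 6) / (1 - sqrt \<rho>)"

lemma var_const_nonneg: "0 \<le> var_const"
  using sqrt_\<rho> C1_ge_1 by (simp add: var_const_def)

lemma second_moment_le:
  assumes h: "bm h" "bv 6 h" "\<And>x. x \<in> space \<mu> \<Longrightarrow> \<bar>ctr h x\<bar> \<le> 1"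
  shows "(\<integral>x. ((\<Sum>j=1..n. ctr h ((T ^^ j) x)) / sqrt (real n))\<^sup>2 \<partial>\<mu>) \<le> var_const * mad h"
proof (cases "n = 0")
  case False
  have "(\<integral>x. ((\<Sum>j=1..n. ctr h ((T ^^ j) x)) / sqrt (real n))\<^sup>2 \<partial>\<mu>)
    = (\<integral>x. (\<Sum>j=1..n. ctr h ((T ^^ j) x))\<^sup>2 \<partial>\<mu>) / real n"
    by (simp add: power_divide)
  also have "\<dots> \<le> (real n * (var_const * mad h)) / real n"
    using variance_sum_le[OF h, of n] by (intro divide_right_mono) (auto simp: var_const_def)
  finally show ?thesis using False by simp
qed (use var_const_nonneg mad_nonneg in simp)

lemma expectation_abs_le_sqrt:
  assumes "bm u" shows "(\<integral>x. \<bar>u x\<bar> \<partial>\<mu>) \<le> sqrt (\<integral>x. (u x)\<^sup>2 \<partial>\<mu>)"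
proof (rule real_le_rsqrt)
  note i = bm_integrable[OF assms] bm_integrable[OF bm_mult[OF assms assms]]
  have "0 \<le> variance (\<lambda>x. \<bar>u x\<bar>)" by (rule variance_positive)
  also have "\<dots> = (\<integral>x. \<bar>u x\<bar>\<^sup>2 \<partial>\<mu>) - (\<integral>x. \<bar>u x\<bar> \<partial>\<mu>)\<^sup>2"
    using i by (intro variance_eq) (auto simp: power2_eq_square)
  finally show "(\<integral>x. \<bar>u x\<bar> \<partial>\<mu>)\<^sup>2 \<le> (\<integral>x. (u x)\<^sup>2 \<partial>\<mu>)" by simp
qed

lemma bm_norm_sum:
  assumes "bm h" shows "bm (\<lambda>x. (\<Sum>j=1..n. ctr h ((T ^^ j) x)) / sqrt (real n))"
proof -
  have "bm (\<lambda>x. (1 / sqrt (real n)) * (\<Sum>j=1..n. ctr h ((T ^^ j) x)))"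
    by (intro bm_cmult bm_sum bm_T_pow bm_ctr assms)
  then show ?thesis by simp
qed

lemma first_moment_le:
  assumes h: "bm h" "bv 6 h" "\<And>x. x \<in> space \<mu> \<Longrightarrow> \<bar>ctr h x\<bar> \<le> 1" and d: "mad h \<le> 2 * d"
  shows "(\<integral>x. \<bar>(\<Sum>j=1..n. ctr h ((T ^^ j) x)) / sqrt (real n)\<bar> \<partial>\<mu>) \<le> sqrt (2 * var_const) * sqrt d"
proof -
  have "(\<integral>x. \<bar>(\<Sum>j=1..n. ctr h ((T ^^ j) x)) / sqrt (real n)\<bar> \<partial>\<mu>)
    \<le> sqrt (\<integral>x. ((\<Sum>j=1..n. ctr h ((T ^^ j) x)) / sqrt (real n))\<^sup>2 \<partial>\<mu>)"
    by (rule expectation_abs_le_sqrt[OF bm_norm_sum[OF h(1)]])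
  also have "\<dots> \<le> sqrt (var_const * (2 * d))"
    using second_moment_le[OF h, of n] mult_left_mono[OF d var_const_nonneg]
    by (intro real_sqrt_le_mono) linarith
  also have "\<dots> = sqrt (2 * var_const) * sqrt d" by (simp add: real_sqrt_mult mult_ac)
  finally show ?thesis .
qed

definition proj_error :: "nat \<Rightarrow> real \<Rightarrow> real" where
  "proj_error m t = sqrt (2 * var_const) * (if \<bar>t\<bar>
      \<le> real m then sqrt (F (right_pt m t) - F t) else tail t)"

definition proj_bound :: "nat \<Rightarrow> real" where
  "proj_bound m = (\<integral>t. proj_error m t \<partial>lborel)"

lemma proj_error_measurable[measurable]: "proj_error m \<in> borel_measurable borel"
  unfolding proj_error_def[abs_def] by measurable

lemma proj_error_bounds: "0 \<le> proj_error m t" "proj_error m t \<le> sqrt (2 * var_const) * tail t"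
proof -
  have "F (right_pt m t) - F t \<le> tail2 t"
    using right_pt_bounds[where t=t and m=m] by (intro F_diff_tail) auto
  then have "sqrt (F (right_pt m t) - F t) \<le> tail t"
    unfolding tail_def by (rule real_sqrt_le_mono)
  then show "proj_error m t \<le> sqrt (2 * var_const) * tail t"
    unfolding proj_error_def using var_const_nonneg by (intro mult_left_mono) auto
  show "0 \<le> proj_error m t"
    unfolding proj_error_def using var_const_nonneg tail_bounds F_mono[of t "right_pt m t"]
        right_pt_bounds(1)[of t m] by auto
qed

lemma integrable_proj_error: "integrable lborel (proj_error m)"
  by (rule Bochner_Integration.integrable_bound[OF integrable_mult_right[where c="sqrt (2
      * var_const)", OF integrable_tail]])
     (use proj_error_bounds tail_bounds var_const_nonneg in \<open>auto intro!: AE_I2 simp: abs_mult\<close>)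

lemma proj_bound_tendsto: "proj_bound \<longlonglongrightarrow> 0"
proof -
  have "(\<lambda>m. \<integral>t. proj_error m t \<partial>lborel) \<longlonglongrightarrow> (\<integral>(t::real). 0 \<partial>lborel)"
  proof (rule integral_dominated_convergence[where w="\<lambda>t. sqrt (2 * var_const) * tail t"])
    show "AE t in lborel. (\<lambda>m. proj_error m t) \<longlonglongrightarrow> 0"
    proof (rule AE_I2)
      fix t :: real
      obtain m0 :: nat where m0: "\<bar>t\<bar> \<le> real m0" using real_arch_simple by blast
      have ev: "\<forall>\<^sub>F m in sequentially. sqrt (2 * var_const) * sqrt (F (right_pt m t) - F t)
          = proj_error m t"
        unfolding proj_error_def using m0 by (auto simp: eventually_sequentially intro!: exI[of _ m0])
      have "(\<lambda>m. sqrt (2 * var_const) * sqrt (F (right_pt m t) - F t))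
          \<longlonglongrightarrow> sqrt (2 * var_const) * sqrt (F t - F t)"
        by (intro tendsto_mult tendsto_real_sqrt tendsto_diff tendsto_const F_right_pt)
      then show "(\<lambda>m. proj_error m t) \<longlonglongrightarrow> 0" using tendsto_cong[OF ev] by simp
    qed
    show "AE t in lborel. norm (proj_error m t) \<le> sqrt (2 * var_const) * tail t" for m
      using proj_error_bounds by (intro AE_I2) auto
  qed (auto intro!: integrable_mult_right integrable_tail)
  then show ?thesis by (simp add: proj_bound_def[abs_def])
qed

lemma expectation_proj_error_le:
  "(\<integral>x. \<bar>emp n x t - step_proj m (emp_seq n x) t\<bar> \<partial>\<mu>) \<le> proj_error m t"
proof (cases "\<bar>t\<bar> \<le> real m")
  case True
  have le: "t \<le> right_pt m t" using right_pt_bounds(1)[of t m] by simp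
  have "\<bar>emp n x t - step_proj m (emp_seq n x) t\<bar>
      = \<bar>(\<Sum>j=1..n. ctr (slice t (right_pt m t)) ((T ^^ j) x)) / sqrt (real n)\<bar>" for x
    using True by (simp add: step_proj_def emp_seq_def right_pt_def[symmetric] emp_def ctr_slice
        sum_subtractf
        diff_divide_distrib abs_minus_commute)
  then show ?thesis
    using True first_moment_le[OF bm_slice bv_slice abs_ctr_slice_le[OF le] mad_slice[OF le], of n]
    by (simp add: proj_error_def)
next
  case False
  have "mad (below t) \<le> 2 * tail2 t"
    using F_tail[of t t] by (simp add: mad_below mult.assoc)
  then show ?thesis
    using False first_moment_le[OF bm_below bv_below6 abs_ctr_below_le, of t "tail2 t" n]
    by (simp add: step_proj_def emp_def proj_error_def tail_def)
qed

lemma bm_emp: "bm (\<lambda>x. emp n x t)"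
  unfolding emp_def by (rule bm_norm_sum[OF bm_below])

lemma bm_step_proj_emp: "bm (\<lambda>x. step_proj m (emp_seq n x) t)"
  unfolding step_proj_def emp_seq_def by (cases "\<bar>t\<bar> \<le> real m") (auto intro: bm_emp bm_const)

lemma emp_proj_dist:
  "integrable \<mu> (\<lambda>x. dist (abs_l1 (emp n x)) (step_l1 m (emp_seq n x)))" (is "integrable _ ?d")
  "(\<integral>x. dist (abs_l1 (emp n x)) (step_l1 m (emp_seq n x)) \<partial>\<mu>) \<le> proj_bound m"
proof -
  interpret pair_sigma_finite \<mu> lborel ..
  have step[measurable]: "(\<lambda>(x, t). step_proj m (emp_seq n x) t) \<in> borel_measurable (\<mu> \<Otimes>\<^sub>M borel)"
  proof -
    have [measurable]: "(\<lambda>p. emp_seq n (fst p) j) \<in> borel_measurable (\<mu> \<Otimes>\<^sub>M borel)"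
      "(\<lambda>p. cell m j (snd p)) \<in> borel_measurable (\<mu> \<Otimes>\<^sub>M (borel :: real measure))" for j
      unfolding emp_seq_def
      by (rule measurable_compose[OF measurable_fst emp_measurable1] measurable_compose[OF
          measurable_snd cell_measurable])+
    show ?thesis unfolding step_proj_eq_sum split_beta' by measurable
  qed
  have "(\<lambda>(x, t). emp n x t) \<in> borel_measurable (\<mu> \<Otimes>\<^sub>M borel)" by (rule emp_joint_measurable)
  note [measurable] = this step
  have D[measurable]: "(\<lambda>(x, t). \<bar>emp n x t - step_proj m (emp_seq n x) t\<bar>) \<in> borel_measurable (\<mu>
      \<Otimes>\<^sub>M lborel)"
    by measurable
  have d: "?d x = (\<integral>t. \<bar>emp n x t - step_proj m (emp_seq n x) t\<bar> \<partial>lborel)" if "x \<in> space \<mu>" for x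
    unfolding step_l1_def by (rule dist_abs_l1) (auto intro: integrable_emp[OF that]
        integrable_step_proj)
  have dm: "?d \<in> borel_measurable \<mu>"
  proof (rule measurable_cong[THEN iffD2, OF d])
    show "(\<lambda>x. \<integral>t. \<bar>emp n x t - step_proj m (emp_seq n x) t\<bar> \<partial>lborel) \<in> borel_measurable \<mu>"
      by measurable
  qed
  have "(\<integral>\<^sup>+x. ennreal (?d x) \<partial>\<mu>) = (\<integral>\<^sup>+x. \<integral>\<^sup>+t. ennreal \<bar>emp n x t
      - step_proj m (emp_seq n x) t\<bar> \<partial>lborel \<partial>\<mu>)"
    using integrable_emp integrable_step_proj
    by (intro nn_integral_cong) (simp add: d nn_integral_eq_integral)
  also have "\<dots> = (\<integral>\<^sup>+t. \<integral>\<^sup>+x. ennreal \<bar>emp n x t - step_proj m (emp_seq n x) t\<bar> \<partial>\<mu> \<partial>lborel)"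
    by (rule Fubini'[symmetric]) (use D in measurable)
  also have "\<dots> \<le> (\<integral>\<^sup>+t. ennreal (proj_error m t) \<partial>lborel)"
  proof (rule nn_integral_mono)
    fix t :: real
    have "(\<integral>\<^sup>+x. ennreal \<bar>emp n x t - step_proj m (emp_seq n x) t\<bar> \<partial>\<mu>)
        = ennreal (\<integral>x. \<bar>emp n x t - step_proj m (emp_seq n x) t\<bar> \<partial>\<mu>)"
      by (intro nn_integral_eq_integral integrable_abs bm_integrable bm_diff bm_emp
          bm_step_proj_emp) auto
    then show "(\<integral>\<^sup>+x. ennreal \<bar>emp n x t - step_proj m (emp_seq n x) t\<bar> \<partial>\<mu>) \<le> ennreal (proj_error m t)"
      using expectation_proj_error_le by (simp add: ennreal_leI)
  qed
  also have "\<dots> = ennreal (proj_bound m)"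
    unfolding proj_bound_def by (intro nn_integral_eq_integral integrable_proj_error) (use
        proj_error_bounds in auto)
  finally have le: "(\<integral>\<^sup>+x. ennreal (?d x) \<partial>\<mu>) \<le> ennreal (proj_bound m)" .
  show i: "integrable \<mu> ?d"
    by (rule integrableI_bounded[OF dm]) (use le in \<open>auto intro: le_less_trans\<close>)
  have "ennreal (\<integral>x. ?d x \<partial>\<mu>) \<le> ennreal (proj_bound m)"
    using le by (subst (asm) nn_integral_eq_integral[OF i]) auto
  moreover have "0 \<le> proj_bound m"
    unfolding proj_bound_def using proj_error_bounds by simp
  ultimately show "(\<integral>x. ?d x \<partial>\<mu>) \<le> proj_bound m" by simp
qed

definition lcov :: "real \<Rightarrow> real \<Rightarrow> real" where
  "lcov s t = long_run_cov (below s) (below t)"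

lemma bv_sum_below: "finite J \<Longrightarrow> \<exists>V. bv V (\<lambda>x. \<Sum>j\<in>J. a j * below (q j) x)"
proof (induction J rule: finite_induct)
  case empty
  then show ?case using bv_const[of 0] by auto
next
  case (insert j J)
  then show ?case using bv_add[OF bv_cmult[OF bv_below]] by fastforce
qed

lemma clt_below:
  assumes J: "finite J"
  shows "(\<lambda>n. \<integral>x. iexp (\<Sum>j\<in>J. a j * emp n x (q j)) \<partial>\<mu>)
    \<longlonglongrightarrow> complex_of_real (exp (- (\<Sum>i\<in>J. \<Sum>j\<in>J. a i * a j * lcov (q i) (q j)) / 2))"
proof -
  define h where "h x = (\<Sum>j\<in>J. a j * below (q j) x)" for x
  have h: "bm h" unfolding h_def[abs_def] by (intro bm_sum bm_cmult bm_below)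
  obtain V where V: "bv V h" using bv_sum_below[OF J, of a q] by (auto simp: h_def[abs_def])
  have ctr: "ctr h x = (\<Sum>j\<in>J. a j * ctr (below (q j)) x)" for x
    using bm_integrable[OF bm_below]
    by (simp add: ctr_def h_def right_diff_distrib sum_subtractf Bochner_Integration.integral_sum)
  have sum_emp: "(\<Sum>i=1..n. ctr h ((T ^^ i) x)) / sqrt (real n) = (\<Sum>j\<in>J. a j * emp n x (q j))" for n x
    unfolding ctr emp_def by (subst sum.swap) (simp add: sum_divide_distrib sum_distrib_left)
  have lrc: "long_run_cov h h = (\<Sum>i\<in>J. \<Sum>j\<in>J. a i * a j * lcov (q i) (q j))"
    unfolding h_def[abs_def] lcov_def by (rule long_run_cov_sum[of _ _ 3]) (rule bm_below bv_below)+
  show ?thesis using clt[OF h V] unfolding sum_emp lrc .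
qed

lemma psd_lcov: "psd (\<lambda>i j. lcov (q i) (q j))"
  unfolding psd_def
proof (intro conjI allI impI)
  show "lcov (q i) (q j) = lcov (q j) (q i)" for i j
    unfolding lcov_def by (rule long_run_cov_commute)
  fix S :: "nat set" and a :: "nat \<Rightarrow> real" assume S: "finite S"
  let ?v = "\<Sum>i\<in>S. \<Sum>j\<in>S. a i * a j * lcov (q i) (q j)"
  have "norm (complex_of_real (exp (- ?v / 2))) \<le> 1"
  proof (rule LIMSEQ_le_const2[OF tendsto_norm[OF clt_below[OF S]]])
    have "norm (\<integral>x. iexp (\<Sum>j\<in>S. a j * emp n x (q j)) \<partial>\<mu>) \<le> 1" for n
      by (rule norm_integral_le) (auto simp del: of_real_sum of_real_mult)
    then show "\<exists>N. \<forall>n\<ge>N. norm (\<integral>x. iexp (\<Sum>j\<in>S. a j * emp n x (q j)) \<partial>\<mu>) \<le> 1" by blast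
  qed
  then show "0 \<le> ?v" by simp
qed

lemma emp_seq_tight:
  assumes "0 < \<epsilon>"
  shows "\<exists>R. \<forall>n. prob {x\<in>space \<mu>. R < \<bar>emp_seq n x j\<bar>} \<le> \<epsilon>"
proof -
  define a where "a = var_const * mad (below (rat_point j))"
  have a: "0 \<le> a" using var_const_nonneg mad_nonneg by (simp add: a_def)
  define R where "R = sqrt (a / \<epsilon> + 1)"
  have R2: "R\<^sup>2 = a / \<epsilon> + 1" "0 < R\<^sup>2" "0 \<le> R" using a assms by (auto simp: R_def add_nonneg_pos)
  show ?thesis
  proof (intro exI[of _ R] allI)
    fix n
    have i: "integrable \<mu> (\<lambda>x. (emp_seq n x j)\<^sup>2)"
      unfolding emp_seq_def power2_eq_square by (intro bm_integrable bm_mult bm_emp)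
    have "prob {x\<in>space \<mu>. R < \<bar>emp_seq n x j\<bar>} \<le> prob {x\<in>space \<mu>. R\<^sup>2 \<le> (emp_seq n x j)\<^sup>2}"
    proof (rule finite_measure_mono)
      show "{x\<in>space \<mu>. R < \<bar>emp_seq n x j\<bar>} \<subseteq> {x\<in>space \<mu>. R\<^sup>2 \<le> (emp_seq n x j)\<^sup>2}"
      proof safe
        fix x assume "R < \<bar>emp_seq n x j\<bar>"
        then show "R\<^sup>2 \<le> (emp_seq n x j)\<^sup>2"
          using R2(3) power_mono[of R "\<bar>emp_seq n x j\<bar>" 2] by simp
      qed
      show "{x\<in>space \<mu>. R\<^sup>2 \<le> (emp_seq n x j)\<^sup>2} \<in> events"
        using i by measurable
    qed
    also have "\<dots> \<le> (\<integral>x. (emp_seq n x j)\<^sup>2 \<partial>\<mu>) / R\<^sup>2"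
      by (rule integral_Markov_inequality_measure[OF i]) (use R2 in auto)
    also have "\<dots> \<le> a / R\<^sup>2"
      unfolding a_def emp_seq_def emp_def using R2
      by (intro divide_right_mono second_moment_le bm_below bv_below6 abs_ctr_below_le) auto
    also have "\<dots> \<le> \<epsilon>" unfolding R2(1) using a assms by (simp add: field_simps add_nonneg_pos)
    finally show "prob {x\<in>space \<mu>. R < \<bar>emp_seq n x j\<bar>} \<le> \<epsilon>" .
  qed
qed

end

section \<open>Convergence in law of the empirical process\<close>

lemma lborel_product_integral:
  fixes u v :: "real \<Rightarrow> real"
  assumes u: "integrable lborel u" and v: "integrable lborel v"
  shows "integrable (lborel \<Otimes>\<^sub>M lborel) (\<lambda>(s, t). u s * v t)"
    and "(\<integral>(s, t). u s * v t \<partial>(lborel \<Otimes>\<^sub>M lborel)) = (\<integral>s. u s \<partial>lborel) * (\<integral>t. v t \<partial>lborel)"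
proof -
  have [measurable]: "u \<in> borel_measurable lborel" "v \<in> borel_measurable lborel" using u v by auto
  show i: "integrable (lborel \<Otimes>\<^sub>M lborel) (\<lambda>(s, t). u s * v t)"
  proof (rule lborel_pair.Fubini_integrable)
    show "integrable lborel (\<lambda>s. \<integral>t. norm (case (s, t) of (s, t) \<Rightarrow> u s * v t) \<partial>lborel)"
      using u v by (simp add: abs_mult)
    show "AE s in lborel. integrable lborel (\<lambda>t. case (s, t) of (s, t) \<Rightarrow> u s * v t)"
      using v by simp
  qed measurable
  show "(\<integral>(s, t). u s * v t \<partial>(lborel \<Otimes>\<^sub>M lborel)) = (\<integral>s. u s \<partial>lborel) * (\<integral>t. v t \<partial>lborel)"
    using lborel_pair.integral_fst'[OF i] by simp
qed

context monotone_observable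
begin

definition cov_const :: real where
  "cov_const = 3 * sqrt (C1 * 6) / (1 - sqrt \<rho>)"

lemma cov_const_nonneg: "0 \<le> cov_const"
  using sqrt_\<rho> C1_ge_1 by (simp add: cov_const_def)

lemma mad_below_le_tail:
  assumes "t \<le> d" "d \<le> t + 1" shows "mad (below d) \<le> 2 * (tail t)\<^sup>2"
  using F_tail[OF assms] by (simp add: mad_below tail_sq mult.assoc)

lemma sqrt_mad_le:
  assumes "mad u \<le> 2 * a\<^sup>2" "mad v \<le> 2 * b\<^sup>2" "0 \<le> a" "0 \<le> b"
  shows "sqrt (mad u * mad v) \<le> 2 * (a * b)"
proof (rule real_le_lsqrt)
  have "mad u * mad v \<le> (2 * a\<^sup>2) * (2 * b\<^sup>2)" by (intro mult_mono assms mad_nonneg) simp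
  then show "mad u * mad v \<le> (2 * (a * b))\<^sup>2" by (simp add: power_mult_distrib)
qed (use assms mad_nonneg in auto)

lemma lcov_le_tail:
  assumes "s \<le> d" "d \<le> s + 1" "t \<le> e" "e \<le> t + 1"
  shows "\<bar>lcov d e\<bar> \<le> cov_const * (2 * (tail s * tail t))"
proof -
  have "\<bar>lcov d e\<bar> \<le> cov_const * sqrt (mad (below d) * mad (below e))"
    unfolding lcov_def cov_const_def by (intro long_run_cov_le bm_below bv_below6 abs_ctr_below_le)
  also have "\<dots> \<le> cov_const * (2 * (tail s * tail t))"
    by (intro mult_left_mono sqrt_mad_le mad_below_le_tail assms tail_bounds cov_const_nonneg)
  finally show ?thesis .
qed

lemma long_run_cov_slice: "long_run_cov (slice s d) w
    = long_run_cov (below d) w - long_run_cov (below s) w"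
  if "bm w" "bv 3 w" for w
proof -
  have "long_run_cov (\<lambda>x. \<Sum>i\<in>UNIV. (if i then 1 else -1)
      * (if i then below d else below s) x) (\<lambda>x. \<Sum>j\<in>{True}. 1 * w x)
    = (\<Sum>i\<in>UNIV. \<Sum>j\<in>{True}. (if i then 1 else -1) * 1 * long_run_cov (if i then below d else below s) w)"
    by (rule long_run_cov_sum[of _ _ 3]) (auto intro: bm_below bv_below that)
  then show ?thesis by (simp add: UNIV_bool slice_def[abs_def])
qed

lemma lcov_diff_le:
  assumes "s \<le> d" "t \<le> e"
  shows "\<bar>lcov d e - lcov s t\<bar> \<le> cov_const * (2 * sqrt (F d - F s)) + cov_const * (2 * sqrt (F e
      - F t))"
proof -
  have mb: "mad (below r) \<le> 2 * 1\<^sup>2" for r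
    using mult_mono[OF F_bounds(2)[of r], of "1 - F r" 1] F_bounds[of r] by (simp add: mad_below)
  have *: "\<bar>long_run_cov (slice s d) (below r)\<bar> \<le> cov_const * (2 * sqrt (F d - F s))" if sd: "s \<le> d"
      for s d r
  proof -
    have "\<bar>long_run_cov (slice s d) (below r)\<bar> \<le> cov_const * sqrt (mad (slice s d) * mad (below r))"
      unfolding cov_const_def
      by (intro long_run_cov_le bm_below bv_below6 abs_ctr_below_le bm_slice bv_slice
          abs_ctr_slice_le sd)
    also have "\<dots> \<le> cov_const * (2 * (sqrt (F d - F s) * 1))"
      using mad_slice[OF sd] F_mono[OF sd]
      by (intro mult_left_mono sqrt_mad_le mb cov_const_nonneg) auto
    finally show ?thesis by simp
  qed
  have "lcov d e - lcov s t = long_run_cov (slice s d) (below e) + long_run_cov (slice t e) (below s)"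
    unfolding long_run_cov_slice[OF bm_below bv_below] lcov_def
    by (simp add: long_run_cov_commute[of "below s"])
  then show ?thesis using *[OF assms(1), of e] *[OF assms(2), of s] by linarith
qed

lemma lcov_right_pt: "(\<lambda>m. lcov (right_pt m s) (right_pt m t)) \<longlonglongrightarrow> lcov s t"
proof -
  have "(\<lambda>m. cov_const * (2 * sqrt (F (right_pt m s) - F s)) + cov_const * (2
      * sqrt (F (right_pt m t) - F t)))
    \<longlonglongrightarrow> cov_const * (2 * sqrt (F s - F s)) + cov_const * (2 * sqrt (F t - F t))"
    by (intro tendsto_add tendsto_mult tendsto_const tendsto_real_sqrt tendsto_diff F_right_pt)
  then have "(\<lambda>m. cov_const * (2 * sqrt (F (right_pt m s) - F s)) + cov_const * (2
      * sqrt (F (right_pt m t) - F t))) \<longlonglongrightarrow> 0"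
    by simp
  then have "(\<lambda>m. lcov (right_pt m s) (right_pt m t) - lcov s t) \<longlonglongrightarrow> 0"
    by (rule Lim_null_comparison[rotated])
       (simp add: lcov_diff_le less_imp_le[OF right_pt_bounds(1)])
  then show ?thesis by (simp add: LIM_zero_iff)
qed

definition step_cov :: "nat \<Rightarrow> (l1 \<Rightarrow> real) \<Rightarrow> (l1 \<Rightarrow> real) \<Rightarrow> real" where
  "step_cov m \<phi> \<psi> = (\<Sum>i\<in>grid m. \<Sum>j\<in>grid m.
     \<phi> (abs_l1 (cell m i)) * \<psi> (abs_l1 (cell m j)) * lcov (rat_point i) (rat_point j))"

lemma step_cov_commute: "step_cov m \<phi> \<psi> = step_cov m \<psi> \<phi>"
  unfolding step_cov_def lcov_def
  by (subst sum.swap) (simp add: long_run_cov_commute mult_ac)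

lemma step_cov_polarization:
  "step_cov m \<phi> \<psi> = (step_cov m (\<lambda>z. \<phi> z + \<psi> z) (\<lambda>z. \<phi> z + \<psi> z) - step_cov m (\<lambda>z. \<phi> z
      - \<psi> z) (\<lambda>z. \<phi> z - \<psi> z)) / 4"
proof -
  have "step_cov m (\<lambda>z. \<phi> z + \<psi> z) (\<lambda>z. \<phi> z + \<psi> z) - step_cov m (\<lambda>z. \<phi> z - \<psi> z) (\<lambda>z. \<phi> z - \<psi> z)
    = 2 * step_cov m \<phi> \<psi> + 2 * step_cov m \<psi> \<phi>"
    unfolding step_cov_def sum_distrib_left sum.distrib[symmetric] sum_subtractf[symmetric]
    by (intro sum.cong refl) (simp add: algebra_simps)
  then show ?thesis by (simp add: step_cov_commute[of m \<psi> \<phi>])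
qed

lemma step_cov_nonneg: "0 \<le> step_cov m \<phi> \<phi>"
  unfolding step_cov_def by (rule psd_quadratic[OF psd_lcov finite_grid])

lemma step_cov_tendsto:
  assumes g: "g \<in> linfty lborel" and h: "h \<in> linfty lborel"
  shows "(\<lambda>m. step_cov m (l1_pair g) (l1_pair h))
      \<longlonglongrightarrow> (\<integral>(s, t). g s * h t * lcov s t \<partial>(lborel \<Otimes>\<^sub>M lborel))"
proof -
  note [measurable] = linfty_measurable[OF g] linfty_measurable[OF h]
  define G where "G m s t = (\<Sum>i\<in>grid m. \<Sum>j\<in>grid m. cell m i s * cell m j t
      * lcov (rat_point i) (rat_point j))" for m s t
  have [measurable]: "(\<lambda>(s, t). G m s t) \<in> borel_measurable (lborel \<Otimes>\<^sub>M lborel)" for m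
    unfolding G_def split_beta' by measurable
  have G: "G m s t = (if \<bar>s\<bar> \<le> real m \<and> \<bar>t\<bar> \<le> real m then lcov (right_pt m s) (right_pt m t) else
      0)" for m s t
  proof -
    have "G m s t = step_proj m (\<lambda>i. step_proj m (\<lambda>j. lcov (rat_point i) (rat_point j)) t) s"
      unfolding G_def step_proj_eq_sum sum_distrib_right by (simp add: mult_ac)
    then show ?thesis by (simp add: step_proj_def right_pt_def)
  qed
  have G_lim: "(\<lambda>m. G m s t) \<longlonglongrightarrow> lcov s t" for s t
  proof -
    obtain m0 :: nat where m0: "max \<bar>s\<bar> \<bar>t\<bar> \<le> real m0" using real_arch_simple by blast
    have "\<forall>\<^sub>F m in sequentially. lcov (right_pt m s) (right_pt m t) = G m s t"
      unfolding G using m0 by (auto simp: eventually_sequentially intro!: exI[of _ m0])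
    then show ?thesis using tendsto_cong lcov_right_pt by fast
  qed
  have [measurable]: "(\<lambda>(s, t). lcov s t) \<in> borel_measurable (lborel \<Otimes>\<^sub>M lborel)"
    by (rule borel_measurable_LIMSEQ_real[where u="\<lambda>m (s, t). G m s t"]) (auto intro: G_lim)
  have G_le: "\<bar>G m s t\<bar> \<le> cov_const * (2 * (tail s * tail t))" for m s t
    unfolding G using lcov_le_tail[of s "right_pt m s" t "right_pt m t"] right_pt_bounds
        cov_const_nonneg tail_bounds
    by (auto simp: less_imp_le)
  have step: "step_cov m (l1_pair g) (l1_pair h)
      = (\<integral>(s, t). g s * h t * G m s t \<partial>(lborel \<Otimes>\<^sub>M lborel))" for m
  proof -
    note gi = linfty_integrable_mult[OF g integrable_cell[of m]] and hi
        = linfty_integrable_mult[OF h integrable_cell[of m]]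
    have "(\<integral>(s, t). g s * h t * G m s t \<partial>(lborel \<Otimes>\<^sub>M lborel))
      = (\<integral>p. (\<Sum>i\<in>grid m. \<Sum>j\<in>grid m. lcov (rat_point i) (rat_point j) *
          (case p of (s, t) \<Rightarrow> (g s * cell m i s) * (h t * cell m j t))) \<partial>(lborel \<Otimes>\<^sub>M lborel))"
      unfolding G_def split_beta' sum_distrib_left by (simp add: mult_ac)
    also have "\<dots> = (\<Sum>i\<in>grid m. \<Sum>j\<in>grid m. lcov (rat_point i) (rat_point j) *
        (\<integral>(s, t). (g s * cell m i s) * (h t * cell m j t) \<partial>(lborel \<Otimes>\<^sub>M lborel)))"
      using lborel_product_integral(1)[OF gi hi]
      by (simp add: Bochner_Integration.integral_sum)
    also have "\<dots> = step_cov m (l1_pair g) (l1_pair h)"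
      unfolding step_cov_def lborel_product_integral(2)[OF gi hi]
      by (simp add: l1_pair_abs[OF g integrable_cell] l1_pair_abs[OF h integrable_cell] mult_ac)
    finally show ?thesis by simp
  qed
  show ?thesis
    unfolding step
  proof (rule integral_dominated_convergence)
    show "integrable (lborel \<Otimes>\<^sub>M lborel) (\<lambda>p. 2 * cov_const * (case p of (s, t) \<Rightarrow> \<bar>g s * tail s\<bar>
        * \<bar>h t * tail t\<bar>))"
      by (intro integrable_mult_right lborel_product_integral integrable_abs linfty_integrable_mult
          g h integrable_tail)
    show "AE p in lborel \<Otimes>\<^sub>M lborel. (\<lambda>m. case p of (s, t) \<Rightarrow> g s * h t * G m s t)
        \<longlonglongrightarrow> (case p of (s, t) \<Rightarrow> g s * h t * lcov s t)"
      by (intro AE_I2) (auto intro!: tendsto_mult tendsto_const G_lim)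
    show "AE p in lborel \<Otimes>\<^sub>M lborel. norm (case p of (s, t) \<Rightarrow> g s * h t * G m s t)
      \<le> 2 * cov_const * (case p of (s, t) \<Rightarrow> \<bar>g s * tail s\<bar> * \<bar>h t * tail t\<bar>)" for m
    proof (intro AE_I2, clarify)
      fix s t
      have "\<bar>g s * h t\<bar> * \<bar>G m s t\<bar> \<le> \<bar>g s * h t\<bar> * (cov_const * (2 * (tail s * tail t)))"
        by (intro mult_left_mono G_le) simp
      then show "norm (g s * h t * G m s t) \<le> 2 * cov_const * (\<bar>g s * tail s\<bar> * \<bar>h t * tail t\<bar>)"
        using tail_bounds by (simp add: abs_mult mult_ac)
    qed
  qed measurable
qed

lemma bounded_linear_step_l1:
  assumes "bounded_linear \<phi>"
  shows "\<phi> (step_l1 m w) = (\<Sum>j\<in>grid m. w j * \<phi> (abs_l1 (cell m j)))"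
proof -
  interpret bounded_linear \<phi> by fact
  show ?thesis by (simp add: step_l1_eq_sum sum scaleR)
qed

theorem empirical_clt:
  obtains \<gamma> :: "l1 measure" where "centered_gaussian \<gamma>"
    "\<And>g h. g \<in> linfty lborel \<Longrightarrow> h \<in> linfty lborel \<Longrightarrow>
      (\<integral>z. l1_pair g z * l1_pair h z \<partial>\<gamma>) = (\<integral>(s, t). g s * h t * lcov s t \<partial>(lborel \<Otimes>\<^sub>M lborel))"
    "converges_in_law \<mu> (\<lambda>n x. abs_l1 (emp n x)) \<gamma>"
proof -
  obtain P :: "(nat \<Rightarrow> real) measure" and W :: "(nat \<Rightarrow> real) \<Rightarrow> nat \<Rightarrow> real" where
    P: "prob_space P" and W[measurable]: "W \<in> borel_measurable P"
    and W_char: "\<And>a J. (\<integral>x. iexp (\<Sum>j<J. a j * W x j) \<partial>P)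
      = complex_of_real (exp (- (\<Sum>i<J. \<Sum>j<J. a i * a j * lcov (rat_point i) (rat_point j)) / 2))"
    using gaussian_sequence_exists[OF psd_lcov] by blast
  interpret P: prob_space P by (rule P)
  have weak: "(\<lambda>n. \<integral>x. \<phi> (emp_seq n x) \<partial>\<mu>) \<longlonglongrightarrow> (\<integral>x. \<phi> (W x) \<partial>P)"
    if "continuous_on UNIV \<phi>" "bounded (range \<phi>)" for \<phi> :: "(nat \<Rightarrow> real) \<Rightarrow> real"
  proof (rule weak_convergence_sequences[OF prob_space_axioms P emp_seq_measurable W _ emp_seq_tight
      that])
    show "(\<lambda>n. \<integral>x. iexp (\<Sum>j<J. a j * emp_seq n x j) \<partial>\<mu>) \<longlonglongrightarrow> (\<integral>x. iexp (\<Sum>j<J. a j * W x j) \<partial>P)" for a J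
      unfolding W_char emp_seq_def by (rule clt_below) simp
  qed

  \<comment> \<open>Truncating the distance keeps the functional bounded, so that the bound passes to the weak limit.\<close>
  have step_dist: "(\<integral>x. min (dist (step_l1 a (W x)) (step_l1 b (W x))) 1 \<partial>P)
      \<le> proj_bound a + proj_bound b" for a b
  proof (rule LIMSEQ_le_const2)
    show "(\<lambda>n. \<integral>x. min (dist (step_l1 a (emp_seq n x)) (step_l1 b (emp_seq n x))) 1 \<partial>\<mu>)
      \<longlonglongrightarrow> (\<integral>x. min (dist (step_l1 a (W x)) (step_l1 b (W x))) 1 \<partial>P)"
      by (rule weak) (auto intro!: continuous_intros continuous_on_step_l1 boundedI[of _ 1])
    have "(\<integral>x. min (dist (step_l1 a (emp_seq n x)) (step_l1 b (emp_seq n x))) 1 \<partial>\<mu>)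
        \<le> proj_bound a + proj_bound b" for n
    proof -
      have "(\<integral>x. min (dist (step_l1 a (emp_seq n x)) (step_l1 b (emp_seq n x))) 1 \<partial>\<mu>)
        \<le> (\<integral>x. dist (abs_l1 (emp n x)) (step_l1 a (emp_seq n x))
            + dist (abs_l1 (emp n x)) (step_l1 b (emp_seq n x)) \<partial>\<mu>)"
      proof (rule integral_mono)
        have "continuous_on UNIV (\<lambda>w. min (dist (step_l1 a w) (step_l1 b w)) 1)"
          by (intro continuous_intros continuous_on_step_l1)
        from measurable_compose[OF emp_seq_measurable borel_measurable_continuous_onI[OF this]]
        show "integrable \<mu> (\<lambda>x. min (dist (step_l1 a (emp_seq n x)) (step_l1 b (emp_seq n x))) 1)"
          by (intro integrable_const_bound[of _ 1]) auto
        show "min (dist (step_l1 a (emp_seq n x)) (step_l1 b (emp_seq n x))) 1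
          \<le> dist (abs_l1 (emp n x)) (step_l1 a (emp_seq n x))
              + dist (abs_l1 (emp n x)) (step_l1 b (emp_seq n x))" for x
          using dist_triangle2[of "step_l1 a (emp_seq n x)" "step_l1 b (emp_seq n x)" "abs_l1 (emp
              n x)"]
          by (simp add: dist_commute min_le_iff_disj)
      qed (intro Bochner_Integration.integrable_add emp_proj_dist)
      also have "\<dots> \<le> proj_bound a + proj_bound b"
        by (subst Bochner_Integration.integral_add) (intro emp_proj_dist add_mono)+
      finally show ?thesis .
    qed
    then show "\<exists>N. \<forall>n\<ge>N. (\<integral>x. min (dist (step_l1 a (emp_seq n x)) (step_l1 b (emp_seq n x))) 1 \<partial>\<mu>)
        \<le> proj_bound a + proj_bound b"
      by blast
  qed

  have "\<exists>m. \<forall>k. k \<le> m k \<and> proj_bound (m k) \<le> (1 / 2) ^ k"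
  proof (intro choice allI)
    fix k :: nat
    have "\<forall>\<^sub>F m in sequentially. proj_bound m < (1 / 2) ^ k"
      by (rule order_tendstoD(2)[OF proj_bound_tendsto]) simp
    then obtain m0 where "\<And>m. m \<ge> m0 \<Longrightarrow> proj_bound m < (1 / 2) ^ k"
        by (auto simp: eventually_sequentially)
    from this[of "max k m0"] show "\<exists>m\<ge>k. proj_bound m \<le> (1 / 2) ^ k"
        by (intro exI[of _ "max k m0"]) auto
  qed
  then obtain m where m: "\<And>k. k \<le> m k" "\<And>k. proj_bound (m k) \<le> (1 / 2) ^ k" by blast
  have m_top: "filterlim m at_top sequentially"
    by (rule filterlim_at_top_mono[OF filterlim_ident]) (auto intro: always_eventually m(1))

  define D where "D k x = dist (step_l1 (m (Suc k)) (W x)) (step_l1 (m k) (W x))" for k x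
  have cD: "continuous_on UNIV (\<lambda>w. dist (step_l1 (m (Suc k)) w) (step_l1 (m k) w))" for k
    by (intro continuous_intros continuous_on_step_l1)
  have D[measurable]: "D k \<in> borel_measurable P" for k
    unfolding D_def by (rule measurable_compose[OF W borel_measurable_continuous_onI[OF cD]])
  have D_sum: "AE x in P. summable (\<lambda>k. D k x)"
  proof -
    have le: "(\<integral>x. min (D k x) 1 \<partial>P) \<le> 2 * (1 / 2) ^ k" for k
    proof -
      have "(\<integral>x. min (D k x) 1 \<partial>P) \<le> proj_bound (m (Suc k)) + proj_bound (m k)"
        unfolding D_def by (rule step_dist)
      also have "\<dots> \<le> (1 / 2) ^ Suc k + (1 / 2) ^ k" by (intro add_mono m)
      also have "\<dots> \<le> 2 * (1 / 2) ^ k" by simp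
      finally show ?thesis .
    qed
    have D0: "0 \<le> D k x" for k x by (simp add: D_def)
    have "AE x in P. summable (\<lambda>k. min (D k x) 1)"
    proof (rule AE_summable)
      show "integrable P (\<lambda>x. min (D k x) 1)" for k
        by (rule P.integrable_const_bound[of _ 1]) (auto simp: D0)
      show "summable (\<lambda>k. \<integral>x. min (D k x) 1 \<partial>P)"
        by (rule summable_comparison_test'[of "\<lambda>k. 2 * (1 / 2) ^ k" 0])
           (use le D0 in \<open>auto intro!: summable_mult summable_geometric\<close>)
    qed (simp add: D0)
    then show ?thesis
    proof eventually_elim
      case (elim x)
      have "\<forall>\<^sub>F k in sequentially. min (D k x) 1 < 1"
        by (rule order_tendstoD(2)[OF summable_LIMSEQ_zero[OF elim]]) simp
      then have "\<forall>\<^sub>F k in sequentially. min (D k x) 1 = D k x" by eventually_elim auto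
      from summable_cong[OF this] elim show ?case by simp
    qed
  qed

  \<comment> \<open>Set to zero off an event of full measure, so that the limit exists everywhere.\<close>
  define Zs where "Zs k x = (if (\<Sum>k. ennreal (D k x)) < \<infinity> then step_l1 (m k) (W x) else 0)" for k x
  have Zs_measurable: "Zs k \<in> borel_measurable P" for k
    unfolding Zs_def by measurable
  have "convergent (\<lambda>k. Zs k x)" for x
  proof (cases "(\<Sum>k. ennreal (D k x)) < \<infinity>")
    case True
    then have "summable (\<lambda>k. D k x)"
      by (intro summable_suminf_not_top) (auto simp: D_def)
    then have "summable (\<lambda>k. norm (step_l1 (m (Suc k)) (W x) - step_l1 (m k) (W x)))"
      by (simp add: D_def dist_norm)
    then obtain z where "(\<lambda>n. \<Sum>k<n. step_l1 (m (Suc k)) (W x) - step_l1 (m k) (W x)) \<longlonglongrightarrow> z"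
      by (rule l1_absolutely_summable)
    then have "(\<lambda>n. step_l1 (m n) (W x) - step_l1 (m 0) (W x)) \<longlonglongrightarrow> z"
      by (simp only: sum_lessThan_telescope[of "\<lambda>k. step_l1 (m k) (W x)"])
    from tendsto_add[OF this tendsto_const[of "step_l1 (m 0) (W x)"]] show ?thesis
      using True by (auto simp: Zs_def convergent_def)
  next
    case False
    then show ?thesis by (simp add: Zs_def convergent_const)
  qed
  then obtain Z where Zs_lim: "\<And>x. (\<lambda>k. Zs k x) \<longlonglongrightarrow> Z x" unfolding convergent_def by metis
  have Z[measurable]: "Z \<in> borel_measurable P"
    by (rule borel_measurable_LIMSEQ_metric[OF Zs_measurable Zs_lim])
  have Z_lim: "AE x in P. (\<lambda>k. step_l1 (m k) (W x)) \<longlonglongrightarrow> Z x"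
    using D_sum
  proof eventually_elim
    case (elim x)
    then have "(\<Sum>k. ennreal (D k x)) < \<infinity>"
      by (subst suminf_ennreal2) (auto simp: D_def)
    then show ?case using Zs_lim[of x] by (simp add: Zs_def)
  qed
  have step_Z: "(\<lambda>k. \<integral>x. \<psi> (step_l1 (m k) (W x)) \<partial>P) \<longlonglongrightarrow> (\<integral>x. \<psi> (Z x) \<partial>P)"
    if \<psi>: "continuous_on UNIV \<psi>" "\<And>z. norm (\<psi> z) \<le> B"
        for \<psi> :: "l1 \<Rightarrow> 'c::{banach, second_countable_topology}" and B
  proof (rule integral_dominated_convergence[where w="\<lambda>_. B"])
    have \<psi>m: "\<psi> \<in> borel_measurable borel" by (rule borel_measurable_continuous_onI[OF \<psi>(1)])
    show "(\<lambda>x. \<psi> (Z x)) \<in> borel_measurable P" by (rule measurable_compose[OF Z \<psi>m])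
    show "(\<lambda>x. \<psi> (step_l1 (m k) (W x))) \<in> borel_measurable P" for k
      by (rule measurable_compose[OF step_l1_measurable[OF W] \<psi>m])
    show "AE x in P. (\<lambda>k. \<psi> (step_l1 (m k) (W x))) \<longlonglongrightarrow> \<psi> (Z x)"
      using Z_lim by eventually_elim (rule continuous_on_tendsto_compose[OF \<psi>(1)], auto)
  qed (use \<psi>(2) in auto)

  define \<gamma> where "\<gamma> = distr P borel Z"
  have \<gamma>: "prob_space \<gamma>" unfolding \<gamma>_def by (rule P.prob_space_distr[OF Z])
  have gauss: "\<exists>\<sigma>\<ge>0. (\<lambda>k. step_cov (m k) \<phi> \<phi>) \<longlonglongrightarrow> \<sigma>\<^sup>2 \<and> distr \<gamma> borel \<phi> = gaussian_law \<sigma>"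
    if \<phi>: "bounded_linear \<phi>" for \<phi> :: "l1 \<Rightarrow> real"
  proof -
    have c\<phi>: "continuous_on UNIV \<phi>" by (rule linear_continuous_on[OF \<phi>])
    have m\<phi>[measurable]: "\<phi> \<in> borel_measurable borel" by (rule borel_measurable_continuous_onI[OF c\<phi>])
    have char: "(\<integral>x. iexp (t * \<phi> (step_l1 k (W x))) \<partial>P)
        = complex_of_real (exp (- (step_cov k \<phi> \<phi> * t\<^sup>2) / 2))" for t k
    proof -
      obtain J where J: "grid k \<subseteq> {..<J}" using finite_grid[of k] by (auto simp: finite_nat_iff_bounded)
      define a where "a j = (if j \<in> grid k then t * \<phi> (abs_l1 (cell k j)) else 0)" for j
      have sum_J: "(\<Sum>j<J. a j * r j) = (\<Sum>j\<in>grid k. t * \<phi> (abs_l1 (cell k j)) * r j)" for r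
        using J by (intro sum.mono_neutral_cong_right) (auto simp: a_def)
      have "t * \<phi> (step_l1 k (W x)) = (\<Sum>j<J. a j * W x j)" for x
        unfolding sum_J by (simp add: bounded_linear_step_l1[OF \<phi>] sum_distrib_left mult_ac)
      then have "(\<integral>x. iexp (t * \<phi> (step_l1 k (W x))) \<partial>P) = (\<integral>x. iexp (\<Sum>j<J. a j * W x j) \<partial>P)" by simp
      also have "\<dots> = complex_of_real (exp (- (\<Sum>i<J. \<Sum>j<J. a i * a j
          * lcov (rat_point i) (rat_point j)) / 2))"
        by (rule W_char)
      also have "(\<Sum>i<J. \<Sum>j<J. a i * a j * lcov (rat_point i) (rat_point j))
        = (\<Sum>i<J. a i * (\<Sum>j<J. a j * lcov (rat_point i) (rat_point j)))"
        by (simp add: sum_distrib_left mult.assoc)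
      also have "\<dots> = step_cov k \<phi> \<phi> * t\<^sup>2"
        unfolding sum_J step_cov_def by (simp add: sum_distrib_left sum_distrib_right
            power2_eq_square mult_ac)
      finally show ?thesis .
    qed
    have lim: "(\<lambda>k. complex_of_real (exp (- (step_cov (m k) \<phi> \<phi> * t\<^sup>2) / 2)))
        \<longlonglongrightarrow> (\<integral>x. iexp (t * \<phi> (Z x)) \<partial>P)" for t
      unfolding char[symmetric]
      by (rule step_Z[of "\<lambda>z. iexp (t * \<phi> z)" 1]) (auto intro!: continuous_intros c\<phi>)
    have "(\<lambda>x. \<phi> (Z x)) \<in> borel_measurable P" by measurable
    from gaussian_limit[OF P this lim step_cov_nonneg] obtain \<sigma> where
      "0 \<le> \<sigma>" "(\<lambda>k. step_cov (m k) \<phi> \<phi>) \<longlonglongrightarrow> \<sigma>\<^sup>2" "distr P borel (\<lambda>x. \<phi> (Z x)) = gaussian_law \<sigma>" by blast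
    moreover have "distr \<gamma> borel \<phi> = distr P borel (\<lambda>x. \<phi> (Z x))"
      unfolding \<gamma>_def by (subst distr_distr) (auto simp: comp_def)
    ultimately show ?thesis by auto
  qed
  have moment: "integrable \<gamma> (\<lambda>z. (\<phi> z)\<^sup>2)" "(\<lambda>k. step_cov (m k) \<phi> \<phi>) \<longlonglongrightarrow> (\<integral>z. (\<phi> z)\<^sup>2 \<partial>\<gamma>)"
    if \<phi>: "bounded_linear \<phi>" for \<phi> :: "l1 \<Rightarrow> real"
  proof -
    have [measurable]: "\<phi> \<in> borel_measurable borel"
      by (rule borel_measurable_continuous_onI[OF linear_continuous_on[OF \<phi>]])
    have \<phi>m: "\<phi> \<in> borel_measurable \<gamma>" by (simp add: \<gamma>_def)
    obtain \<sigma> where \<sigma>: "0 \<le> \<sigma>" "(\<lambda>k. step_cov (m k) \<phi> \<phi>) \<longlonglongrightarrow> \<sigma>\<^sup>2" "distr \<gamma> borel \<phi> = gaussian_law \<sigma>"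
      using gauss[OF \<phi>] by blast
    from gaussian_law_second_moment[OF \<sigma>(1)] have "has_bochner_integral (distr \<gamma> borel \<phi>) (\<lambda>x. x\<^sup>2)
        (\<sigma>\<^sup>2)"
      unfolding \<sigma>(3) .
    then have *: "integrable (distr \<gamma> borel \<phi>) (\<lambda>x. x\<^sup>2)" "(\<integral>x. x\<^sup>2 \<partial>distr \<gamma> borel \<phi>) = \<sigma>\<^sup>2"
      by (auto simp: has_bochner_integral_iff)
    show "integrable \<gamma> (\<lambda>z. (\<phi> z)\<^sup>2)" using *(1) by (subst (asm) integrable_distr_eq) (auto simp: \<phi>m)
    show "(\<lambda>k. step_cov (m k) \<phi> \<phi>) \<longlonglongrightarrow> (\<integral>z. (\<phi> z)\<^sup>2 \<partial>\<gamma>)"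
      using *(2) \<sigma>(2) by (subst (asm) integral_distr) (auto simp: \<phi>m)
  qed
  show thesis
  proof (rule that[of \<gamma>])
    show "centered_gaussian \<gamma>"
      unfolding centered_gaussian_def
    proof (intro conjI allI impI)
      show "sets \<gamma> = sets borel" by (simp add: \<gamma>_def)
      fix \<phi> :: "l1 \<Rightarrow> real" assume "bounded_linear \<phi>"
      then show "\<exists>\<sigma>\<ge>0. distr \<gamma> borel \<phi> =
        (if \<sigma> = 0 then return borel 0 else density lborel (\<lambda>x. ennreal (normal_density 0 \<sigma> x)))"
        using gauss[of \<phi>] unfolding gaussian_law_def by blast
    qed (rule \<gamma>)
  next
    fix g h :: "real \<Rightarrow> real" assume g: "g \<in> linfty lborel" and h: "h \<in> linfty lborel"
    let ?a = "l1_pair g" and ?b = "l1_pair h"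
    have ab: "bounded_linear (\<lambda>z. ?a z + ?b z)" "bounded_linear (\<lambda>z. ?a z - ?b z)"
      by (intro bounded_linear_add bounded_linear_sub bounded_linear_l1_pair g h)+
    have "(\<lambda>k. step_cov (m k) ?a ?b) \<longlonglongrightarrow> ((\<integral>z. (?a z + ?b z)\<^sup>2 \<partial>\<gamma>) - (\<integral>z. (?a z - ?b z)\<^sup>2 \<partial>\<gamma>)) / 4"
      by (subst step_cov_polarization) (intro tendsto_divide tendsto_diff tendsto_const moment ab, simp)
    also have "((\<integral>z. (?a z + ?b z)\<^sup>2 \<partial>\<gamma>) - (\<integral>z. (?a z - ?b z)\<^sup>2 \<partial>\<gamma>)) / 4
      = (\<integral>z. ((?a z + ?b z)\<^sup>2 - (?a z - ?b z)\<^sup>2) / 4 \<partial>\<gamma>)"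
      using moment(1)[OF ab(1)] moment(1)[OF ab(2)] by simp
    also have "\<dots> = (\<integral>z. ?a z * ?b z \<partial>\<gamma>)"
      by (intro Bochner_Integration.integral_cong refl) (simp add: power2_eq_square algebra_simps)
    finally have "(\<lambda>k. step_cov (m k) ?a ?b) \<longlonglongrightarrow> (\<integral>z. ?a z * ?b z \<partial>\<gamma>)" .
    moreover have "(\<lambda>k. step_cov (m k) ?a ?b) \<longlonglongrightarrow> (\<integral>(s, t). g s * h t * lcov s t \<partial>(lborel \<Otimes>\<^sub>M lborel))"
      by (rule filterlim_compose[OF step_cov_tendsto[OF g h] m_top])
    ultimately show "(\<integral>z. ?a z * ?b z \<partial>\<gamma>) = (\<integral>(s, t). g s * h t * lcov s t \<partial>(lborel \<Otimes>\<^sub>M lborel))"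
      by (rule LIMSEQ_unique)
  next
    have int_\<gamma>: "(\<integral>z. \<psi> z \<partial>\<gamma>) = (\<integral>x. \<psi> (Z x) \<partial>P)" if "continuous_on UNIV \<psi>" for \<psi> :: "l1 \<Rightarrow> real"
      unfolding \<gamma>_def by (rule integral_distr[OF Z borel_measurable_continuous_onI[OF that]])
    have lip: "(\<lambda>n. \<integral>x. \<psi> (abs_l1 (emp n x)) \<partial>\<mu>) \<longlonglongrightarrow> (\<integral>x. \<psi> (Z x) \<partial>P)"
      if L: "0 \<le> L" and lip: "\<And>x y. \<bar>\<psi> x - \<psi> y\<bar> \<le> L * dist x y" and B: "\<And>x. \<bar>\<psi> x\<bar> \<le> B"
      for \<psi> :: "l1 \<Rightarrow> real" and L B
    proof (rule LIMSEQ_I)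
      fix r :: real assume r: "0 < r"
      have c\<psi>: "continuous_on UNIV \<psi>"
        using L lip by (intro lipschitz_on_continuous_on[of L]) (auto simp: lipschitz_on_def
            dist_real_def)
      have m\<psi>: "\<psi> \<in> borel_measurable borel" by (rule borel_measurable_continuous_onI[OF c\<psi>])
      have "(\<lambda>k. L * proj_bound (m k)) \<longlonglongrightarrow> L * 0"
        by (intro tendsto_mult tendsto_const filterlim_compose[OF proj_bound_tendsto m_top])
      then have "\<forall>\<^sub>F k in sequentially. L * proj_bound (m k) < r / 3"
        by (rule order_tendstoD(2)) (use r in simp)
      moreover have "\<forall>\<^sub>F k in sequentially. dist (\<integral>x. \<psi> (step_l1 (m k) (W x)) \<partial>P) (\<integral>x. \<psi> (Z x) \<partial>P)
          < r / 3"
        using B r by (intro tendstoD[OF step_Z[OF c\<psi>, of B]]) auto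
      ultimately obtain k where k: "L * proj_bound (m k) < r / 3"
        "\<bar>(\<integral>x. \<psi> (step_l1 (m k) (W x)) \<partial>P) - (\<integral>x. \<psi> (Z x) \<partial>P)\<bar> < r / 3"
        using eventually_happens[OF eventually_conj] by (force simp: dist_real_def)
      have "continuous_on UNIV (\<lambda>w. \<psi> (step_l1 (m k) w))"
        by (rule continuous_on_compose2[OF c\<psi> continuous_on_step_l1]) simp
      then have *: "(\<lambda>n. \<integral>x. \<psi> (step_l1 (m k) (emp_seq n x)) \<partial>\<mu>) \<longlonglongrightarrow> (\<integral>x. \<psi> (step_l1 (m k) (W x)) \<partial>P)"
        by (rule weak) (auto intro!: boundedI[of _ B] B)
      have "0 < r / 3" using r by simp
      from LIMSEQ_D[OF * this] obtain n0 where n0: "\<And>n. n \<ge> n0 \<Longrightarrow>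
          \<bar>(\<integral>x. \<psi> (step_l1 (m k) (emp_seq n x)) \<partial>\<mu>) - (\<integral>x. \<psi> (step_l1 (m k) (W x)) \<partial>P)\<bar> < r / 3"
        unfolding real_norm_def by blast
      have near: "\<bar>(\<integral>x. \<psi> (abs_l1 (emp n x)) \<partial>\<mu>) - (\<integral>x. \<psi> (step_l1 (m k) (emp_seq n x)) \<partial>\<mu>)\<bar>
          \<le> L * proj_bound (m k)" for n
      proof -
        have i: "integrable \<mu> (\<lambda>x. \<psi> (abs_l1 (emp n x)))" "integrable \<mu> (\<lambda>x. \<psi> (step_l1 (m k)
            (emp_seq n x)))"
          using measurable_compose[OF emp_l1_measurable m\<psi>] measurable_compose[OF
              step_l1_measurable[OF emp_seq_measurable] m\<psi>] B
          by (auto intro!: integrable_const_bound[of _ B])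
        have "\<bar>(\<integral>x. \<psi> (abs_l1 (emp n x)) \<partial>\<mu>) - (\<integral>x. \<psi> (step_l1 (m k) (emp_seq n x)) \<partial>\<mu>)\<bar>
          = \<bar>\<integral>x. \<psi> (abs_l1 (emp n x)) - \<psi> (step_l1 (m k) (emp_seq n x)) \<partial>\<mu>\<bar>"
          using i by simp
        also have "\<dots> \<le> (\<integral>x. \<bar>\<psi> (abs_l1 (emp n x)) - \<psi> (step_l1 (m k) (emp_seq n x))\<bar> \<partial>\<mu>)"
          by (rule integral_abs_bound)
        also have "\<dots> \<le> (\<integral>x. L * dist (abs_l1 (emp n x)) (step_l1 (m k) (emp_seq n x)) \<partial>\<mu>)"
          by (intro integral_mono integrable_abs Bochner_Integration.integrable_diff i
              integrable_mult_right emp_proj_dist lip)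
        also have "\<dots> \<le> L * proj_bound (m k)"
          using emp_proj_dist(2)[of n "m k"] L by (simp add: mult_left_mono)
        finally show ?thesis .
      qed
      show "\<exists>n0. \<forall>n\<ge>n0. norm ((\<integral>x. \<psi> (abs_l1 (emp n x)) \<partial>\<mu>) - (\<integral>x. \<psi> (Z x) \<partial>P)) < r"
      proof (intro exI[of _ n0] allI impI)
        fix n assume "n \<ge> n0"
        from n0[OF this] near[of n] k show "norm ((\<integral>x. \<psi> (abs_l1 (emp n x)) \<partial>\<mu>) - (\<integral>x. \<psi> (Z x) \<partial>P)) < r"
          unfolding real_norm_def by linarith
      qed
    qed
    show "converges_in_law \<mu> (\<lambda>n x. abs_l1 (emp n x)) \<gamma>"
      unfolding converges_in_law_def
    proof (intro conjI allI impI)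
      fix \<phi> :: "l1 \<Rightarrow> real" assume \<phi>: "continuous_on UNIV \<phi> \<and> bounded (range \<phi>)"
      have "(\<lambda>n. \<integral>x. \<phi> (abs_l1 (emp n x)) \<partial>\<mu>) \<longlonglongrightarrow> (\<integral>x. \<phi> (Z x) \<partial>P)"
        using \<phi> by (intro weak_convergence_lipschitz[OF prob_space_axioms P emp_l1_measurable Z
            lip]) auto
      then show "(\<lambda>n. \<integral>x. \<phi> (abs_l1 (emp n x)) \<partial>\<mu>) \<longlonglongrightarrow> (\<integral>z. \<phi> z \<partial>\<gamma>)"
        using int_\<gamma> \<phi> by simp
    qed (rule emp_l1_measurable)
  qed
qed

text \<open>The limiting covariance of the statement, which is not symmetric; \<open>lcov\<close> is its symmetric part.\<close>

definition half_cov :: "real \<Rightarrow> real \<Rightarrow> real" where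
  "half_cov s t = covk (below t) (below s) 0 + 2 * (\<Sum>k. covk (below t) (below s) (Suc k))"

lemma lcov_eq_half_cov: "lcov s t = (half_cov s t + half_cov t s) / 2"
  by (simp add: lcov_def long_run_cov_def half_cov_def covk_zero_commute[of "below t" "below s"]
      add_divide_distrib)

lemma half_cov_le: "\<bar>half_cov s t\<bar> \<le> cov_const * (2 * (tail s * tail t))"
proof -
  let ?c = "sqrt (C1 * 6)" and ?m = "sqrt (mad (below t) * mad (below s))"
  have nn: "0 \<le> ?c" "0 \<le> ?m" using C1_ge_1 mad_nonneg by auto
  have "\<bar>covk (below t) (below s) 0\<bar> \<le> ?c * ?m"
    using covk_le[OF bm_below bv_below6 bm_below abs_ctr_below_le, of t s 0] by simp
  also have "\<dots> \<le> (?c / (1 - sqrt \<rho>)) * ?m"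
    using sqrt_\<rho> nn by (intro mult_right_mono) (auto simp: field_simps intro: mult_left_le)
  finally have "\<bar>covk (below t) (below s) 0\<bar> \<le> (?c / (1 - sqrt \<rho>)) * ?m" .
  moreover have "\<bar>\<Sum>k. covk (below t) (below s) (Suc k)\<bar> \<le> (?c / (1 - sqrt \<rho>)) * ?m"
    by (rule suminf_covk_le[OF bm_below bv_below6 bm_below abs_ctr_below_le])
  ultimately have "\<bar>half_cov s t\<bar> \<le> cov_const * ?m" by (simp add: half_cov_def cov_const_def)
  also have "\<dots> \<le> cov_const * (2 * (tail t * tail s))"
    by (intro mult_left_mono sqrt_mad_le mad_below_le_tail tail_bounds cov_const_nonneg) auto
  finally show ?thesis by (simp add: mult_ac)
qed

lemma half_cov_measurable[measurable]: "(\<lambda>(s, t). half_cov s t) \<in> borel_measurable (lborel \<Otimes>\<^sub>M lborel)"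
proof -
  have [measurable]: "(\<lambda>p. covk (below (snd p)) (below (fst p)) k) \<in> borel_measurable (lborel \<Otimes>\<^sub>M
      lborel)" for k
  proof -
    have "(\<lambda>(p, x). below (snd p) x * below (fst p) ((T ^^ k) x)) \<in> borel_measurable ((lborel \<Otimes>\<^sub>M
        lborel) \<Otimes>\<^sub>M \<mu>)"
      unfolding below_def by measurable
    then have [measurable]: "(\<lambda>p. \<integral>x. below (snd p) x
        * below (fst p) ((T ^^ k) x) \<partial>\<mu>) \<in> borel_measurable (lborel \<Otimes>\<^sub>M lborel)"
      by (rule borel_measurable_lebesgue_integral)
    show ?thesis unfolding covk_def F_def[symmetric] by measurable
  qed
  show ?thesis unfolding half_cov_def split_beta' by measurable
qed

lemma integrable_half_cov_mult:
  assumes g: "g \<in> linfty lborel" and h: "h \<in> linfty lborel"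
  shows "integrable (lborel \<Otimes>\<^sub>M lborel) (\<lambda>(s, t). g s * h t * half_cov s t)"
proof (rule Bochner_Integration.integrable_bound)
  note [measurable] = linfty_measurable[OF g] linfty_measurable[OF h]
  show "integrable (lborel \<Otimes>\<^sub>M lborel) (\<lambda>p. 2 * cov_const * (case p of (s, t) \<Rightarrow> \<bar>g s * tail s\<bar>
      * \<bar>h t * tail t\<bar>))"
    by (intro integrable_mult_right lborel_product_integral integrable_abs linfty_integrable_mult g
        h integrable_tail)
  show "(\<lambda>(s, t). g s * h t * half_cov s t) \<in> borel_measurable (lborel \<Otimes>\<^sub>M lborel)" by measurable
  show "AE p in lborel \<Otimes>\<^sub>M lborel. norm (case p of (s, t) \<Rightarrow> g s * h t * half_cov s t)
      \<le> norm (2 * cov_const * (case p of (s, t) \<Rightarrow> \<bar>g s * tail s\<bar> * \<bar>h t * tail t\<bar>))"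
  proof (intro AE_I2, clarify)
    fix s t
    have "\<bar>g s * h t\<bar> * \<bar>half_cov s t\<bar> \<le> \<bar>g s * h t\<bar> * (cov_const * (2 * (tail s * tail t)))"
      by (intro mult_left_mono half_cov_le) simp
    then show "norm (g s * h t * half_cov s t)
        \<le> norm (2 * cov_const * (\<bar>g s * tail s\<bar> * \<bar>h t * tail t\<bar>))"
      using tail_bounds cov_const_nonneg by (simp add: abs_mult mult_ac)
  qed
qed

lemma half_cov_symmetrized:
  assumes g: "g \<in> linfty lborel" and h: "h \<in> linfty lborel"
  shows "((\<integral>(s, t). g s * h t * half_cov s t \<partial>(lborel \<Otimes>\<^sub>M lborel)) + (\<integral>(s, t). h s * g t
      * half_cov s t \<partial>(lborel \<Otimes>\<^sub>M lborel))) / 2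
    = (\<integral>(s, t). g s * h t * lcov s t \<partial>(lborel \<Otimes>\<^sub>M lborel))"
proof -
  note i1 = integrable_half_cov_mult[OF g h] and i2 = integrable_half_cov_mult[OF h g]
  have "(\<integral>(s, t). h s * g t * half_cov s t \<partial>(lborel \<Otimes>\<^sub>M lborel))
      = (\<integral>(s, t). h t * g s * half_cov t s \<partial>(lborel \<Otimes>\<^sub>M lborel))"
    using lborel_pair.integral_product_swap[of "\<lambda>(s, t). h s * g t * half_cov s t"] i2
        by (simp add: split_beta')
  moreover have "integrable (lborel \<Otimes>\<^sub>M lborel) (\<lambda>(s, t). h t * g s * half_cov t s)"
    using lborel_pair.integrable_product_swap[OF i2] by (simp add: split_beta')
  ultimately have "((\<integral>(s, t). g s * h t * half_cov s t \<partial>(lborel \<Otimes>\<^sub>M lborel)) + (\<integral>(s, t). h s * g t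
      * half_cov s t \<partial>(lborel \<Otimes>\<^sub>M lborel))) / 2
    = (\<integral>p. ((case p of (s, t) \<Rightarrow> g s * h t * half_cov s t) + (case p of (s, t) \<Rightarrow> h t * g s
        * half_cov t s)) / 2 \<partial>(lborel \<Otimes>\<^sub>M lborel))"
    using i1 by simp
  also have "\<dots> = (\<integral>(s, t). g s * h t * lcov s t \<partial>(lborel \<Otimes>\<^sub>M lborel))"
    by (intro Bochner_Integration.integral_cong refl) (auto simp: lcov_eq_half_cov algebra_simps)
  finally show ?thesis .
qed

lemma cov_term_eq_covk: "cov_term \<mu> (\<lambda>k x. f ((T ^^ k) x)) s t k = covk (below t) (below s) k"
proof -
  have "(\<integral>x. below t x * below s ((T ^^ k) x) \<partial>\<mu>) = (\<integral>x. indicator {x\<in>space \<mu>. f x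
      \<le> t \<and> f ((T ^^ k) x) \<le> s} x \<partial>\<mu>)"
    by (intro Bochner_Integration.integral_cong) (auto simp: below_def)
  then show ?thesis by (simp add: cov_term_def covk_def F_cdf[symmetric] F_def)
qed

lemma lim_cov_eq_half_cov: "lim_cov \<mu> (\<lambda>k x. f ((T ^^ k) x)) s t = half_cov s t"
proof -
  have "below t x * below s x = below (min t s) x" for x by (simp add: below_def)
  then have "covk (below t) (below s) 0 = F (min t s) - F t * F s"
    by (simp add: covk_def F_def)
  then show ?thesis by (simp add: lim_cov_def half_cov_def cov_term_eq_covk F_cdf[symmetric])
qed

end

theorem corollary3p7:
  fixes \<mu> :: "real measure" and T f :: "real \<Rightarrow> real" and Y :: "nat \<Rightarrow> real \<Rightarrow> real"
  assumes mu_space: "space \<mu> = {0..1}"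
    and mu_sets: "sets \<mu> = sets (restrict_space borel {0..1})"
    and mu_prob: "prob_space \<mu>"
    and T_meas: "T \<in> \<mu> \<rightarrow>\<^sub>M \<mu>"
    and T_pres: "distr \<mu> \<mu> T = \<mu>"
    and T_BV: "BV_contracting_map \<mu> T"
    and f_mono: "mono_on {0<..<1} f \<or> antimono_on {0<..<1} f"
    and tail: "(\<integral>\<^sup>+t\<in>{0..}. ennreal (sqrt (measure lborel {x \<in> {0<..<1}. \<bar>f x\<bar> > t})) \<partial>lborel) < \<infinity>"
    and tail_mu: "(\<integral>\<^sup>+t\<in>{0..}. ennreal (sqrt (measure \<mu> {x \<in> {0<..<1}. \<bar>f x\<bar> > t})) \<partial>lborel) < \<infinity>"
    and Y_def: "\<And>k x. Y k x = f ((T ^^ k) x)"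
  shows "(\<forall>n. \<forall>x\<in>{0..1}. integrable lborel (empirical_process \<mu> Y n x)) \<and>
    (\<forall>s t. summable (\<lambda>k. cov_term \<mu> Y s t (Suc k))) \<and>
    integrable (lborel \<Otimes>\<^sub>M lborel) (\<lambda>(s, t). lim_cov \<mu> Y s t) \<and>
    (\<exists>\<gamma> :: l1 measure. centered_gaussian \<gamma> \<and>
      (\<forall>g\<in>linfty lborel. \<forall>h\<in>linfty lborel.
        (\<integral>x. l1_pair g x * l1_pair h x \<partial>\<gamma>) = \<Phi>_sym \<mu> Y g h) \<and>
      converges_in_law \<mu> (\<lambda>n x. abs_l1 (empirical_process \<mu> Y n x)) \<gamma>)"
proof -
  from T_BV obtain K where K: "K \<in> \<mu> \<rightarrow>\<^sub>M prob_algebra \<mu>" "perron_frobenius \<mu> T (kernel_op K)"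
      "BV_contracting_kernel K"
    unfolding BV_contracting_map_def by blast
  then obtain C \<rho> where C: "C > 0" "\<rho> \<in> {0..<1}"
    "\<And>h n. h \<in> BV \<Longrightarrow> n \<ge> 1 \<Longrightarrow> variation01 ((kernel_op K ^^ n) h) \<le> ennreal (C * \<rho> ^ n) * variation01 h"
    unfolding BV_contracting_kernel_def by metis
  interpret prob_space \<mu> by (rule mu_prob)
  interpret monotone_observable \<mu> T K C \<rho> f
  proof unfold_locales
    show "0 \<le> \<rho>" "\<rho> < 1" using C(2) by auto
    show "variation01 ((kernel_op K ^^ n) h) \<le> ennreal (C * \<rho> ^ n) * variation01 h"
      if "h \<in> BV" "1 \<le> n" for h n
      using that by (rule C(3))
  qed (rule mu_space T_meas T_pres K C(1) mu_sets f_mono tail_mu)+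
  have Y: "Y = (\<lambda>k x. f ((T ^^ k) x))" by (intro ext Y_def)
  have one: "(\<lambda>_. 1) \<in> linfty lborel" by (auto simp: linfty_def intro!: exI[of _ 1])
  obtain \<gamma> :: "l1 measure" where \<gamma>: "centered_gaussian \<gamma>"
    "\<And>g h. g \<in> linfty lborel \<Longrightarrow> h \<in> linfty lborel \<Longrightarrow>
      (\<integral>z. l1_pair g z * l1_pair h z \<partial>\<gamma>) = (\<integral>(s, t). g s * h t * lcov s t \<partial>(lborel \<Otimes>\<^sub>M lborel))"
    "converges_in_law \<mu> (\<lambda>n x. abs_l1 (emp n x)) \<gamma>"
    using empirical_clt by blast
  show ?thesis
    unfolding Y \<Phi>_sym_def \<Phi>_def lim_cov_eq_half_cov cov_term_eq_covk empirical_process_eq_emp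
  proof (intro conjI allI ballI exI[of _ \<gamma>])
    show "integrable lborel (emp n x)" if "x \<in> {0..1}" for n x
      using that by (intro integrable_emp) (simp add: mu_space)
    show "summable (\<lambda>k. covk (below t) (below s) (Suc k))" for s t
      by (rule summable_covk[OF bm_below bv_below bm_below])
    show "integrable (lborel \<Otimes>\<^sub>M lborel) (\<lambda>(s, t). half_cov s t)"
      using integrable_half_cov_mult[OF one one] by simp
    show "(\<integral>x. l1_pair g x * l1_pair h x \<partial>\<gamma>) =
      ((\<integral>(s, t). g s * h t * half_cov s t \<partial>(lborel \<Otimes>\<^sub>M lborel)) + (\<integral>(s, t). h s * g t
          * half_cov s t \<partial>(lborel \<Otimes>\<^sub>M lborel))) / 2"
      if "g \<in> linfty lborel" "h \<in> linfty lborel" for g h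
      unfolding \<gamma>(2)[OF that] half_cov_symmetrized[OF that] ..
  qed (rule \<gamma>(1), rule \<gamma>(3))
qed

end
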